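(* Let $S\subseteq \mathbf{R}_+$ be finite or countable, $\mu$ a probability on $S$, $\psi$ a positive function on $S$, $c>0$ a constant, and $\kappa(x,y)=c\,\psi(x)\psi(y)$. Let $\mathcal V=(S,\mu,(x_1,\ldots,x_n)_{n\ge 1})$ be a vertex space on which $\kappa$ is graphical, and let $G^{\mathcal V}(n,\kappa)$ be the associated inhomogeneous random graph (definitions in the context). Assume that: (1) either $\sup_{x\in S}\psi(x)<\infty$; or, for some monotone increasing unbounded function $\psi_0$ and positive constants $A_1\le A_2$, one has $A_1\psi_0(x)\le\psi(x)\le A_2\psi_0(x)$ for all large $x$, and $\sum_{x\in S}e^{a\psi(x)}\mu(x)<\infty$ for some $a>0$; (2) for any $\varepsilon>0$ and $q>0$, $$\mathbf P\left\{\left|\frac{\#\{i:x_i=k\}}{n}-\mu(k)\right|\le\varepsilon e^{q\psi(k)}\mu(k)\ \text{ for all } k\in S\right\}\to 1\quad\text{as } n\to\infty .$$ Set $c^{cr}:=\left(\sum_{x\in S}\psi^2(x)\mu(x)\right)^{-1}$ and $$r(c)=\sup\Big\{z\ge 1:\ \sum_{x\in S}\mu(x)\psi(x)\,\mathbf E z^{\mathcal X(x)}<\infty\Big\}.$$ Then $$\frac{C_1\big(G^{\mathcal V}(n,\kappa)\big)}{\log n}\ \stackrel{P}{\longrightarrow}\ \frac{1}{\log r(c)}\quad\text{as } n\to\infty,$$ where $r(c)>1$ if $c<c^{cr}$ and $r(c)=1$ if $c\ge c^{cr}$.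
   Context: Vertex space: $S\subseteq\mathbf R_+$ is regarded as a separable metric space with Borel probability measure $\mu$ (write $\mu(x)=\mu(\{x\})$). For each $n$, $x_1,\ldots,x_n$ (which may depend on $n$) is a deterministic or random sequence of points of $S$ such that for every $\mu$-continuity set $A\subseteq S$, $\#\{i:x_i\in A\}/n\to\mu(A)$ in probability as $n\to\infty$. Random graph: given $x_1,\ldots,x_n$, the graph $G^{\mathcal V}(n,\kappa)$ has vertices $x_1,\ldots,x_n$ (the $i$-th vertex has type $x_i$; there are $n$ vertices, several may have the same type), and any two vertices $x_i,x_j$ are joined by an edge, independently of the other pairs, with probability $p_{x_i,x_j}(n)=\min\{c\,\psi(x_i)\psi(x_j)/n,\,1\}$. The kernel $\kappa$ is graphical on $\mathcal V$ if (i) $\kappa$ is continuous a.e. on $S\times S$; (ii) $\kappa\in L^1(S\times S,\mu\times\mu)$; (iii) $\frac1n\mathbf E\,e(G^{\mathcal V}(n,\kappa))\to\frac12\int_{S^2}\kappa(x,y)\,d\mu(x)d\mu(y)$, where $e(G)$ is the number of edges of $G$. $C_1(G)$ is the number of vertices of a largest connected component of $G$. Branching process: $B_\kappa(x)$ is the multi-type Galton–Watson process with type space $S$ starting with one particle of type $x\in S$, in which at every step each particle of type $u\in S$ is replaced, independently, by offspring whose number of type $y$ is $\mathrm{Po}(\kappa(u,y)\mu(y))$, independently for $y\in S$. $\mathcal X(x)\in\{1,2,\ldots\}\cup\{\infty\}$ is the total number of particles ever produced by $B_\kappa(x)$, including the initial one. For $z>1$, $z^\infty=\infty$, and $1^\infty=1$.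 Convention: $1/\log 1=+\infty$; convergence in probability to $+\infty$ means that for every $M$ the probability of exceeding $M$ tends to $1$. *)

theory Defs
  imports "HOL-Probability.Probability"
begin

section \<open>Convergence in probability\<close>

text \<open>
  The \<open>n\<close>-th random variable may live on its own probability space \<open>M n\<close>; the limit is a
  constant in the extended reals.
\<close>

definition tendsto_in_prob ::
    "(nat \<Rightarrow> 'a measure) \<Rightarrow> (nat \<Rightarrow> 'a \<Rightarrow> real) \<Rightarrow> ereal \<Rightarrow> bool" where
  "tendsto_in_prob M Y l \<longleftrightarrow>
     (case l of
        ereal a \<Rightarrow> \<forall>\<epsilon>>0. (\<lambda>n. \<P>(\<omega> in M n. \<bar>Y n \<omega> - a\<bar> > \<epsilon>)) \<longlonglongrightarrow> 0
      | PInfty \<Rightarrow> \<forall>B. (\<lambda>n. \<P>(\<omega> in M n. Y n \<omega> > B)) \<longlonglongrightarrow> 1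
      | MInfty \<Rightarrow> \<forall>B. (\<lambda>n. \<P>(\<omega> in M n. Y n \<omega> < B)) \<longlonglongrightarrow> 1)"


section \<open>Vertex spaces\<close>

definition count_in :: "(nat \<Rightarrow> real) \<Rightarrow> nat \<Rightarrow> real set \<Rightarrow> nat" where
  "count_in x n A = card {i \<in> {1..n}. x i \<in> A}"

text \<open>
  \<open>S\<close> is a countable set of non-negative reals with the topology inherited from the real line.
  Every subset of it is Borel, so that a Borel probability measure on \<open>S\<close> is a probability
  mass function supported in \<open>S\<close>.  The types \<open>X n 1, \<dots>, X n n\<close> are random variables on a
  probability space \<open>M n\<close>; a deterministic sequence is the case of constant functions.
\<close>

definition vertex_space ::
    "real set \<Rightarrow> real pmf \<Rightarrow> (nat \<Rightarrow> 'w measure) \<Rightarrow> (nat \<Rightarrow> nat \<Rightarrow> 'w \<Rightarrow> real) \<Rightarrow> bool" where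
  "vertex_space S \<mu> M X \<longleftrightarrow>
     S \<subseteq> {0..} \<and> countable S \<and> set_pmf \<mu> \<subseteq> S \<and>
     (\<forall>n\<ge>1. prob_space (M n)) \<and>
     (\<forall>n\<ge>1. \<forall>i\<in>{1..n}. X n i \<in> borel_measurable (M n) \<and> (\<forall>\<omega>\<in>space (M n). X n i \<omega> \<in> S)) \<and>
     (\<forall>A\<subseteq>S. measure_pmf.prob \<mu> (top_of_set S frontier_of A) = 0 \<longrightarrow>
        tendsto_in_prob M (\<lambda>n \<omega>. count_in (\<lambda>i. X n i \<omega>) n A / n) (measure_pmf.prob \<mu> A))"


section \<open>The random graph\<close>

text \<open>A simple graph on the vertex set \<open>{1..n}\<close> is given by its set of edges \<open>{i, j}\<close>.\<close>

definition component :: "nat \<Rightarrow> nat set set \<Rightarrow> nat \<Rightarrow> nat set" where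
  "component n E u = {v \<in> {1..n}. (u, v) \<in> {(a, b). {a, b} \<in> E}\<^sup>*}"

definition C1 :: "nat \<Rightarrow> nat set set \<Rightarrow> nat" where
  "C1 n E = Max ((\<lambda>u. card (component n E u)) ` {1..n})"

definition vertex_pairs :: "nat \<Rightarrow> (nat \<times> nat) set" where
  "vertex_pairs n = {(i, j). 1 \<le> i \<and> i < j \<and> j \<le> n}"

definition graph_given_types ::
    "nat \<Rightarrow> (real \<Rightarrow> real \<Rightarrow> real) \<Rightarrow> (nat \<Rightarrow> real) \<Rightarrow> nat set set pmf" where
  "graph_given_types n \<kappa> x =
     map_pmf (\<lambda>b. {{i, j} | i j. (i, j) \<in> vertex_pairs n \<and> b (i, j)})
       (Pi_pmf (vertex_pairs n) False (\<lambda>(i, j). bernoulli_pmf (min (\<kappa> (x i) (x j) / n) 1)))"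

text \<open>The law of the edge set, obtained by averaging over the random types.\<close>

definition random_graph ::
    "(nat \<Rightarrow> 'w measure) \<Rightarrow> (nat \<Rightarrow> nat \<Rightarrow> 'w \<Rightarrow> real) \<Rightarrow> (real \<Rightarrow> real \<Rightarrow> real) \<Rightarrow> nat
      \<Rightarrow> nat set set measure" where
  "random_graph M X \<kappa> n =
     Giry_Monad.bind (M n) (\<lambda>\<omega>. measure_pmf (graph_given_types n \<kappa> (\<lambda>i. X n i \<omega>)))"

definition graphical ::
    "real set \<Rightarrow> real pmf \<Rightarrow> (nat \<Rightarrow> 'w measure) \<Rightarrow> (nat \<Rightarrow> nat \<Rightarrow> 'w \<Rightarrow> real)
      \<Rightarrow> (real \<Rightarrow> real \<Rightarrow> real) \<Rightarrow> bool" where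
  "graphical S \<mu> M X \<kappa> \<longleftrightarrow>
     (AE p in pair_pmf \<mu> \<mu>. continuous (at p within S \<times> S) (\<lambda>(x, y). \<kappa> x y)) \<and>
     integrable (pair_pmf \<mu> \<mu>) (\<lambda>(x, y). \<kappa> x y) \<and>
     (\<lambda>n. (\<integral>E. real (card E) \<partial>random_graph M X \<kappa> n) / n)
       \<longlonglongrightarrow> 1/2 * (\<integral>(x, y). \<kappa> x y \<partial>pair_pmf \<mu> \<mu>)"

definition rank1_kernel :: "real \<Rightarrow> (real \<Rightarrow> real) \<Rightarrow> real \<Rightarrow> real \<Rightarrow> real" where
  "rank1_kernel c \<psi> x y = c * \<psi> x * \<psi> y"


section \<open>The branching process\<close>

text \<open>\<^const>\<open>poisson_pmf\<close> is only specified for positive rates.\<close>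

definition Po :: "real \<Rightarrow> nat pmf" where
  "Po r = (if r = 0 then return_pmf 0 else poisson_pmf r)"

text \<open>
  Particles are addressed as in the Ulam--Harris tree.  The initial particle is \<open>[]\<close>, and
  \<open>(y, j) # p\<close> is the \<open>j\<close>-th child of type \<open>y\<close> of the particle \<open>p\<close>.
  The variable \<open>N (p, y)\<close> is the number of children of type \<open>y\<close> of \<open>p\<close>.
\<close>

type_synonym address = "(real \<times> nat) list"

fun particle_type :: "real \<Rightarrow> address \<Rightarrow> real" where
  "particle_type x [] = x"
| "particle_type x ((y, j) # p) = y"

definition offspring_space ::
    "real set \<Rightarrow> real pmf \<Rightarrow> (real \<Rightarrow> real \<Rightarrow> real) \<Rightarrow> real \<Rightarrow> (address \<times> real \<Rightarrow> nat) measure" where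
  "offspring_space S \<mu> \<kappa> x =
     PiM (lists (S \<times> UNIV) \<times> S) (\<lambda>(p, y). measure_pmf (Po (\<kappa> (particle_type x p) y * pmf \<mu> y)))"

inductive_set particles :: "real set \<Rightarrow> (address \<times> real \<Rightarrow> nat) \<Rightarrow> address set"
  for S N where
  root: "[] \<in> particles S N"
| child: "p \<in> particles S N \<Longrightarrow> y \<in> S \<Longrightarrow> j < N (p, y) \<Longrightarrow> (y, j) # p \<in> particles S N"

definition total_progeny :: "real set \<Rightarrow> (address \<times> real \<Rightarrow> nat) \<Rightarrow> enat" where
  "total_progeny S N =
     (if finite (particles S N) then enat (card (particles S N)) else \<infinity>)"

definition power_enat :: "real \<Rightarrow> enat \<Rightarrow> ennreal" where
  "power_enat z m = (case m of enat k \<Rightarrow> ennreal (z ^ k) | \<infinity> \<Rightarrow> if z = 1 then 1 else \<infinity>)"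

definition progeny_gf ::
    "real set \<Rightarrow> real pmf \<Rightarrow> (real \<Rightarrow> real \<Rightarrow> real) \<Rightarrow> real \<Rightarrow> real \<Rightarrow> ennreal" where
  "progeny_gf S \<mu> \<kappa> x z = (\<integral>\<^sup>+N. power_enat z (total_progeny S N) \<partial>offspring_space S \<mu> \<kappa> x)"


section \<open>The critical value and the radius\<close>

definition c_cr :: "real set \<Rightarrow> real pmf \<Rightarrow> (real \<Rightarrow> real) \<Rightarrow> ennreal" where
  "c_cr S \<mu> \<psi> = inverse (\<Sum>\<^sub>\<infinity>x\<in>S. ennreal ((\<psi> x)\<^sup>2 * pmf \<mu> x))"

definition r_radius :: "real set \<Rightarrow> real pmf \<Rightarrow> (real \<Rightarrow> real) \<Rightarrow> real \<Rightarrow> ereal" where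
  "r_radius S \<mu> \<psi> c =
     Sup {ereal z | z. z \<ge> 1 \<and>
       (\<Sum>\<^sub>\<infinity>x\<in>S. ennreal (pmf \<mu> x * \<psi> x) * progeny_gf S \<mu> (rank1_kernel c \<psi>) x z) < \<infinity>}"

text \<open>
  \<open>1 / log r\<close> for \<open>1 \<le> r \<le> \<infinity>\<close>; since \<open>1 / 0 = \<infinity>\<close> on \<^typ>\<open>ereal\<close>, its value at \<open>r = 1\<close> is \<open>\<infinity>\<close>.
\<close>

definition inv_log :: "ereal \<Rightarrow> ereal" where
  "inv_log r = (if r = \<infinity> then 0 else 1 / ereal (ln (real_of_ereal r)))"


section \<open>The assumptions on the type distribution\<close>

definition growth_condition :: "real set \<Rightarrow> real pmf \<Rightarrow> (real \<Rightarrow> real) \<Rightarrow> bool" where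
  "growth_condition S \<mu> \<psi> \<longleftrightarrow>
     bdd_above (\<psi> ` S) \<or> (
     (\<exists>\<psi>\<^sub>0 A\<^sub>1 A\<^sub>2. mono_on {0..} \<psi>\<^sub>0 \<and> \<not> bdd_above (\<psi>\<^sub>0 ` {0..}) \<and> 0 < A\<^sub>1 \<and> A\<^sub>1 \<le> A\<^sub>2 \<and>
        (\<exists>x\<^sub>0. \<forall>x\<in>S. x \<ge> x\<^sub>0 \<longrightarrow> A\<^sub>1 * \<psi>\<^sub>0 x \<le> \<psi> x \<and> \<psi> x \<le> A\<^sub>2 * \<psi>\<^sub>0 x)) \<and>
     (\<exists>a>0. (\<lambda>x. exp (a * \<psi> x) * pmf \<mu> x) summable_on S))"

definition types_concentrated ::
    "real set \<Rightarrow> real pmf \<Rightarrow> (nat \<Rightarrow> 'w measure) \<Rightarrow> (nat \<Rightarrow> nat \<Rightarrow> 'w \<Rightarrow> real)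
      \<Rightarrow> (real \<Rightarrow> real) \<Rightarrow> bool" where
  "types_concentrated S \<mu> M X \<psi> \<longleftrightarrow>
     (\<forall>\<epsilon>>0. \<forall>q>0.
        (\<lambda>n. \<P>(\<omega> in M n. \<forall>k\<in>S.
           \<bar>count_in (\<lambda>i. X n i \<omega>) n {k} / n - pmf \<mu> k\<bar> \<le> \<epsilon> * exp (q * \<psi> k) * pmf \<mu> k))
        \<longlonglongrightarrow> 1)"

end

theory Submission
  imports Defs "HOL-Real_Asymp.Real_Asymp"
begin

text \<open>
  The kernel has rank one, so everything is governed by the single function
  \<open>f s = \<Sum>x. \<mu> x \<psi> x exp (c \<psi> x (s - m))\<close> with \<open>m = \<Sum>x. \<mu> x \<psi> x\<close>.  The generating function
  \<open>\<phi> x\<close> of the total progeny at \<open>z\<close> satisfies \<open>\<phi> x = z exp (c \<psi> x (s - m))\<close> with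
  \<open>s = \<Sum>x. \<mu> x \<psi> x \<phi> x\<close>, so that \<open>r\<close> is the supremum of the \<open>z\<close> with \<open>z f s \<le> s\<close> for some
  \<open>s \<ge> m\<close>.  Since \<open>f m = m\<close> and \<open>f\<close> is convex with slope \<open>c \<Sum>x. \<mu> x (\<psi> x)\<^sup>2\<close> at \<open>m\<close>, this
  locates the threshold.

  For the upper bound, the same \<open>\<phi>\<close>, perturbed to absorb the fluctuation of the types, bounds the
  expectation of \<open>z ^ card C\<close> for the component \<open>C\<close> of a vertex, through an exploration
  supermartingale; Markov's inequality and a union bound over the vertices conclude.  For the lower
  bound, restrict to finitely many types, thin the vertices slightly (or down to just below
  criticality), and count the components with a prescribed number of vertices of each type.  A
  weighted form of Cayley's formula gives the first moment, which optimises to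
  \<open>n powr (1 - \<alpha> ln r + o(1))\<close> for components of size \<open>\<alpha> ln n\<close>.  Disjoint components are almost
  independent, so the second moment method applies.
\<close>


section \<open>Exponential moments of the total progeny\<close>

text \<open>The condition z f(s) <= s says exactly that z exp (c \<psi> (s - m)) is a supersolution
  of the recursion for the generating function. With empirical in place of true frequencies the same
  inequality controls the graph. For z beyond r it fails strictly for every s > 0 (after lowering c
  to criticality if necessary), and the best exponent of the component count is the minimum of ln
  (f(s) / s), which then exceeds - ln z.

  The obstacle is uniformity. For the upper bound the types are unbounded and frequencies are known
  only up to a factor 1 + \<epsilon> exp (q \<psi>); one works strictly inside the admissible
  region, where the gap in s absorbs q and the gap in z absorbs \<epsilon>. For the lower bound the
  strict inequality for all s must survive the restriction to finitely many types and a further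
  decrease of the intensity. As s is unbounded, this is a compactness argument, in which a single
  type supplies exponential growth. The branching process is reached through truncations in
  generation, type and child index: its total size may be infinite, while each truncation obeys an
  exact recursion.\<close>

lemma nn_integral_PiM_disjoint_blocks:
  fixes f :: "'b \<Rightarrow> ('i \<Rightarrow> 'a) \<Rightarrow> ennreal"
  assumes prob: "\<And>i. i \<in> I \<Longrightarrow> prob_space (N i)"
    and B: "finite B" "\<And>b. b \<in> B \<Longrightarrow> L b \<subseteq> I" "disjoint_family_on L B"
    and f [measurable]: "\<And>b. b \<in> B \<Longrightarrow> f b \<in> borel_measurable (PiM I N)"
    and dep: "\<And>b \<omega> \<omega>'. b \<in> B \<Longrightarrow> (\<And>i. i \<in> L b \<Longrightarrow> \<omega> i = \<omega>' i) \<Longrightarrow> f b \<omega> = f b \<omega>'"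
  shows "(\<integral>\<^sup>+\<omega>. (\<Prod>b\<in>B. f b \<omega>) \<partial>PiM I N) = (\<Prod>b\<in>B. \<integral>\<^sup>+\<omega>. f b \<omega> \<partial>PiM I N)"
proof -
  interpret P: prob_space "PiM I N"
    by (rule prob_space_PiM) (rule prob)
  obtain \<omega>0 where \<omega>0: "\<omega>0 \<in> space (PiM I N)"
    using P.not_empty by blast
  have indep: "P.indep_vars N (\<lambda>i \<omega>. \<omega> i) I"
  proof (cases "I = {}")
    case True
    then show ?thesis
      unfolding P.indep_vars_def P.indep_sets_def by auto
  next
    case False
    have *: "distr (PiM I N) (N i) (\<lambda>\<omega>. \<omega> i) = N i" if "i \<in> I" for i
      using that by (intro distr_PiM_component prob)
    show ?thesis
    proof (subst P.indep_vars_iff_distr_eq_PiM')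
      show "distr (PiM I N) (PiM I N) (\<lambda>x. \<lambda>i\<in>I. x i) =
              Pi\<^sub>M I (\<lambda>i. distr (Pi\<^sub>M I N) (N i) (\<lambda>x. x i))"
      proof -
        have "distr (PiM I N) (PiM I N) (\<lambda>x. \<lambda>i\<in>I. x i) = distr (PiM I N) (PiM I N) (\<lambda>x. x)"
          by (intro distr_cong refl) (auto simp: space_PiM PiE_def extensional_def restrict_def)
        also have "\<dots> = PiM I N"
          by simp
        also have "\<dots> = Pi\<^sub>M I (\<lambda>i. distr (Pi\<^sub>M I N) (N i) (\<lambda>x. x i))"
          using * by (intro PiM_cong) auto
        finally show ?thesis .
      qed
    qed (use False in auto)
  qed
  \<comment> \<open>Each factor becomes a function of its own block by freezing all other
    coordinates at a fixed point \<open>\<omega>0\<close>. By \<open>dep\<close> this does not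
    change its value, and the independence of restrictions to disjoint blocks applies.\<close>
  define Y where "Y b \<omega> = f b (\<lambda>i\<in>I. if i \<in> L b then \<omega> i else \<omega>0 i)" for b \<omega>
  have Y: "Y b \<in> borel_measurable (PiM (L b) N)" if b: "b \<in> B" for b
  proof -
    have "(\<lambda>\<omega>. \<lambda>i\<in>I. if i \<in> L b then \<omega> i else \<omega>0 i) \<in> measurable (PiM (L b) N) (PiM I N)"
    proof (intro measurable_restrict)
      fix i assume i: "i \<in> I"
      show "(\<lambda>\<omega>. if i \<in> L b then \<omega> i else \<omega>0 i) \<in> measurable (PiM (L b) N) (N i)"
        using \<omega>0 i by (cases "i \<in> L b") (auto simp: space_PiM PiE_def Pi_def)
    qed
    from measurable_compose[OF this f[OF b]] show ?thesis
      by (simp add: Y_def[abs_def])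
  qed
  have "P.indep_vars (\<lambda>j. PiM (L j) N) (\<lambda>j \<omega>. restrict (\<lambda>i. \<omega> i) (L j)) B"
    using indep B(2,3) by (intro P.indep_vars_restrict[where I = I]) auto
  then have "P.indep_vars (\<lambda>_. borel) (\<lambda>j \<omega>. Y j (restrict (\<lambda>i. \<omega> i) (L j))) B"
    by (rule P.indep_vars_compose2) (rule Y)
  from P.indep_vars_nn_integral[OF B(1) this]
  have "(\<integral>\<^sup>+\<omega>. (\<Prod>b\<in>B. Y b (restrict \<omega> (L b))) \<partial>PiM I N)
      = (\<Prod>b\<in>B. \<integral>\<^sup>+\<omega>. Y b (restrict \<omega> (L b)) \<partial>PiM I N)"
    by simp
  moreover have "Y b (restrict \<omega> (L b)) = f b \<omega>" if "b \<in> B" for b \<omega>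
    unfolding Y_def using that B(2)[OF that] by (intro dep) auto
  ultimately show ?thesis
    by simp
qed

text \<open>The offspring variables seen from the \<open>j\<close>-th child of type \<open>y\<close>
  of the root. Addresses grow at the head, so the first-generation ancestor is the last entry of the
  list. The restriction keeps the result in the product space over the same index set.\<close>

definition subtree ::
    "real set \<Rightarrow> real \<Rightarrow> nat \<Rightarrow> (address \<times> real \<Rightarrow> nat) \<Rightarrow> address \<times> real \<Rightarrow> nat" where
  "subtree S y j N = (\<lambda>q\<in>lists (S \<times> UNIV) \<times> S. N (fst q @ [(y, j)], snd q))"

text \<open>Counts the particles of generation at most \<open>g\<close> whose line of descent,
  themselves included, uses only types in \<open>F\<close> and child indices below \<open>J\<close>.
  It is finite by construction and unfolds at the root, which is what integration needs.\<close>

fun truncated_progeny ::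
    "real set \<Rightarrow> real set \<Rightarrow> nat \<Rightarrow> nat \<Rightarrow> (address \<times> real \<Rightarrow> nat) \<Rightarrow> nat" where
  "truncated_progeny S F J 0 N = 1"
| "truncated_progeny S F J (Suc g) N =
     1 + (\<Sum>y\<in>F. \<Sum>j<J. if j < N ([], y) then truncated_progeny S F J g (subtree S y j N) else 0)"

section \<open>Self-similarity of the offspring space and the recursion for truncated generating
  functions\<close>

lemma prob_space_offspring_space: "prob_space (offspring_space S \<mu> \<kappa> x)"
  unfolding offspring_space_def
  by (intro prob_space_PiM) (auto simp: measure_pmf.prob_space_axioms)

lemma sets_offspring_space:
  "sets (offspring_space S \<mu> \<kappa> x) = sets (PiM (lists (S \<times> UNIV) \<times> S) (\<lambda>_. count_space UNIV))"
  unfolding offspring_space_def by (intro sets_PiM_cong) auto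

lemma measurable_offspring_component:
  assumes "q \<in> lists (S \<times> UNIV) \<times> S"
  shows "(\<lambda>N. N q) \<in> measurable (offspring_space S \<mu> \<kappa> x) (count_space UNIV)"
  unfolding measurable_cong_sets[OF sets_offspring_space refl]
  using assms by (rule measurable_component_singleton)

lemma subtree_measurable:
  assumes "y \<in> S"
  shows "subtree S y j \<in> measurable (offspring_space S \<mu> \<kappa> x) (offspring_space S \<mu> \<kappa> x')"
  unfolding measurable_cong_sets[OF sets_offspring_space sets_offspring_space]
  unfolding subtree_def
  using assms by (intro measurable_restrict measurable_component_singleton) auto

lemma particle_type_append: "particle_type x (p @ [(y, j)]) = particle_type y p"
  by (cases p) auto

text \<open>The branching property: the type of \<open>p @ [(y, j)]\<close> in the process from
  \<open>x\<close> is the type of \<open>p\<close> in the process from \<open>y\<close>, so the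
  shifted coordinates form an independent family with exactly the rates of a process started from
  \<open>y\<close>.\<close>

lemma distr_subtree:
  assumes "y \<in> S"
  shows "distr (offspring_space S \<mu> \<kappa> x) (offspring_space S \<mu> \<kappa> y) (subtree S y j)
           = offspring_space S \<mu> \<kappa> y"
proof -
  define I where "I = lists (S \<times> (UNIV :: nat set)) \<times> S"
  define h where "h q = (fst q @ [(y, j)], snd q)" for q :: "address \<times> real"
  define Q where "Q x' = (\<lambda>(p, y). measure_pmf (Po (\<kappa> (particle_type x' p) y * pmf \<mu> y)))" for x'
  have Qh: "(\<lambda>i. Q x (h i)) = Q y"
    by (auto simp: Q_def h_def particle_type_append fun_eq_iff)
  have "distr (PiM I (Q x)) (PiM I (\<lambda>i. Q x (h i))) (\<lambda>\<omega>. \<lambda>n\<in>I. \<omega> (h n)) = PiM I (\<lambda>i. Q x (h i))"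
    by (rule distr_PiM_reindex)
       (use assms in \<open>auto simp: Q_def I_def h_def inj_on_def measure_pmf.prob_space_axioms\<close>)
  then show ?thesis
    unfolding Qh unfolding offspring_space_def Q_def I_def h_def subtree_def by simp
qed

lemma truncated_progeny_measurable:
  assumes "F \<subseteq> S" "finite F"
  shows "truncated_progeny S F J g \<in> measurable (offspring_space S \<mu> \<kappa> x) (count_space UNIV)"
proof (induction g arbitrary: x)
  case (Suc g)
  have [measurable]: "(\<lambda>N. truncated_progeny S F J g (subtree S y j N))
      \<in> measurable (offspring_space S \<mu> \<kappa> x) (count_space UNIV)" if "y \<in> F" for y j
    using assms that by (intro measurable_compose[OF subtree_measurable[where x' = x] Suc.IH]) auto
  have [measurable]: "(\<lambda>N. N ([], y)) \<in> measurable (offspring_space S \<mu> \<kappa> x) (count_space UNIV)"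
    if "y \<in> F" for y
    using assms that by (intro measurable_offspring_component) auto
  have "(\<lambda>N. if j < N ([], y) then truncated_progeny S F J g (subtree S y j N) else 0)
      \<in> borel_measurable (offspring_space S \<mu> \<kappa> x)" if "y \<in> F" for y j
    unfolding measurable_cong_sets[OF refl sets_borel_eq_count_space] using that by measurable
  then have "(\<lambda>N. truncated_progeny S F J (Suc g) N) \<in> borel_measurable (offspring_space S \<mu> \<kappa> x)"
    unfolding truncated_progeny.simps by (intro borel_measurable_add borel_measurable_sum) auto
  then show ?case
    unfolding measurable_cong_sets[OF refl sets_borel_eq_count_space] .
next
  case 0
  have "(\<lambda>N. truncated_progeny S F J 0 N) \<in> measurable (offspring_space S \<mu> \<kappa> x) (count_space UNIV)"
    by simp
  then show ?case .
qed

definition truncated_gf ::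
    "real set \<Rightarrow> real pmf \<Rightarrow> (real \<Rightarrow> real \<Rightarrow> real) \<Rightarrow> real set \<Rightarrow> nat \<Rightarrow> nat \<Rightarrow> real \<Rightarrow> real \<Rightarrow> ennreal" where
  "truncated_gf S \<mu> \<kappa> F J g z x =
     (\<integral>\<^sup>+N. ennreal (z ^ truncated_progeny S F J g N) \<partial>offspring_space S \<mu> \<kappa> x)"

lemma truncated_gf_0: "truncated_gf S \<mu> \<kappa> F J 0 z x = ennreal z"
proof -
  interpret prob_space "offspring_space S \<mu> \<kappa> x" by (rule prob_space_offspring_space)
  show ?thesis by (simp add: truncated_gf_def emeasure_space_1)
qed

text \<open>Splitting by the value of \<open>min t J\<close> replaces a product with a random number
  of factors by a finite sum of products of fixed length, to which independence can be
  applied.\<close>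

lemma sum_indicator_min:
  fixes a :: "nat \<Rightarrow> ennreal" and t J :: nat
  shows "a (min t J) = (\<Sum>s\<le>J. of_bool (min t J = s) * a s)"
proof -
  have "(\<Sum>s\<le>J. of_bool (min t J = s) * a s) = (\<Sum>s\<in>{min t J}. of_bool (min t J = s) * a s)"
    by (intro sum.mono_neutral_right) auto
  then show ?thesis by simp
qed

text \<open>The generating function recursion of a Galton--Watson process. The number of children of
  type \<open>y\<close> and the subtrees below these children read pairwise disjoint sets of
  coordinates, and so do the families belonging to different types.\<close>

lemma truncated_gf_Suc:
  assumes F: "F \<subseteq> S" "finite F" and z: "z \<ge> 0"
  shows "truncated_gf S \<mu> \<kappa> F J (Suc g) z x =
    ennreal z * (\<Prod>y\<in>F. \<integral>\<^sup>+t. truncated_gf S \<mu> \<kappa> F J g z y ^ min t J \<partial>Po (\<kappa> x y * pmf \<mu> y))"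
proof -
  define I where "I = lists (S \<times> (UNIV :: nat set)) \<times> S"
  define Q where "Q = (\<lambda>(p, y). measure_pmf (Po (\<kappa> (particle_type x p) y * pmf \<mu> y)))"
  define \<Omega> where "\<Omega> = PiM I Q"
  have \<Omega>: "offspring_space S \<mu> \<kappa> x = \<Omega>"
    by (simp add: \<Omega>_def Q_def I_def offspring_space_def)
  interpret P: prob_space \<Omega>
    unfolding \<Omega>[symmetric] by (rule prob_space_offspring_space)
  have Q: "prob_space (Q q)" for q
    by (cases q) (simp add: Q_def measure_pmf.prob_space_axioms)
  define T where "T y j N = ennreal (z ^ truncated_progeny S F J g (subtree S y j N))" for y j N
  define D where "D y j = (\<lambda>q. (fst q @ [(y, j)], snd q)) ` I" for y j
  have Tm [measurable]: "T y j \<in> borel_measurable \<Omega>" if "y \<in> F" for y j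
  proof -
    have [measurable]: "(\<lambda>N. truncated_progeny S F J g (subtree S y j N)) \<in> measurable \<Omega> (count_space UNIV)"
      unfolding \<Omega>[symmetric]
      using F that by (intro measurable_compose[OF subtree_measurable truncated_progeny_measurable]) auto
    show ?thesis unfolding T_def by measurable
  qed
  have Tint: "(\<integral>\<^sup>+N. T y j N \<partial>\<Omega>) = truncated_gf S \<mu> \<kappa> F J g z y" if "y \<in> F" for y j
  proof -
    have [measurable]: "truncated_progeny S F J g \<in> measurable (offspring_space S \<mu> \<kappa> y) (count_space UNIV)"
      using F by (intro truncated_progeny_measurable) auto
    have "truncated_gf S \<mu> \<kappa> F J g z y = (\<integral>\<^sup>+N. ennreal (z ^ truncated_progeny S F J g N)
       \<partial>distr \<Omega> (offspring_space S \<mu> \<kappa> y) (subtree S y j))"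
      using that F unfolding \<Omega>[symmetric] by (subst distr_subtree) (auto simp: truncated_gf_def)
    also have "\<dots> = (\<integral>\<^sup>+N. T y j N \<partial>\<Omega>)"
      unfolding \<Omega>[symmetric] T_def using that F
      by (subst nn_integral_distr) (auto intro!: subtree_measurable)
    finally show ?thesis ..
  qed
  have Tdep: "T y j N = T y j N'" if "\<And>q. q \<in> D y j \<Longrightarrow> N q = N' q" for y j N N'
  proof -
    have "subtree S y j N = subtree S y j N'"
      unfolding subtree_def by (intro restrict_ext that) (auto simp: D_def I_def)
    then show ?thesis by (simp add: T_def)
  qed
  have Nm [measurable]: "(\<lambda>N. N ([], y)) \<in> measurable \<Omega> (count_space UNIV)" if "y \<in> F" for y
    unfolding \<Omega>[symmetric] using F that by (intro measurable_offspring_component) auto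
  have DI: "D y j \<subseteq> I" if "y \<in> F" for y j
    using F that by (auto simp: D_def I_def)
  have rootI: "([], y) \<in> I" if "y \<in> F" for y
    using F that by (auto simp: I_def)
  define G where "G y N = (\<Prod>j<min (N ([], y)) J. T y j N)" for y N
  have Gsum: "G y N = (\<Sum>s\<le>J. of_bool (min (N ([], y)) J = s) * (\<Prod>j<s. T y j N))" for y N
    unfolding G_def by (rule sum_indicator_min[of "\<lambda>s. \<Prod>j<s. T y j N"])
  have Gm [measurable]: "G y \<in> borel_measurable \<Omega>" if "y \<in> F" for y
  proof -
    have "(\<lambda>N. of_bool (min (N ([], y)) J = s) * (\<Prod>j<s. T y j N)) \<in> borel_measurable \<Omega>" for s
    proof (intro borel_measurable_times_ennreal borel_measurable_prod_ennreal)
      show "(\<lambda>N. of_bool (min (N ([], y)) J = s) :: ennreal) \<in> borel_measurable \<Omega>"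
        by (rule measurable_compose[OF Nm[OF that], where g = "\<lambda>t. of_bool (min t J = s)"]) simp
    qed (use that in auto)
    then show ?thesis
      unfolding Gsum by (intro borel_measurable_sum) auto
  qed
  have Gint: "(\<integral>\<^sup>+N. G y N \<partial>\<Omega>) =
      (\<integral>\<^sup>+t. truncated_gf S \<mu> \<kappa> F J g z y ^ min t J \<partial>Po (\<kappa> x y * pmf \<mu> y))" if y: "y \<in> F" for y
  proof -
    have term_eq: "(\<integral>\<^sup>+N. of_bool (min (N ([], y)) J = s) * (\<Prod>j<s. T y j N) \<partial>\<Omega>) =
       (\<integral>\<^sup>+t. of_bool (min t J = s) \<partial>Po (\<kappa> x y * pmf \<mu> y)) * truncated_gf S \<mu> \<kappa> F J g z y ^ s"
      (is "?l = _") for s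
    proof -
      \<comment> \<open>\<open>None\<close> stands for the coordinate with the number of children of
        type \<open>y\<close>, \<open>Some j\<close> for the subtree of the \<open>j\<close>-th of
        them.\<close>
      define f :: "nat option \<Rightarrow> _ \<Rightarrow> ennreal" where
        "f b = (case b of None \<Rightarrow> (\<lambda>N. of_bool (min (N ([], y)) J = s)) | Some j \<Rightarrow> T y j)" for b
      define L where "L b = (case b of None \<Rightarrow> {([], y)} | Some j \<Rightarrow> D y j)" for b
      define B where "B = insert None (Some ` {..<s})"
      have "?l = (\<integral>\<^sup>+N. (\<Prod>b\<in>B. f b N) \<partial>\<Omega>)"
        by (simp add: B_def f_def prod.reindex)
      also have "\<dots> = (\<Prod>b\<in>B. \<integral>\<^sup>+N. f b N \<partial>\<Omega>)"
        unfolding \<Omega>_def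
      proof (rule nn_integral_PiM_disjoint_blocks)
        show "disjoint_family_on L B"
          by (auto simp: disjoint_family_on_def L_def D_def split: option.splits)
        show "f b \<in> borel_measurable (Pi\<^sub>M I Q)" if "b \<in> B" for b
        proof (cases b)
          case None
          show ?thesis unfolding \<Omega>_def[symmetric] f_def None option.case
            by (rule measurable_compose[OF Nm[OF y], where g = "\<lambda>t. of_bool (min t J = s)"]) simp
        next
          case (Some j)
          then show ?thesis unfolding \<Omega>_def[symmetric] f_def using Tm[OF y] by simp
        qed
        show "f b \<omega> = f b \<omega>'" if "b \<in> B" "\<And>i. i \<in> L b \<Longrightarrow> \<omega> i = \<omega>' i" for b \<omega> \<omega>'
          using that(2) Tdep[of y _ \<omega> \<omega>'] by (cases b) (auto simp: f_def L_def)
        show "L b \<subseteq> I" if "b \<in> B" for b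
          using DI[OF y] rootI[OF y] by (cases b) (auto simp: L_def)
      qed (auto simp: Q B_def)
      also have "\<dots> = (\<integral>\<^sup>+N. of_bool (min (N ([], y)) J = s) \<partial>\<Omega>) * (\<Prod>j<s. \<integral>\<^sup>+N. T y j N \<partial>\<Omega>)"
        by (simp add: B_def f_def prod.reindex)
      also have "(\<Prod>j<s. \<integral>\<^sup>+N. T y j N \<partial>\<Omega>) = truncated_gf S \<mu> \<kappa> F J g z y ^ s"
        using y by (simp add: Tint)
      also have "(\<integral>\<^sup>+N. of_bool (min (N ([], y)) J = s) \<partial>\<Omega>) =
          (\<integral>\<^sup>+t. of_bool (min t J = s) \<partial>distr \<Omega> (Q ([], y)) (\<lambda>N. N ([], y)))"
      proof (subst nn_integral_distr)
        show "(\<lambda>N. N ([], y)) \<in> \<Omega> \<rightarrow>\<^sub>M Q ([], y)"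
          unfolding \<Omega>_def using rootI[OF y] by measurable
      qed (auto simp: Q_def)
      also have "distr \<Omega> (Q ([], y)) (\<lambda>N. N ([], y)) = Q ([], y)"
        unfolding \<Omega>_def using rootI[OF y] by (intro distr_PiM_component Q)
      finally show ?thesis by (simp add: Q_def)
    qed
    have "(\<integral>\<^sup>+N. G y N \<partial>\<Omega>) = (\<Sum>s\<le>J. \<integral>\<^sup>+N. of_bool (min (N ([], y)) J = s) * (\<Prod>j<s. T y j N) \<partial>\<Omega>)"
      unfolding Gsum
    proof (rule nn_integral_sum)
      fix s
      show "(\<lambda>N. of_bool (min (N ([], y)) J = s) * (\<Prod>j<s. T y j N)) \<in> borel_measurable \<Omega>"
      proof (intro borel_measurable_times_ennreal borel_measurable_prod_ennreal)
        show "(\<lambda>N. of_bool (min (N ([], y)) J = s) :: ennreal) \<in> borel_measurable \<Omega>"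
          by (rule measurable_compose[OF Nm[OF y], where g = "\<lambda>t. of_bool (min t J = s)"]) simp
      qed (use y in auto)
    qed
    also have "\<dots> = (\<integral>\<^sup>+t. truncated_gf S \<mu> \<kappa> F J g z y ^ min t J \<partial>Po (\<kappa> x y * pmf \<mu> y))"
      unfolding term_eq
      by (subst sum_indicator_min[of "\<lambda>s. truncated_gf S \<mu> \<kappa> F J g z y ^ s"], subst nn_integral_sum)
         (auto intro!: sum.cong simp: nn_integral_multc simp del: sum_of_bool_mult_eq)
    finally show ?thesis .
  qed
  have pow: "ennreal (z ^ truncated_progeny S F J (Suc g) N) = ennreal z * (\<Prod>y\<in>F. G y N)" for N
  proof -
    have "(\<Sum>j<J. if j < N ([], y) then truncated_progeny S F J g (subtree S y j N) else 0)
        = (\<Sum>j<min (N ([], y)) J. truncated_progeny S F J g (subtree S y j N))" for y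
      by (subst sum.inter_filter[symmetric]) (auto intro!: sum.cong)
    then have eq: "z ^ truncated_progeny S F J (Suc g) N =
        z * (\<Prod>y\<in>F. \<Prod>j<min (N ([], y)) J. z ^ truncated_progeny S F J g (subtree S y j N))"
      by (simp add: power_sum)
    show ?thesis
      unfolding eq using z by (simp add: G_def T_def ennreal_mult prod_nonneg prod_ennreal)
  qed
  have "truncated_gf S \<mu> \<kappa> F J (Suc g) z x = (\<integral>\<^sup>+N. ennreal z * (\<Prod>y\<in>F. G y N) \<partial>\<Omega>)"
    unfolding truncated_gf_def pow \<Omega> ..
  also have "\<dots> = ennreal z * (\<integral>\<^sup>+N. (\<Prod>y\<in>F. G y N) \<partial>\<Omega>)"
    by (intro nn_integral_cmult) auto
  \<comment> \<open>A second use of independence, now across types: the block of \<open>y\<close>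
    consists of its count together with all its subtrees.\<close>
  also have "(\<integral>\<^sup>+N. (\<Prod>y\<in>F. G y N) \<partial>\<Omega>) = (\<Prod>y\<in>F. \<integral>\<^sup>+N. G y N \<partial>\<Omega>)"
    unfolding \<Omega>_def
  proof (rule nn_integral_PiM_disjoint_blocks)
    show "disjoint_family_on (\<lambda>y. insert ([], y) (\<Union>j. D y j)) F"
      by (auto simp: disjoint_family_on_def D_def)
    show "G y \<omega> = G y \<omega>'" if "y \<in> F" "\<And>i. i \<in> insert ([], y) (\<Union>j. D y j) \<Longrightarrow> \<omega> i = \<omega>' i" for y \<omega> \<omega>'
    proof -
      have "T y j \<omega> = T y j \<omega>'" for j
        using that(2) by (intro Tdep) auto
      then show ?thesis using that(2)[of "([], y)"] by (simp add: G_def)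
    qed
    show "insert ([], y) (\<Union>j. D y j) \<subseteq> I" if "y \<in> F" for y
      using DI[OF that] rootI[OF that] by auto
  qed (use F Gm in \<open>auto simp: Q \<Omega>_def\<close>)
  finally show ?thesis
    by (simp add: Gint)
qed

lemma nn_integral_Po_power:
  assumes "r \<ge> 0" "a \<ge> 0"
  shows "(\<integral>\<^sup>+t. ennreal (a ^ t) \<partial>Po r) = ennreal (exp (r * (a - 1)))"
proof (cases "r = 0")
  case False
  then have r: "r > 0" using assms by simp
  have "(\<integral>\<^sup>+t. ennreal (a ^ t) \<partial>Po r) = (\<Sum>t. ennreal ((r * a) ^ t / fact t * exp (-r)))"
  proof -
    have "ennreal (pmf (poisson_pmf r) t) * ennreal (a ^ t) = ennreal ((r * a) ^ t / fact t * exp (-r))" for t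
    proof -
      have "pmf (poisson_pmf r) t * a ^ t = (r * a) ^ t / fact t * exp (-r)"
        using r by (simp add: power_mult_distrib)
      then show ?thesis
        using assms by (simp only: ennreal_mult'[symmetric] zero_le_power pmf_nonneg)
    qed
    then show ?thesis
      using r by (simp only: Po_def nn_integral_measure_pmf nn_integral_count_space_nat False if_False)
  qed
  also have "\<dots> = ennreal (exp (r * a) * exp (-r))"
  proof (rule suminf_ennreal_eq)
    show "(\<lambda>t. (r * a) ^ t / fact t * exp (- r)) sums (exp (r * a) * exp (- r))"
      using exp_converges[of "r * a"] by (intro sums_mult2) (simp add: divide_inverse_commute)
  qed (use r assms in simp)
  finally show ?thesis by (simp add: exp_add[symmetric] algebra_simps)
qed (simp add: Po_def)

section \<open>Truncations of the family tree and their monotone limit\<close>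

lemma Cons_in_particles_iff:
  "(y, j) # p \<in> particles S N \<longleftrightarrow> p \<in> particles S N \<and> y \<in> S \<and> j < N (p, y)"
  by (auto intro: particles.child elim: particles.cases)

lemma particles_in_lists: "p \<in> particles S N \<Longrightarrow> p \<in> lists (S \<times> UNIV)"
  by (induction rule: particles.induct) auto

text \<open>The inductive definition extends a particle at the youngest end; here the same set is
  read from the root, the form in which \<open>truncated_progeny\<close> recurses.\<close>

lemma append_in_particles_iff:
  "p @ [(y, j)] \<in> particles S N \<longleftrightarrow> y \<in> S \<and> j < N ([], y) \<and> p \<in> particles S (subtree S y j N)"
proof (induction p)
  case Nil
  then show ?case by (simp add: Cons_in_particles_iff particles.root)
next
  case (Cons q p)
  obtain y' j' where q: "q = (y', j')" by (cases q)
  have "(p, y') \<in> lists (S \<times> UNIV) \<times> S \<Longrightarrow> subtree S y j N (p, y') = N (p @ [(y, j)], y')"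
    by (simp add: subtree_def)
  then show ?case
    using Cons particles_in_lists[of p S "subtree S y j N"]
    by (auto simp: q Cons_in_particles_iff)
qed

definition truncated_particles ::
    "real set \<Rightarrow> real set \<Rightarrow> nat \<Rightarrow> nat \<Rightarrow> (address \<times> real \<Rightarrow> nat) \<Rightarrow> address set" where
  "truncated_particles S F J g N = {p \<in> particles S N. length p \<le> g \<and> set p \<subseteq> F \<times> {..<J}}"

lemma finite_truncated_particles: "finite F \<Longrightarrow> finite (truncated_particles S F J g N)"
  by (rule finite_subset[OF _ finite_lists_length_le[of "F \<times> {..<J}" g]])
     (auto simp: truncated_particles_def)

lemma truncated_particles_Suc:
  assumes "F \<subseteq> S"
  shows "truncated_particles S F J (Suc g) N = insert []
    (\<Union>(y, j)\<in>{(y, j). y \<in> F \<and> j < J \<and> j < N ([], y)}.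
      (\<lambda>p. p @ [(y, j)]) ` truncated_particles S F J g (subtree S y j N))"
proof (intro set_eqI)
  fix p
  show "p \<in> truncated_particles S F J (Suc g) N \<longleftrightarrow> p \<in> insert []
    (\<Union>(y, j)\<in>{(y, j). y \<in> F \<and> j < J \<and> j < N ([], y)}.
      (\<lambda>p. p @ [(y, j)]) ` truncated_particles S F J g (subtree S y j N))"
  proof (cases p rule: rev_cases)
    case Nil
    then show ?thesis by (simp add: truncated_particles_def particles.root)
  next
    case (snoc q e)
    obtain y j where e: "e = (y, j)" by (cases e)
    show ?thesis
      using assms by (auto simp: snoc e truncated_particles_def append_in_particles_iff image_iff)
  qed
qed

text \<open>Connects the recursive count, suited to integration, with a set of particles, from which
  monotonicity in the truncation and convergence to the whole tree can be read off.\<close>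

lemma truncated_progeny_eq_card:
  assumes F: "F \<subseteq> S" "finite F"
  shows "truncated_progeny S F J g N = card (truncated_particles S F J g N)"
proof (induction g arbitrary: N)
  case 0
  have "truncated_particles S F J 0 N = {[]}"
    by (auto simp: truncated_particles_def particles.root)
  then show ?case by simp
next
  case (Suc g)
  define P where "P = {(y, j). y \<in> F \<and> j < J \<and> j < N ([], y)}"
  define T where "T = (\<lambda>(y, j). (\<lambda>p. p @ [(y, j)]) ` truncated_particles S F J g (subtree S y j N))"
  have P: "P \<subseteq> F \<times> {..<J}" "finite P"
  proof -
    show "P \<subseteq> F \<times> {..<J}" by (auto simp: P_def)
    then show "finite P" using F finite_subset by blast
  qed
  have T: "finite (T e)" for e
    using F by (auto simp: T_def finite_truncated_particles split: prod.splits)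
  have "truncated_particles S F J (Suc g) N = insert [] (\<Union>e\<in>P. T e)"
    unfolding truncated_particles_Suc[OF F(1)] P_def T_def by simp
  then have "card (truncated_particles S F J (Suc g) N) = 1 + card (\<Union>e\<in>P. T e)"
    using P T by (subst \<open>_ = insert [] _\<close>, subst card_insert_disjoint) (auto simp: T_def)
  also have "card (\<Union>e\<in>P. T e) = (\<Sum>e\<in>P. card (T e))"
    using P T by (intro card_UN_disjoint) (auto simp: T_def)
  also have "\<dots> = (\<Sum>(y, j)\<in>P. truncated_progeny S F J g (subtree S y j N))"
    by (intro sum.cong refl) (auto simp: T_def Suc.IH card_image inj_on_def)
  also have "\<dots> = (\<Sum>(y, j)\<in>F \<times> {..<J}.
      if j < N ([], y) then truncated_progeny S F J g (subtree S y j N) else 0)"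
    using P F by (intro sum.mono_neutral_cong_left) (auto simp: P_def)
  also have "\<dots> = (\<Sum>y\<in>F. \<Sum>j<J.
      if j < N ([], y) then truncated_progeny S F J g (subtree S y j N) else 0)"
    by (simp add: sum.cartesian_product)
  finally show ?case by simp
qed

lemma truncated_progeny_mono:
  assumes "F \<subseteq> F'" "F' \<subseteq> S" "finite F'" "J \<le> J'" "g \<le> g'"
  shows "truncated_progeny S F J g N \<le> truncated_progeny S F' J' g' N"
proof -
  have "truncated_particles S F J g N \<subseteq> truncated_particles S F' J' g' N"
  proof -
    have "F \<times> {..<J} \<subseteq> F' \<times> {..<J'}" using assms by (intro Sigma_mono) auto
    then show ?thesis using assms unfolding truncated_particles_def by (auto dest: order_trans)
  qed
  moreover have "finite F" "F \<subseteq> S" using assms finite_subset by auto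
  ultimately show ?thesis
    using assms by (simp add: truncated_progeny_eq_card card_mono finite_truncated_particles)
qed

text \<open>Every finite set of particles is contained in some truncation, so for a finite tree the
  truncated sizes reach the total. For an infinite tree they are unbounded, and as z > 1 so are the
  powers, in accordance with the value infinity.\<close>

lemma power_enat_total_progeny:
  assumes F: "incseq F" "\<And>l. finite (F l)" "(\<Union>l. F l) = S" and z: "z > 1"
  shows "power_enat z (total_progeny S N) = (SUP l. ennreal (z ^ truncated_progeny S (F l) l l N))"
proof -
  have FS: "F l \<subseteq> S" for l using F(3) by auto
  have sub: "\<exists>l. A \<subseteq> truncated_particles S (F l) l l N" if "finite A" "A \<subseteq> particles S N" for A
    using that
  proof (induction rule: finite_induct)
    case (insert p A)
    then obtain l where l: "A \<subseteq> truncated_particles S (F l) l l N" by auto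
    \<comment> \<open>A particle has finitely many ancestors, each with a type in some
      \<open>F l\<close> and a finite child index; one level dominates them all.\<close>
    have "\<exists>l'. set p \<subseteq> F l' \<times> {..<l'}" if "p \<in> particles S N" for p
      using that
    proof (induction rule: particles.induct)
      case (child p y j)
      then obtain l1 where l1: "set p \<subseteq> F l1 \<times> {..<l1}" by auto
      from child F(3) obtain l2 where l2: "y \<in> F l2" by auto
      define l3 where "l3 = max l1 (max l2 (Suc j))"
      have "F l1 \<subseteq> F l3" "F l2 \<subseteq> F l3" using F(1) by (auto simp: l3_def incseq_def)
      moreover have "{..<l1} \<subseteq> {..<l3}" "j \<in> {..<l3}" by (auto simp: l3_def)
      ultimately show ?case using l1 l2 by (intro exI[of _ l3]) auto
    qed simp
    then obtain l' where l': "set p \<subseteq> F l' \<times> {..<l'}" using insert.prems by blast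
    define k where "k = max (max l l') (length p)"
    have "F l \<subseteq> F k" "F l' \<subseteq> F k" using F(1) by (auto simp: k_def incseq_def)
    moreover have "{..<l} \<subseteq> {..<k}" "{..<l'} \<subseteq> {..<k}" "l \<le> k" "length p \<le> k" by (auto simp: k_def)
    ultimately have "F l \<times> {..<l} \<subseteq> F k \<times> {..<k}" "F l' \<times> {..<l'} \<subseteq> F k \<times> {..<k}" by (auto intro!: Sigma_mono)
    then have "truncated_particles S (F l) l l N \<subseteq> truncated_particles S (F k) k k N"
      unfolding truncated_particles_def using \<open>l \<le> k\<close> by force
    moreover have "p \<in> truncated_particles S (F k) k k N"
      unfolding truncated_particles_def
      using l' insert.prems \<open>length p \<le> k\<close> \<open>F l' \<times> _ \<subseteq> _\<close> by simp
    ultimately show ?case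
      using l by (intro exI[of _ k]) blast
  qed (auto simp: truncated_particles_def)
  show ?thesis
  proof (cases "finite (particles S N)")
    case True
    then obtain l where l: "particles S N \<subseteq> truncated_particles S (F l) l l N"
      using sub by blast
    have "truncated_progeny S (F k) k k N \<le> card (particles S N)" for k
      using True FS F by (auto simp: truncated_progeny_eq_card truncated_particles_def intro!: card_mono)
    moreover have "card (particles S N) \<le> truncated_progeny S (F l) l l N"
      using FS F l by (auto simp: truncated_progeny_eq_card finite_truncated_particles intro!: card_mono)
    ultimately have "(SUP l. ennreal (z ^ truncated_progeny S (F l) l l N)) = ennreal (z ^ card (particles S N))"
      using z by (intro antisym SUP_least SUP_upper2[of l] ennreal_leI power_increasing) auto
    then show ?thesis
      using True by (simp add: total_progeny_def power_enat_def)
  next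
    case False
    have "ennreal (real k) \<le> (SUP l. ennreal (z ^ truncated_progeny S (F l) l l N))" for k
    proof -
      obtain i where i: "real k < z ^ i"
        using real_arch_pow[OF z] by blast
      obtain A where A: "finite A" "card A = i" "A \<subseteq> particles S N"
        using False infinite_arbitrarily_large by blast
      obtain l where l: "A \<subseteq> truncated_particles S (F l) l l N"
        using sub[OF A(1,3)] by blast
      have "i \<le> truncated_progeny S (F l) l l N"
        unfolding truncated_progeny_eq_card[OF FS F(2)] A(2)[symmetric]
        using l F(2) by (intro card_mono finite_truncated_particles)
      then have "z ^ i \<le> z ^ truncated_progeny S (F l) l l N"
        using z by (intro power_increasing) auto
      then show ?thesis
        using i by (intro SUP_upper2[of l] ennreal_leI) auto
    qed
    then have "(SUP k. of_nat k) \<le> (SUP l. ennreal (z ^ truncated_progeny S (F l) l l N))"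
      by (intro SUP_least) (simp add: ennreal_of_nat_eq_real_of_nat)
    then have "(SUP l. ennreal (z ^ truncated_progeny S (F l) l l N)) = \<infinity>"
      by (simp only: ennreal_SUP_of_nat_eq_top top_unique infinity_ennreal_def)
    moreover have "power_enat z (total_progeny S N) = \<infinity>"
      using False z by (simp add: total_progeny_def power_enat_def)
    ultimately show ?thesis
      by (simp only:)
  qed
qed

lemma progeny_gf_eq_SUP:
  assumes F: "incseq F" "\<And>l. finite (F l)" "(\<Union>l. F l) = S" and z: "z > 1"
  shows "progeny_gf S \<mu> \<kappa> x z = (SUP l. truncated_gf S \<mu> \<kappa> (F l) l l z x)"
  unfolding progeny_gf_def power_enat_total_progeny[OF assms] truncated_gf_def
proof (rule nn_integral_monotone_convergence_SUP)
  have FS: "F l \<subseteq> S" for l using F(3) by auto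
  show "incseq (\<lambda>l N. ennreal (z ^ truncated_progeny S (F l) l l N))"
    using F FS z by (auto simp: incseq_def le_fun_def intro!: ennreal_leI power_increasing truncated_progeny_mono)
  fix l
  have [measurable]: "truncated_progeny S (F l) l l \<in> measurable (offspring_space S \<mu> \<kappa> x) (count_space UNIV)"
    using F FS by (intro truncated_progeny_measurable)
  show "(\<lambda>N. ennreal (z ^ truncated_progeny S (F l) l l N)) \<in> borel_measurable (offspring_space S \<mu> \<kappa> x)"
    by measurable
qed

lemma truncated_gf_mono:
  assumes "F \<subseteq> F'" "F' \<subseteq> S" "finite F'" "J \<le> J'" "g \<le> g'" "z \<ge> 1"
  shows "truncated_gf S \<mu> \<kappa> F J g z x \<le> truncated_gf S \<mu> \<kappa> F' J' g' z x"
  unfolding truncated_gf_def using assms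
  by (intro nn_integral_mono ennreal_leI power_increasing truncated_progeny_mono) auto

lemma progeny_gf_1: "progeny_gf S \<mu> \<kappa> x 1 = 1"
proof -
  interpret prob_space "offspring_space S \<mu> \<kappa> x" by (rule prob_space_offspring_space)
  have "power_enat 1 m = 1" for m by (cases m) (auto simp: power_enat_def)
  then show ?thesis by (simp add: progeny_gf_def emeasure_space_1)
qed

section \<open>Countable sums as integrals\<close>

lemma countable_exhaustion:
  assumes "countable S"
  obtains F :: "nat \<Rightarrow> 'a set" where "incseq F" "\<And>l. finite (F l)" "(\<Union>l. F l) = S"
proof
  let ?F = "\<lambda>l. {x \<in> S. to_nat_on S x < l}"
  show "incseq ?F" by (auto simp: incseq_def)
  show "(\<Union>l. ?F l) = S" by auto
  show "finite (?F l)" for l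
    by (rule inj_on_finite[of "to_nat_on S" _ "{..<l}"])
       (use assms in \<open>auto intro: inj_on_subset[OF inj_on_to_nat_on]\<close>)
qed

text \<open>The radius and the critical value are defined by unordered sums; as integrals over a
  counting measure they become accessible to monotone convergence and to integration against
  \<open>\<mu>\<close>.\<close>

lemma infsum_ennreal_eq_nn_integral:
  fixes f :: "'a \<Rightarrow> ennreal"
  assumes "countable S"
  shows "infsum f S = (\<integral>\<^sup>+x. f x \<partial>count_space S)"
proof (rule antisym)
  have sum_eq: "sum f F = (\<integral>\<^sup>+x. f x * indicator F x \<partial>count_space S)" if "finite F" "F \<subseteq> S" for F
    using that by (subst nn_integral_count_space'[of F]) (auto split: split_indicator)
  have inf: "infsum f S = (SUP F\<in>{F. finite F \<and> F \<subseteq> S}. sum f F)"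
    by (rule nonneg_infsum_complete) simp
  show "infsum f S \<le> (\<integral>\<^sup>+x. f x \<partial>count_space S)"
    unfolding inf
    by (intro SUP_least) (auto simp: sum_eq intro!: nn_integral_mono split: split_indicator)
  obtain F where F: "incseq F" "\<And>l. finite (F l)" "(\<Union>l. F l) = S"
    by (rule countable_exhaustion[OF assms]) (rule that)
  have "(\<integral>\<^sup>+x. f x \<partial>count_space S) = (\<integral>\<^sup>+x. (SUP l. f x * indicator (F l) x) \<partial>count_space S)"
  proof (intro nn_integral_cong)
    fix x assume "x \<in> space (count_space S)"
    then obtain l where "x \<in> F l" using F(3) by auto
    then show "f x = (SUP l. f x * indicator (F l) x)"
      by (intro antisym SUP_least SUP_upper2[of l]) (auto split: split_indicator)
  qed
  also have "\<dots> = (SUP l. \<integral>\<^sup>+x. f x * indicator (F l) x \<partial>count_space S)"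
    using F(1) by (intro nn_integral_monotone_convergence_SUP)
      (auto simp: incseq_def le_fun_def split: split_indicator)
  also have "\<dots> = (SUP l. sum f (F l))"
    using F by (intro SUP_cong refl sum_eq[symmetric]) auto
  also have "\<dots> \<le> infsum f S"
    unfolding inf using F by (intro SUP_least SUP_upper) auto
  finally show "(\<integral>\<^sup>+x. f x \<partial>count_space S) \<le> infsum f S" .
qed

lemma nn_integral_pmf_eq_infsum:
  fixes g :: "'a \<Rightarrow> ennreal"
  assumes "countable S" "set_pmf \<mu> \<subseteq> S"
  shows "(\<Sum>\<^sub>\<infinity>x\<in>S. ennreal (pmf \<mu> x) * g x) = (\<integral>\<^sup>+x. g x \<partial>\<mu>)"
  unfolding infsum_ennreal_eq_nn_integral[OF assms(1)] nn_integral_measure_pmf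
  by (rule nn_integral_count_space_eq) (use assms(2) in \<open>auto simp: set_pmf_eq\<close>)

lemma sum_pmf_le_integral:
  fixes \<mu> :: "'a pmf" and h :: "'a \<Rightarrow> real"
  assumes "finite F" "integrable \<mu> h" "\<And>x. x \<in> set_pmf \<mu> \<Longrightarrow> h x \<ge> 0"
  shows "(\<Sum>x\<in>F. pmf \<mu> x * h x) \<le> measure_pmf.expectation \<mu> h"
proof -
  have "(\<Sum>x\<in>F. pmf \<mu> x * h x) = measure_pmf.expectation \<mu> (\<lambda>x. h x * indicator F x)"
    using assms(1) by (subst integral_measure_pmf_real[of F]) (auto simp: mult_ac indicator_def)
  also have "\<dots> \<le> measure_pmf.expectation \<mu> h"
  proof (rule integral_mono_AE)
    show "integrable \<mu> (\<lambda>x. h x * indicator F x)"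
      using assms(2) by (intro integrable_real_mult_indicator) auto
  qed (use assms in \<open>auto simp: AE_measure_pmf_iff indicator_def\<close>)
  finally show ?thesis .
qed

section \<open>The fixed-point inequality for the rank-one generating function\<close>

locale rank1_branching =
  fixes S :: "real set" and \<mu> :: "real pmf" and \<psi> :: "real \<Rightarrow> real" and c :: real
  assumes countable_S: "countable S" and supp: "set_pmf \<mu> \<subseteq> S"
    and \<psi>_pos: "x \<in> S \<Longrightarrow> \<psi> x > 0" and c_pos: "c > 0"
    and \<psi>_integrable: "integrable \<mu> \<psi>"
begin

definition m :: real where "m = measure_pmf.expectation \<mu> \<psi>"

text \<open>The function f, extended-valued because it may be infinite once s > m.\<close>

definition tilted :: "real \<Rightarrow> ennreal" where
  "tilted s = (\<integral>\<^sup>+x. ennreal (\<psi> x * exp (c * \<psi> x * (s - m))) \<partial>\<mu>)"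

abbreviation "\<kappa> \<equiv> rank1_kernel c \<psi>"

lemma \<psi>_pos': "x \<in> set_pmf \<mu> \<Longrightarrow> \<psi> x > 0"
  using supp \<psi>_pos by auto

lemma nn_integral_\<psi>: "(\<integral>\<^sup>+x. ennreal (\<psi> x) \<partial>\<mu>) = ennreal m"
  unfolding m_def using \<psi>_pos' \<psi>_integrable
  by (intro nn_integral_eq_integral) (auto simp: AE_measure_pmf_iff less_imp_le)

lemma tilted_m: "tilted m = ennreal m"
  by (simp add: tilted_def nn_integral_\<psi>)

lemma m_pos: "m > 0"
proof -
  obtain x where x: "x \<in> set_pmf \<mu>" using set_pmf_not_empty by fast
  have "0 < pmf \<mu> x * \<psi> x" using x \<psi>_pos' by (simp add: pmf_positive)
  also have "\<dots> = (\<Sum>x\<in>{x}. pmf \<mu> x * \<psi> x)" by simp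
  also have "\<dots> \<le> m"
    unfolding m_def using \<psi>_integrable \<psi>_pos' by (intro sum_pmf_le_integral) (auto simp: less_imp_le)
  finally show ?thesis .
qed

lemma tilted_finite_imp:
  assumes "tilted s < \<infinity>"
  shows "integrable \<mu> (\<lambda>x. \<psi> x * exp (c * \<psi> x * (s - m)))" (is "integrable \<mu> ?h")
    "tilted s = ennreal (measure_pmf.expectation \<mu> (\<lambda>x. \<psi> x * exp (c * \<psi> x * (s - m))))"
proof -
  show int: "integrable \<mu> ?h"
  proof (rule integrableI_bounded)
    have "(\<integral>\<^sup>+x. ennreal (norm (?h x)) \<partial>\<mu>) = tilted s"
      unfolding tilted_def using \<psi>_pos'
      by (intro nn_integral_cong_AE) (auto simp: AE_measure_pmf_iff less_imp_le abs_mult)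
    then show "(\<integral>\<^sup>+x. ennreal (norm (?h x)) \<partial>\<mu>) < \<infinity>" using assms by simp
  qed simp
  show "tilted s = ennreal (measure_pmf.expectation \<mu> ?h)"
    unfolding tilted_def using \<psi>_pos' int
    by (intro nn_integral_eq_integral) (auto simp: AE_measure_pmf_iff less_imp_le)
qed

text \<open>Induction over generations. Inserting the bound z exp (c \<psi> (s - m)) for the
  children into the Poisson recursion gives the exponent c \<psi> x (z f(s) - m), and z f(s) <= s
  reproduces the same bound.\<close>

lemma truncated_gf_le:
  assumes s: "s \<ge> m" and z: "z \<ge> 1" and le: "ennreal z * tilted s \<le> ennreal s"
    and F: "F \<subseteq> S" "finite F" and x: "x \<in> S"
  shows "truncated_gf S \<mu> \<kappa> F J g z x \<le> ennreal (z * exp (c * \<psi> x * (s - m)))"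
  using x
proof (induction g arbitrary: x)
  case 0
  have "c * \<psi> x * (s - m) \<ge> 0" using s c_pos \<psi>_pos[OF 0] by simp
  then have "1 \<le> exp (c * \<psi> x * (s - m))" by simp
  then show ?case using z by (simp add: truncated_gf_0 mult_le_cancel_left1)
next
  case (Suc g)
  define b where "b y = z * exp (c * \<psi> y * (s - m))" for y
  have b: "b y \<ge> 1" if "y \<in> S" for y
  proof -
    have "1 * 1 \<le> z * exp (c * \<psi> y * (s - m))"
      using s z c_pos \<psi>_pos[OF that] by (intro mult_mono) auto
    then show ?thesis by (simp add: b_def)
  qed
  have fin: "tilted s < \<infinity>"
  proof (rule ccontr)
    assume "\<not> tilted s < \<infinity>"
    then have "tilted s = top" unfolding infinity_ennreal_def by (meson less_top)
    then have "ennreal z * tilted s = top" using z by (simp add: ennreal_mult_top)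
    with le show False by (simp add: top_unique)
  qed
  note int = tilted_finite_imp[OF fin]
  have zs: "z * measure_pmf.expectation \<mu> (\<lambda>x. \<psi> x * exp (c * \<psi> x * (s - m))) \<le> s"
    using le z s m_pos unfolding int(2) by (simp add: ennreal_mult'[symmetric])
  have "truncated_gf S \<mu> \<kappa> F J (Suc g) z x =
      ennreal z * (\<Prod>y\<in>F. \<integral>\<^sup>+t. truncated_gf S \<mu> \<kappa> F J g z y ^ min t J \<partial>Po (\<kappa> x y * pmf \<mu> y))"
    using z F by (intro truncated_gf_Suc) auto
  also have "\<dots> \<le> ennreal z * (\<Prod>y\<in>F. ennreal (exp (\<kappa> x y * pmf \<mu> y * (b y - 1))))"
  proof (intro mult_left_mono prod_mono_ennreal)
    fix y assume y: "y \<in> F"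
    then have yS: "y \<in> S" using F by auto
    have "(\<integral>\<^sup>+t. truncated_gf S \<mu> \<kappa> F J g z y ^ min t J \<partial>Po (\<kappa> x y * pmf \<mu> y))
        \<le> (\<integral>\<^sup>+t. ennreal (b y ^ t) \<partial>Po (\<kappa> x y * pmf \<mu> y))"
    proof (intro nn_integral_mono)
      fix t
      have "truncated_gf S \<mu> \<kappa> F J g z y ^ min t J \<le> ennreal (b y) ^ min t J"
        unfolding b_def by (intro power_mono Suc.IH yS) auto
      also have "\<dots> \<le> ennreal (b y ^ t)"
        using b[OF yS] by (simp add: ennreal_power power_increasing)
      finally show "truncated_gf S \<mu> \<kappa> F J g z y ^ min t J \<le> ennreal (b y ^ t)" .
    qed
    also have "\<dots> = ennreal (exp (\<kappa> x y * pmf \<mu> y * (b y - 1)))"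
      using c_pos \<psi>_pos[OF yS] \<psi>_pos[OF Suc.prems] b[OF yS]
      by (intro nn_integral_Po_power) (auto simp: rank1_kernel_def)
    finally show "(\<integral>\<^sup>+t. truncated_gf S \<mu> \<kappa> F J g z y ^ min t J \<partial>Po (\<kappa> x y * pmf \<mu> y))
       \<le> ennreal (exp (\<kappa> x y * pmf \<mu> y * (b y - 1)))" .
  qed simp
  also have "\<dots> = ennreal (z * exp (\<Sum>y\<in>F. \<kappa> x y * pmf \<mu> y * (b y - 1)))"
    using z F by (simp add: prod_ennreal exp_sum ennreal_mult prod_nonneg)
  also have "\<dots> \<le> ennreal (z * exp (c * \<psi> x * (s - m)))"
  proof -
    \<comment> \<open>Rank one: the exponent is c \<psi> x times a sum that does not depend on
      \<open>x\<close>, which reduces the recursion to a single number.\<close>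
    have "(\<Sum>y\<in>F. \<kappa> x y * pmf \<mu> y * (b y - 1)) = c * \<psi> x * (\<Sum>y\<in>F. pmf \<mu> y * (\<psi> y * (b y - 1)))"
      by (simp add: rank1_kernel_def sum_distrib_left mult_ac)
    also have "\<dots> \<le> c * \<psi> x * (s - m)"
    proof (intro mult_left_mono)
      have eq: "\<psi> y * (b y - 1) = z * (\<psi> y * exp (c * \<psi> y * (s - m))) - \<psi> y" for y
        by (simp add: b_def algebra_simps)
      have "(\<Sum>y\<in>F. pmf \<mu> y * (\<psi> y * (b y - 1))) \<le> measure_pmf.expectation \<mu> (\<lambda>y. \<psi> y * (b y - 1))"
      proof (intro sum_pmf_le_integral F)
        show "integrable \<mu> (\<lambda>y. \<psi> y * (b y - 1))"
          unfolding eq using int \<psi>_integrable by (intro Bochner_Integration.integrable_diff integrable_mult_right)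
        show "0 \<le> \<psi> y * (b y - 1)" if "y \<in> set_pmf \<mu>" for y
        proof -
          have "y \<in> S" using that supp by auto
          then show ?thesis using \<psi>_pos[of y] b[of y] by simp
        qed
      qed
      also have "\<dots> = z * measure_pmf.expectation \<mu> (\<lambda>x. \<psi> x * exp (c * \<psi> x * (s - m))) - m"
        unfolding eq m_def[symmetric] using int \<psi>_integrable
        by (subst Bochner_Integration.integral_diff) (auto simp: m_def)
      finally show "(\<Sum>y\<in>F. pmf \<mu> y * (\<psi> y * (b y - 1))) \<le> s - m" using zs by simp
    qed (use c_pos \<psi>_pos[OF Suc.prems] in simp)
    finally show ?thesis using z by (intro ennreal_leI mult_left_mono) auto
  qed
  finally show ?case .
qed

lemma progeny_gf_le:
  assumes s: "s \<ge> m" and z: "z > 1" and le: "ennreal z * tilted s \<le> ennreal s" and x: "x \<in> S"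
  shows "progeny_gf S \<mu> \<kappa> x z \<le> ennreal (z * exp (c * \<psi> x * (s - m)))"
proof -
  obtain F where F: "incseq F" "\<And>l. finite (F l)" "(\<Union>l. F l) = S"
    by (rule countable_exhaustion[OF countable_S]) (rule that)
  show ?thesis
    unfolding progeny_gf_eq_SUP[OF F z]
    using assms F by (intro SUP_least truncated_gf_le) auto
qed

definition weighted_gf :: "real \<Rightarrow> ennreal" where
  "weighted_gf z = (\<integral>\<^sup>+x. ennreal (\<psi> x) * progeny_gf S \<mu> \<kappa> x z \<partial>\<mu>)"

lemma weighted_gf_finite:
  assumes s: "s \<ge> m" and z: "z > 1" and le: "ennreal z * tilted s \<le> ennreal s"
  shows "weighted_gf z < \<infinity>"
proof -
  have "weighted_gf z \<le> (\<integral>\<^sup>+x. ennreal z * ennreal (\<psi> x * exp (c * \<psi> x * (s - m))) \<partial>\<mu>)"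
    unfolding weighted_gf_def
  proof (intro nn_integral_mono_AE, unfold AE_measure_pmf_iff, intro ballI)
    fix x assume x: "x \<in> set_pmf \<mu>"
    then have "ennreal (\<psi> x) * progeny_gf S \<mu> \<kappa> x z
        \<le> ennreal (\<psi> x) * ennreal (z * exp (c * \<psi> x * (s - m)))"
      using supp assms by (intro mult_left_mono progeny_gf_le) auto
    also have "\<dots> = ennreal z * ennreal (\<psi> x * exp (c * \<psi> x * (s - m)))"
      using z \<psi>_pos'[OF x] by (simp add: ennreal_mult[symmetric] mult_ac)
    finally show "ennreal (\<psi> x) * progeny_gf S \<mu> \<kappa> x z \<le> \<dots>" .
  qed
  also have "\<dots> = ennreal z * tilted s"
    unfolding tilted_def by (rule nn_integral_cmult) simp
  finally show ?thesis using le by (simp add: le_less_trans)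
qed

text \<open>Removes the cap \<open>J\<close> on the number of children by monotone convergence;
  lower bounds on the generating function need the uncapped exponent.\<close>

lemma nn_integral_Po_power_min_SUP:
  assumes "r \<ge> 0" "a \<ge> 1"
  shows "(\<lambda>J. \<integral>\<^sup>+t. ennreal (a ^ min t J) \<partial>Po r) \<longlonglongrightarrow> ennreal (exp (r * (a - 1)))"
proof -
  have "(SUP J. ennreal (a ^ min t J)) = ennreal (a ^ t)" for t
    using assms by (intro antisym SUP_least SUP_upper2[of t]) (auto intro!: ennreal_leI power_increasing)
  then have "ennreal (exp (r * (a - 1))) = (\<integral>\<^sup>+t. (SUP J. ennreal (a ^ min t J)) \<partial>Po r)"
    using assms by (simp add: nn_integral_Po_power)
  also have "\<dots> = (SUP J. \<integral>\<^sup>+t. ennreal (a ^ min t J) \<partial>Po r)"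
    using assms by (intro nn_integral_monotone_convergence_SUP)
      (auto simp: incseq_def le_fun_def intro!: ennreal_leI power_increasing)
  finally show ?thesis
    using assms by (auto intro!: LIMSEQ_SUP nn_integral_mono ennreal_leI power_increasing simp: incseq_def)
qed

text \<open>One more generation on top of a truncation: each child of type \<open>y\<close>
  contributes at least \<open>b y\<close>, the number of children is uncapped by letting
  \<open>J\<close> tend to infinity, and the recursion returns the Poisson exponent. This is the
  counterpart from below of the supersolution bound.\<close>

lemma progeny_gf_ge:
  assumes F: "incseq F" "\<And>l. finite (F l)" "(\<Union>l. F l) = S" and z: "z > 1" and x: "x \<in> S"
    and b: "\<And>y. y \<in> F l \<Longrightarrow> b y \<ge> 1" "\<And>y. y \<in> F l \<Longrightarrow> ennreal (b y) \<le> truncated_gf S \<mu> \<kappa> (F l) l l z y"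
  shows "ennreal (z * exp (c * \<psi> x * (\<Sum>y\<in>F l. pmf \<mu> y * \<psi> y * (b y - 1)))) \<le> progeny_gf S \<mu> \<kappa> x z"
proof (rule LIMSEQ_le_const2)
  have FS: "F l \<subseteq> S" for l using F(3) by auto
  have \<kappa>0: "\<kappa> x y * pmf \<mu> y \<ge> 0" if "y \<in> F l" for y
  proof -
    have "y \<in> S" using that FS by auto
    then show ?thesis using c_pos \<psi>_pos[of y] \<psi>_pos[OF x] by (simp add: rank1_kernel_def)
  qed
  have "(\<lambda>J. ennreal z * (\<Prod>y\<in>F l. \<integral>\<^sup>+t. ennreal (b y ^ min t J) \<partial>Po (\<kappa> x y * pmf \<mu> y)))
     \<longlonglongrightarrow> ennreal z * (\<Prod>y\<in>F l. ennreal (exp (\<kappa> x y * pmf \<mu> y * (b y - 1))))"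
  proof (intro tendsto_mult_ennreal tendsto_const)
    have "(\<lambda>J. \<Prod>y\<in>F l. enn2real (\<integral>\<^sup>+t. ennreal (b y ^ min t J) \<partial>Po (\<kappa> x y * pmf \<mu> y)))
     \<longlonglongrightarrow> (\<Prod>y\<in>F l. exp (\<kappa> x y * pmf \<mu> y * (b y - 1)))"
    proof (intro tendsto_prod)
      fix y assume y: "y \<in> F l"
      from nn_integral_Po_power_min_SUP[OF \<kappa>0[OF y] b(1)[OF y]]
      have "(\<lambda>J. enn2real (\<integral>\<^sup>+t. ennreal (b y ^ min t J) \<partial>Po (\<kappa> x y * pmf \<mu> y)))
         \<longlonglongrightarrow> enn2real (ennreal (exp (\<kappa> x y * pmf \<mu> y * (b y - 1))))"
        by (intro tendsto_enn2real) auto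
      then show "(\<lambda>J. enn2real (\<integral>\<^sup>+t. ennreal (b y ^ min t J) \<partial>Po (\<kappa> x y * pmf \<mu> y)))
         \<longlonglongrightarrow> exp (\<kappa> x y * pmf \<mu> y * (b y - 1))" by simp
    qed
    then have "(\<lambda>J. ennreal (\<Prod>y\<in>F l. enn2real (\<integral>\<^sup>+t. ennreal (b y ^ min t J) \<partial>Po (\<kappa> x y * pmf \<mu> y))))
     \<longlonglongrightarrow> ennreal (\<Prod>y\<in>F l. exp (\<kappa> x y * pmf \<mu> y * (b y - 1)))"
      by (rule tendsto_ennrealI)
    moreover have "ennreal (\<Prod>y\<in>F l. enn2real (\<integral>\<^sup>+t. ennreal (b y ^ min t J) \<partial>Po (\<kappa> x y * pmf \<mu> y)))
        = (\<Prod>y\<in>F l. \<integral>\<^sup>+t. ennreal (b y ^ min t J) \<partial>Po (\<kappa> x y * pmf \<mu> y))" for J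
    proof -
      have "(\<integral>\<^sup>+t. ennreal (b y ^ min t J) \<partial>Po (\<kappa> x y * pmf \<mu> y)) < top" if y: "y \<in> F l" for y
      proof -
        have "(\<integral>\<^sup>+t. ennreal (b y ^ min t J) \<partial>Po (\<kappa> x y * pmf \<mu> y))
            \<le> (\<integral>\<^sup>+t. ennreal (b y ^ J) \<partial>Po (\<kappa> x y * pmf \<mu> y))"
          using b(1)[OF y] by (intro nn_integral_mono ennreal_leI power_increasing) auto
        also have "\<dots> = ennreal (b y ^ J)" by (simp add: measure_pmf.emeasure_space_1[simplified])
        finally show ?thesis by (rule le_less_trans) simp
      qed
      then show ?thesis by (subst prod_ennreal[symmetric]) (auto intro!: prod.cong)
    qed
    ultimately show "(\<lambda>J. \<Prod>y\<in>F l. \<integral>\<^sup>+t. ennreal (b y ^ min t J) \<partial>Po (\<kappa> x y * pmf \<mu> y))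
      \<longlonglongrightarrow> (\<Prod>y\<in>F l. ennreal (exp (\<kappa> x y * pmf \<mu> y * (b y - 1))))"
      by (simp add: prod_ennreal)
  qed (use z in \<open>auto simp: prod_ennreal prod_pos\<close>)
  also have "ennreal z * (\<Prod>y\<in>F l. ennreal (exp (\<kappa> x y * pmf \<mu> y * (b y - 1)))) =
      ennreal (z * exp (c * \<psi> x * (\<Sum>y\<in>F l. pmf \<mu> y * \<psi> y * (b y - 1))))"
    using z F by (simp add: prod_ennreal exp_sum[symmetric] ennreal_mult' rank1_kernel_def
        sum_distrib_left mult_ac)
  finally show "(\<lambda>J. ennreal z * (\<Prod>y\<in>F l. \<integral>\<^sup>+t. ennreal (b y ^ min t J) \<partial>Po (\<kappa> x y * pmf \<mu> y)))
     \<longlonglongrightarrow> \<dots>" .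
  show "\<exists>J0. \<forall>J\<ge>J0. ennreal z * (\<Prod>y\<in>F l. \<integral>\<^sup>+t. ennreal (b y ^ min t J) \<partial>Po (\<kappa> x y * pmf \<mu> y))
      \<le> progeny_gf S \<mu> \<kappa> x z"
  \<comment> \<open>From \<open>Suc l\<close> on, the truncation at level \<open>J\<close> contains
    the extra generation as well as \<open>F l\<close>.\<close>
  proof (intro exI[of _ "Suc l"] allI impI)
    fix J assume J: "Suc l \<le> J"
    have "ennreal z * (\<Prod>y\<in>F l. \<integral>\<^sup>+t. ennreal (b y ^ min t J) \<partial>Po (\<kappa> x y * pmf \<mu> y))
      \<le> ennreal z * (\<Prod>y\<in>F l. \<integral>\<^sup>+t. truncated_gf S \<mu> \<kappa> (F l) J l z y ^ min t J \<partial>Po (\<kappa> x y * pmf \<mu> y))"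
    proof (intro mult_left_mono prod_mono_ennreal nn_integral_mono)
      fix y t assume y: "y \<in> F l"
      have "ennreal (b y) \<le> truncated_gf S \<mu> \<kappa> (F l) l l z y" by (rule b(2)[OF y])
      also have "\<dots> \<le> truncated_gf S \<mu> \<kappa> (F l) J l z y"
        using FS F z J by (intro truncated_gf_mono) auto
      finally have "ennreal (b y) ^ min t J \<le> truncated_gf S \<mu> \<kappa> (F l) J l z y ^ min t J"
        by (intro power_mono) auto
      then show "ennreal (b y ^ min t J) \<le> truncated_gf S \<mu> \<kappa> (F l) J l z y ^ min t J"
        using b(1)[OF y] by (simp add: ennreal_power)
    qed simp
    also have "\<dots> = truncated_gf S \<mu> \<kappa> (F l) J (Suc l) z x"
      using FS F z by (intro truncated_gf_Suc[symmetric]) auto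
    also have "\<dots> \<le> truncated_gf S \<mu> \<kappa> (F J) J J z x"
      using FS F z J by (intro truncated_gf_mono) (auto simp: incseq_def)
    also have "\<dots> \<le> progeny_gf S \<mu> \<kappa> x z"
      unfolding progeny_gf_eq_SUP[OF F z] by (rule SUP_upper) simp
    finally show "ennreal z * (\<Prod>y\<in>F l. \<integral>\<^sup>+t. ennreal (b y ^ min t J) \<partial>Po (\<kappa> x y * pmf \<mu> y))
      \<le> progeny_gf S \<mu> \<kappa> x z" .
  qed
qed

text \<open>The converse of \<open>weighted_gf_finite\<close>, with the weighted generating function
  itself as the witness s. The generating function satisfies its recursion at least as an
  inequality, so it dominates z exp (c \<psi> x (s - m)).\<close>

lemma tilted_le_if_weighted_gf_finite:
  assumes z: "z > 1" and fin: "weighted_gf z < \<infinity>"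
  shows "\<exists>s\<ge>m. ennreal z * tilted s \<le> ennreal s"
proof -
  obtain F where F: "incseq F" "\<And>l. finite (F l)" "(\<Union>l. F l) = S"
    by (rule countable_exhaustion[OF countable_S]) (rule that)
  have FS: "F l \<subseteq> S" for l using F(3) by auto
  define s where "s = enn2real (weighted_gf z)"
  have s: "weighted_gf z = ennreal s" using fin by (simp add: s_def)
  have ge1: "ennreal 1 \<le> truncated_gf S \<mu> \<kappa> (F l) l l z y" for l y
    using z truncated_gf_mono[of "F l" "F l" S l l 0 l z \<mu> \<kappa> y] FS F
    by (simp add: truncated_gf_0) (metis ennreal_1 ennreal_leI less_imp_le order_trans)
  have ge1': "1 \<le> progeny_gf S \<mu> \<kappa> y z" for y
    unfolding progeny_gf_eq_SUP[OF F z] using ge1[of 0 y] by (intro SUP_upper2[of 0]) auto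
  have sm: "m \<le> s"
  proof -
    have "ennreal m \<le> weighted_gf z"
      unfolding nn_integral_\<psi>[symmetric] weighted_gf_def
      using ge1' by (intro nn_integral_mono) (metis mult.right_neutral mult_left_mono zero_le)
    then have "ennreal m \<le> ennreal s" by (simp only: s)
    then show ?thesis using m_pos by (simp add: ennreal_le_iff2)
  qed
  have key: "ennreal (z * exp (c * \<psi> x * (s - m))) \<le> progeny_gf S \<mu> \<kappa> x z" if x: "x \<in> S" for x
  proof (rule LIMSEQ_le_const2)
    define b where "b l y = enn2real (truncated_gf S \<mu> \<kappa> (F l) l l z y)" for l y
    \<comment> \<open>Capping at a level that tends to infinity makes the values real numbers
      without a separate finiteness argument and does not affect the limit.\<close>
    define b' where "b' l y = min (truncated_gf S \<mu> \<kappa> (F l) l l z y) (of_nat (Suc l))" for l y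
    have b': "b' l y < top" "1 \<le> b' l y" for l y
    proof -
      show "b' l y < top"
        unfolding b'_def by (rule le_less_trans[OF min.cobounded2 of_nat_less_top])
      have "(1::ennreal) \<le> of_nat (Suc l)" by simp
      then show "1 \<le> b' l y" using ge1[of l y] by (simp add: b'_def del: of_nat_Suc)
    qed
    define r where "r l = (\<Sum>y\<in>F l. pmf \<mu> y * \<psi> y * (enn2real (b' l y) - 1))" for l
    show "\<exists>L. \<forall>l\<ge>L. ennreal (z * exp (c * \<psi> x * r l)) \<le> progeny_gf S \<mu> \<kappa> x z"
      unfolding r_def
    proof (intro exI[of _ 0] allI impI progeny_gf_ge F z x)
      fix l y
      show "1 \<le> enn2real (b' l y)" using b'[of l y]
        by (metis enn2real_1 enn2real_mono)
      show "ennreal (enn2real (b' l y)) \<le> truncated_gf S \<mu> \<kappa> (F l) l l z y"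
        using b'[of l y] by (simp add: b'_def)
    qed
    have "r \<longlonglongrightarrow> s - m"
    proof -
      have "(\<lambda>l. \<Sum>y\<in>F l. ennreal (pmf \<mu> y) * (ennreal (\<psi> y) * b' l y)) \<longlonglongrightarrow> weighted_gf z"
      proof -
        have inc: "incseq (\<lambda>l y. ennreal (\<psi> y) * b' l y * indicator (F l) y)"
        proof (intro incseq_SucI le_funI)
          fix l y
          have "truncated_gf S \<mu> \<kappa> (F l) l l z y \<le> truncated_gf S \<mu> \<kappa> (F (Suc l)) (Suc l) (Suc l) z y"
            using F FS z by (intro truncated_gf_mono) (auto simp: incseq_def)
          then have "b' l y \<le> b' (Suc l) y" unfolding b'_def by (intro min.mono) auto
          moreover have "F l \<subseteq> F (Suc l)" using F(1) by (auto simp: incseq_def)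
          ultimately show "ennreal (\<psi> y) * b' l y * indicator (F l) y
             \<le> ennreal (\<psi> y) * b' (Suc l) y * indicator (F (Suc l)) y"
            by (intro mult_mono) (auto split: split_indicator)
        qed
        have sup: "(SUP l. ennreal (\<psi> y) * b' l y * indicator (F l) y)
            = ennreal (\<psi> y) * progeny_gf S \<mu> \<kappa> y z" if y: "y \<in> set_pmf \<mu>" for y
        proof (rule LIMSEQ_unique)
          show "(\<lambda>l. ennreal (\<psi> y) * b' l y * indicator (F l) y) \<longlonglongrightarrow>
              (SUP l. ennreal (\<psi> y) * b' l y * indicator (F l) y)"
            using inc by (intro LIMSEQ_SUP) (auto simp: incseq_def le_fun_def)
          obtain l0 where l0: "y \<in> F l0" using subsetD[OF supp y] unfolding F(3)[symmetric] by blast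
          have T: "(\<lambda>l. truncated_gf S \<mu> \<kappa> (F l) l l z y) \<longlonglongrightarrow> progeny_gf S \<mu> \<kappa> y z"
            unfolding progeny_gf_eq_SUP[OF F z]
            using F FS z by (intro LIMSEQ_SUP) (auto simp: incseq_def intro!: truncated_gf_mono)
          have N: "(\<lambda>l. of_nat (Suc l) :: ennreal) \<longlonglongrightarrow> top"
            using LIMSEQ_Suc[OF of_nat_tendsto_top_ennreal] by simp
          have "(\<lambda>l. b' l y) \<longlonglongrightarrow> min (progeny_gf S \<mu> \<kappa> y z) top"
            unfolding b'_def by (rule tendsto_min[OF T N])
          then have "(\<lambda>l. ennreal (\<psi> y) * b' l y) \<longlonglongrightarrow> ennreal (\<psi> y) * progeny_gf S \<mu> \<kappa> y z"
            using \<psi>_pos'[OF y] ge1'[of y] by (intro tendsto_mult_ennreal tendsto_const) auto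
          then show "(\<lambda>l. ennreal (\<psi> y) * b' l y * indicator (F l) y)
              \<longlonglongrightarrow> ennreal (\<psi> y) * progeny_gf S \<mu> \<kappa> y z"
          proof (rule Lim_transform_eventually)
            show "\<forall>\<^sub>F l in sequentially. ennreal (\<psi> y) * b' l y = ennreal (\<psi> y) * b' l y * indicator (F l) y"
              using eventually_ge_at_top[of l0]
              by eventually_elim (use l0 F(1) in \<open>auto simp: incseq_def indicator_def\<close>)
          qed
        qed
        have "(\<lambda>l. \<integral>\<^sup>+y. ennreal (\<psi> y) * b' l y * indicator (F l) y \<partial>\<mu>) \<longlonglongrightarrow> weighted_gf z"
        proof -
          have "weighted_gf z = (\<integral>\<^sup>+y. (SUP l. ennreal (\<psi> y) * b' l y * indicator (F l) y) \<partial>\<mu>)"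
            unfolding weighted_gf_def using sup by (intro nn_integral_cong_AE) (auto simp: AE_measure_pmf_iff)
          also have "\<dots> = (SUP l. \<integral>\<^sup>+y. ennreal (\<psi> y) * b' l y * indicator (F l) y \<partial>\<mu>)"
            by (intro nn_integral_monotone_convergence_SUP inc) simp
          finally show ?thesis
            using inc by (simp only:) (intro LIMSEQ_SUP, auto intro!: nn_integral_mono simp: incseq_def le_fun_def)
        qed
        moreover have "(\<integral>\<^sup>+y. ennreal (\<psi> y) * b' l y * indicator (F l) y \<partial>\<mu>)
            = (\<Sum>y\<in>F l. ennreal (pmf \<mu> y) * (ennreal (\<psi> y) * b' l y))" for l
          unfolding nn_integral_measure_pmf
          by (subst nn_integral_count_space'[of "F l"]) (use F in \<open>auto split: split_indicator\<close>)
        ultimately show ?thesis by simp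
      qed
      then have "(\<lambda>l. enn2real (\<Sum>y\<in>F l. ennreal (pmf \<mu> y) * (ennreal (\<psi> y) * b' l y))) \<longlonglongrightarrow> s"
        unfolding s using sm m_pos by (intro tendsto_enn2real) auto
      moreover have "enn2real (\<Sum>y\<in>F l. ennreal (pmf \<mu> y) * (ennreal (\<psi> y) * b' l y))
          = (\<Sum>y\<in>F l. pmf \<mu> y * \<psi> y * enn2real (b' l y))" for l
      proof -
        have "(\<Sum>y\<in>F l. ennreal (pmf \<mu> y) * (ennreal (\<psi> y) * b' l y))
            = (\<Sum>y\<in>F l. ennreal (pmf \<mu> y * \<psi> y * enn2real (b' l y)))"
        proof (intro sum.cong refl)
          fix y assume "y \<in> F l"
          then have "\<psi> y > 0" using FS \<psi>_pos by auto
          have "b' l y = ennreal (enn2real (b' l y))" using b'[of l y] by simp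
          then show "ennreal (pmf \<mu> y) * (ennreal (\<psi> y) * b' l y) = ennreal (pmf \<mu> y * \<psi> y * enn2real (b' l y))"
            using \<open>\<psi> y > 0\<close> by (metis ennreal_mult' ennreal_mult'' enn2real_nonneg less_imp_le mult.assoc pmf_nonneg)
        qed
        also have "\<dots> = ennreal (\<Sum>y\<in>F l. pmf \<mu> y * \<psi> y * enn2real (b' l y))"
          using FS \<psi>_pos by (intro sum_ennreal) (auto intro!: mult_nonneg_nonneg simp: less_imp_le subset_iff)
        finally show ?thesis
          using FS \<psi>_pos by (auto intro!: enn2real_ennreal sum_nonneg mult_nonneg_nonneg simp: less_imp_le subset_iff)
      qed
      ultimately have lim1: "(\<lambda>l. \<Sum>y\<in>F l. pmf \<mu> y * \<psi> y * enn2real (b' l y)) \<longlonglongrightarrow> s" by simp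
      have "(\<lambda>l. measure_pmf.expectation \<mu> (\<lambda>y. \<psi> y * indicator (F l) y)) \<longlonglongrightarrow> m"
        unfolding m_def
      proof (rule integral_dominated_convergence[where w = "\<lambda>y. \<bar>\<psi> y\<bar>"])
        show "AE y in \<mu>. (\<lambda>l. \<psi> y * indicator (F l) y) \<longlonglongrightarrow> \<psi> y"
          unfolding AE_measure_pmf_iff
        proof
          fix y assume "y \<in> set_pmf \<mu>"
          from subsetD[OF supp this] obtain l0 where l0: "y \<in> F l0"
            unfolding F(3)[symmetric] by blast
          have "\<forall>\<^sub>F l in sequentially. \<psi> y = \<psi> y * indicator (F l) y"
              using eventually_ge_at_top[of l0]
              by eventually_elim (use l0 F(1) in \<open>auto simp: incseq_def indicator_def\<close>)
          then show "(\<lambda>l. \<psi> y * indicator (F l) y) \<longlonglongrightarrow> \<psi> y"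
            by (rule Lim_transform_eventually[OF tendsto_const])
        qed
      qed (use \<psi>_integrable in \<open>auto split: split_indicator\<close>)
      moreover have "measure_pmf.expectation \<mu> (\<lambda>y. \<psi> y * indicator (F l) y) = (\<Sum>y\<in>F l. pmf \<mu> y * \<psi> y)" for l
        using F(2) by (subst integral_measure_pmf_real[of "F l"]) (auto simp: mult_ac indicator_def)
      ultimately have lim2: "(\<lambda>l. \<Sum>y\<in>F l. pmf \<mu> y * \<psi> y) \<longlonglongrightarrow> m" by simp
      show ?thesis
        using tendsto_diff[OF lim1 lim2] by (simp add: r_def[abs_def] sum_subtractf right_diff_distrib)
    qed
    then show "(\<lambda>l. ennreal (z * exp (c * \<psi> x * r l))) \<longlonglongrightarrow> ennreal (z * exp (c * \<psi> x * (s - m)))"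
      by (intro tendsto_intros)
  qed
  \<comment> \<open>Integrating the pointwise bound \<open>key\<close> against \<psi> closes the
    loop: the right-hand side is s itself.\<close>
  have "ennreal z * tilted s = (\<integral>\<^sup>+x. ennreal z * ennreal (\<psi> x * exp (c * \<psi> x * (s - m))) \<partial>\<mu>)"
    unfolding tilted_def by (rule nn_integral_cmult[symmetric]) simp
  also have "\<dots> \<le> weighted_gf z"
    unfolding weighted_gf_def
  proof (intro nn_integral_mono_AE, unfold AE_measure_pmf_iff, intro ballI)
    fix x assume x: "x \<in> set_pmf \<mu>"
    have "ennreal z * ennreal (\<psi> x * exp (c * \<psi> x * (s - m))) =
       ennreal (\<psi> x) * ennreal (z * exp (c * \<psi> x * (s - m)))"
      using z \<psi>_pos'[OF x] by (simp add: ennreal_mult[symmetric] mult_ac)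
    also have "\<dots> \<le> ennreal (\<psi> x) * progeny_gf S \<mu> \<kappa> x z"
      using x supp by (intro mult_left_mono key) auto
    finally show "ennreal z * ennreal (\<psi> x * exp (c * \<psi> x * (s - m))) \<le> \<dots>" .
  qed
  finally show ?thesis using sm s by auto
qed

text \<open>Combines the two directions for z > 1. At z = 1 both conditions hold: the weighted sum
  equals m, and s = m is a witness because f(m) = m. From here on the radius is a question about f
  alone.\<close>

lemma r_radius_eq:
  "r_radius S \<mu> \<psi> c = Sup {ereal z | z. z \<ge> 1 \<and> (\<exists>s\<ge>m. ennreal z * tilted s \<le> ennreal s)}"
proof -
  have "(\<Sum>\<^sub>\<infinity>x\<in>S. ennreal (pmf \<mu> x * \<psi> x) * progeny_gf S \<mu> \<kappa> x z) = weighted_gf z" for z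
  proof -
    have "ennreal (pmf \<mu> x * \<psi> x) * progeny_gf S \<mu> \<kappa> x z =
        ennreal (pmf \<mu> x) * (ennreal (\<psi> x) * progeny_gf S \<mu> \<kappa> x z)" if "x \<in> S" for x
      using \<psi>_pos[OF that] by (simp add: ennreal_mult mult_ac)
    then have "(\<Sum>\<^sub>\<infinity>x\<in>S. ennreal (pmf \<mu> x * \<psi> x) * progeny_gf S \<mu> \<kappa> x z) =
       (\<Sum>\<^sub>\<infinity>x\<in>S. ennreal (pmf \<mu> x) * (ennreal (\<psi> x) * progeny_gf S \<mu> \<kappa> x z))"
      by (intro infsum_cong)
    then show ?thesis
      by (simp add: nn_integral_pmf_eq_infsum[OF countable_S supp] weighted_gf_def)
  qed
  moreover have "weighted_gf z < \<infinity> \<longleftrightarrow> (\<exists>s\<ge>m. ennreal z * tilted s \<le> ennreal s)" if "z \<ge> 1" for z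
  proof (cases "z = 1")
    case True
    have "weighted_gf 1 = ennreal m" by (simp add: weighted_gf_def progeny_gf_1 nn_integral_\<psi>)
    then show ?thesis using True by (auto intro!: exI[of _ m] simp: tilted_m)
  next
    case False
    then show ?thesis
      using that tilted_le_if_weighted_gf_finite weighted_gf_finite by force
  qed
  ultimately show ?thesis
    unfolding r_radius_def by (intro arg_cong[of _ _ Sup]) auto
qed

end


section \<open>Exploration of the random graph\<close>

definition pairs_on :: "nat set \<Rightarrow> (nat \<times> nat) set" where
  "pairs_on V = {(i, j). i \<in> V \<and> j \<in> V \<and> i < j}"

text \<open>Sorts the endpoints, so that an undirected edge is a single coordinate of the product
  measure.\<close>

definition key :: "nat \<Rightarrow> nat \<Rightarrow> nat \<times> nat" where
  "key i j = (min i j, max i j)"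

definition adj :: "(nat \<times> nat \<Rightarrow> bool) \<Rightarrow> nat \<Rightarrow> nat \<Rightarrow> bool" where
  "adj b i j \<longleftrightarrow> i \<noteq> j \<and> b (key i j)"

text \<open>The vertices reached from the active set \<open>A\<close> inside the graph induced on
  \<open>V\<close>. Explored vertices are deleted from \<open>V\<close>, so an exploration in
  progress is again of this form.\<close>

definition reach :: "(nat \<times> nat \<Rightarrow> bool) \<Rightarrow> nat set \<Rightarrow> nat set \<Rightarrow> nat set" where
  "reach b A V = {v \<in> V. \<exists>a\<in>A. (a, v) \<in> {(u, w). u \<in> V \<and> w \<in> V \<and> adj b u w}\<^sup>*}"

abbreviation edge_pmf :: "(nat \<times> nat \<Rightarrow> real) \<Rightarrow> (nat \<times> nat) set \<Rightarrow> (nat \<times> nat \<Rightarrow> bool) pmf" where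
  "edge_pmf p I \<equiv> Pi_pmf I False (\<lambda>e. bernoulli_pmf (p e))"

section \<open>Graph search by successive removal of vertices\<close>

lemma key_commute: "key i j = key j i"
  by (auto simp: key_def min_def max_def)

lemma key_in_pairs_on: "i \<in> V \<Longrightarrow> j \<in> V \<Longrightarrow> i \<noteq> j \<Longrightarrow> key i j \<in> pairs_on V"
  by (auto simp: key_def pairs_on_def min_def max_def)

lemma key_eq_iff: "key i j = key i' j' \<longleftrightarrow> (i = i' \<and> j = j') \<or> (i = j' \<and> j = i')"
  by (auto simp: key_def min_def max_def split: if_splits)

lemma adj_commute: "adj b i j = adj b j i"
  by (auto simp: adj_def key_commute)

lemma finite_pairs_on: "finite V \<Longrightarrow> finite (pairs_on V)"
  by (rule finite_subset[of _ "V \<times> V"]) (auto simp: pairs_on_def)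

lemma pairs_on_mono: "V \<subseteq> V' \<Longrightarrow> pairs_on V \<subseteq> pairs_on V'"
  by (auto simp: pairs_on_def)

lemma pairs_on_disjoint: "V \<inter> V' = {} \<Longrightarrow> pairs_on V \<inter> pairs_on V' = {}"
  by (auto simp: pairs_on_def)

lemma reach_subset: "reach b A V \<subseteq> V"
  by (auto simp: reach_def)

lemma subset_reach: "A \<subseteq> V \<Longrightarrow> A \<subseteq> reach b A V"
  by (auto simp: reach_def)

lemma reach_empty: "reach b {} V = {}"
  by (auto simp: reach_def)

lemma reach_closed:
  assumes "u \<in> reach b A V" "w \<in> V" "adj b u w"
  shows "w \<in> reach b A V"
  using assms unfolding reach_def by (auto intro: rtrancl_into_rtrancl)

lemma reach_induct [consumes 2, case_names base step]:
  assumes "v \<in> reach b A V" "A \<subseteq> V"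
    and base: "\<And>a. a \<in> A \<Longrightarrow> P a"
    and step: "\<And>u w. u \<in> V \<Longrightarrow> w \<in> V \<Longrightarrow> adj b u w \<Longrightarrow> u \<in> reach b A V \<Longrightarrow> P u \<Longrightarrow> P w"
  shows "P v"
proof -
  obtain a where a: "a \<in> A" "(a, v) \<in> {(u, w). u \<in> V \<and> w \<in> V \<and> adj b u w}\<^sup>*"
    using assms(1) by (auto simp: reach_def)
  from a(2) have "v \<in> reach b A V \<and> P v"
  proof (induction rule: rtrancl_induct)
    case base
    then show ?case using a(1) assms(2) subset_reach[of A V b] by (auto intro: assms(3))
  next
    case (step u w)
    then show ?case by (auto intro: reach_closed assms(4))
  qed
  then show ?thesis ..
qed

lemma reach_cong:
  assumes "A \<subseteq> V" "\<And>e. e \<in> pairs_on V \<Longrightarrow> b e = b' e"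
  shows "reach b A V = reach b' A V"
proof -
  have "{(u, w). u \<in> V \<and> w \<in> V \<and> adj b u w} = {(u, w). u \<in> V \<and> w \<in> V \<and> adj b' u w}"
    using assms(2)[OF key_in_pairs_on] by (auto simp: adj_def)
  then show ?thesis by (simp add: reach_def)
qed

lemma reach_mono:
  assumes "A \<subseteq> A'" "V \<subseteq> V'"
  shows "reach b A V \<subseteq> reach b A' V'"
proof -
  have "{(u, w). u \<in> V \<and> w \<in> V \<and> adj b u w}\<^sup>* \<subseteq> {(u, w). u \<in> V' \<and> w \<in> V' \<and> adj b u w}\<^sup>*"
    using assms by (intro rtrancl_mono) auto
  then show ?thesis using assms by (auto simp: reach_def)
qed

text \<open>Processing the active vertex \<open>a\<close>: its neighbours become active and it
  leaves the graph. No later step looks at an edge at \<open>a\<close>, which is why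
  \<open>V\<close> may shrink.\<close>

lemma reach_step:
  assumes "a \<in> A" "A \<subseteq> V"
  shows "reach b A V = insert a (reach b (A - {a} \<union> {v \<in> V - {a}. adj b a v}) (V - {a}))"
    (is "_ = insert a (reach b ?A ?V)")
proof (intro equalityI subsetI)
  have A: "?A \<subseteq> ?V" using assms by auto
  fix v assume "v \<in> reach b A V"
  then show "v \<in> insert a (reach b ?A ?V)" using assms(2)
  proof (induction rule: reach_induct)
    case (base a')
    then show ?case using subset_reach[OF A, of b] by auto
  next
    case (step u w)
    show ?case
    proof (cases "w = a \<or> u = a")
      case True
      then show ?thesis using step subset_reach[OF A, of b] by auto
    next
      case False
      then show ?thesis using step by (auto intro: reach_closed)
    qed
  qed
next
  fix v assume v: "v \<in> insert a (reach b ?A ?V)"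
  have a: "a \<in> reach b A V" using assms subset_reach by blast
  show "v \<in> reach b A V"
  proof (cases "v = a")
    case False
    with v have "v \<in> reach b ?A ?V" by simp
    moreover have "?A \<subseteq> ?V" using assms by auto
    ultimately show ?thesis
    proof (induction rule: reach_induct)
      case (base a')
      then show ?case using assms a subset_reach[of A V b] by (auto intro: reach_closed)
    next
      case (step u w)
      then show ?case by (auto intro: reach_closed)
    qed
  qed (use a in simp)
qed

lemma pairs_on_split:
  assumes "a \<in> V"
  shows "pairs_on V = key a ` (V - {a}) \<union> pairs_on (V - {a})"
    "key a ` (V - {a}) \<inter> pairs_on (V - {a}) = {}"
proof -
  show "pairs_on V = key a ` (V - {a}) \<union> pairs_on (V - {a})"
  proof (intro equalityI subsetI)
    fix e assume e: "e \<in> pairs_on V"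
    then obtain i j where ij: "e = (i, j)" "i \<in> V" "j \<in> V" "i < j" by (auto simp: pairs_on_def)
    then have "e = key i j" "e = key j i" by (auto simp: key_def)
    then show "e \<in> key a ` (V - {a}) \<union> pairs_on (V - {a})"
    proof (cases "i = a \<or> j = a")
      case True
      then have "e = key a (if i = a then j else i)" "(if i = a then j else i) \<in> V - {a}"
        using ij \<open>e = key i j\<close> \<open>e = key j i\<close> by auto
      then show ?thesis by blast
    qed (use ij in \<open>auto simp: pairs_on_def\<close>)
  next
    fix e assume e: "e \<in> key a ` (V - {a}) \<union> pairs_on (V - {a})"
    then show "e \<in> pairs_on V"
      using pairs_on_mono[of "V - {a}" V] assms by (auto intro: key_in_pairs_on)
  qed
  show "key a ` (V - {a}) \<inter> pairs_on (V - {a}) = {}"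
    by (auto simp: key_def pairs_on_def min_def max_def split: if_splits)
qed

lemma nn_integral_Pi_pmf_union:
  assumes "finite A" "finite B" "A \<inter> B = {}"
  shows "(\<integral>\<^sup>+b. f b \<partial>Pi_pmf (A \<union> B) d p) =
    (\<integral>\<^sup>+b1. \<integral>\<^sup>+b2. f (\<lambda>x. if x \<in> A then b1 x else b2 x) \<partial>Pi_pmf B d p \<partial>Pi_pmf A d p)"
  using assms by (subst Pi_pmf_union) (simp_all add: nn_integral_pair_pmf' case_prod_beta' fst_conv snd_conv cong: if_cong)

text \<open>The edges at \<open>a\<close> and those inside \<open>V - {a}\<close> are disjoint
  coordinates; given the neighbourhood of \<open>a\<close>, described by \<open>b1\<close>, the rest
  is an exploration with fresh edges.\<close>

lemma nn_integral_reach_step: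
  assumes V: "finite V" and a: "a \<in> A" "A \<subseteq> V"
  shows "(\<integral>\<^sup>+b. f (reach b A V) \<partial>edge_pmf p (pairs_on V)) =
    (\<integral>\<^sup>+b1. \<integral>\<^sup>+b2. f (insert a (reach b2 (A - {a} \<union> {v \<in> V - {a}. b1 (key a v)}) (V - {a})))
      \<partial>edge_pmf p (pairs_on (V - {a})) \<partial>edge_pmf p (key a ` (V - {a})))"
proof -
  have aV: "a \<in> V" using a by auto
  let ?b = "\<lambda>b1 b2 x. if x \<in> key a ` (V - {a}) then b1 x else b2 x"
  have "reach (?b b1 b2) A V =
      insert a (reach b2 (A - {a} \<union> {v \<in> V - {a}. b1 (key a v)}) (V - {a}))" for b1 b2 :: "nat \<times> nat \<Rightarrow> bool"
  proof -
    have "{v \<in> V - {a}. adj (?b b1 b2) a v} = {v \<in> V - {a}. b1 (key a v)}"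
      by (auto simp: adj_def)
    then have "reach (?b b1 b2) A V =
        insert a (reach (?b b1 b2) (A - {a} \<union> {v \<in> V - {a}. b1 (key a v)}) (V - {a}))"
      using reach_step[OF a, of "?b b1 b2"] by simp
    also have "reach (?b b1 b2) (A - {a} \<union> {v \<in> V - {a}. b1 (key a v)}) (V - {a})
        = reach b2 (A - {a} \<union> {v \<in> V - {a}. b1 (key a v)}) (V - {a})"
      using pairs_on_split(2)[OF aV] a by (intro reach_cong) auto
    finally show ?thesis .
  qed
  then show ?thesis
    unfolding pairs_on_split(1)[OF aV]
    using V pairs_on_split(2)[OF aV] by (subst nn_integral_Pi_pmf_union) (auto simp: finite_pairs_on)
qed

lemma inj_on_key: "inj_on (key a) X"
  by (auto simp: inj_on_def key_eq_iff)

text \<open>When the neighbours of one active vertex are revealed at a time, the product of \<open>\<phi>\<close> over the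
  active vertices, weighted by \<open>z\<close> per explored vertex, is a supermartingale.\<close>

lemma nn_integral_reach_le:
  fixes p :: "nat \<times> nat \<Rightarrow> real" and \<phi> :: "nat \<Rightarrow> real" and z :: real
  assumes V0: "finite V0" and V: "V \<subseteq> V0" and A: "A \<subseteq> V"
    and p: "\<And>e. e \<in> pairs_on V0 \<Longrightarrow> 0 \<le> p e \<and> p e \<le> 1"
    and \<phi>: "\<And>v. v \<in> V0 \<Longrightarrow> \<phi> v \<ge> 1" and z: "z \<ge> 1"
    and super: "\<And>a. a \<in> V0 \<Longrightarrow> z * exp (\<Sum>v\<in>V0 - {a}. p (key a v) * (\<phi> v - 1)) \<le> \<phi> a"
  shows "(\<integral>\<^sup>+b. ennreal (z ^ card (reach b A V)) \<partial>edge_pmf p (pairs_on V)) \<le> ennreal (\<Prod>v\<in>A. \<phi> v)"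
proof -
  have "finite V" using V V0 finite_subset by auto
  then show ?thesis using V A
  \<comment> \<open>Only \<open>V\<close> shrinks. The condition \<open>super\<close> stays
    formulated on the full vertex set \<open>V0\<close>, which is enough because its summands are
    nonnegative.\<close>
  proof (induction "card V" arbitrary: V A)
    case 0
    then show ?case by (simp add: reach_empty measure_pmf.emeasure_space_1[simplified])
  next
    case (Suc n)
    show ?case
    proof (cases "A = {}")
      case True
      then show ?thesis by (simp add: reach_empty measure_pmf.emeasure_space_1[simplified])
    next
      case False
      then obtain a where a: "a \<in> A" by auto
      then have aV: "a \<in> V" and finV: "finite V" and finA: "finite A"
        using Suc.prems finite_subset by auto
      let ?A = "\<lambda>b. A - {a} \<union> {v \<in> V - {a}. b (key a v)}"
      have \<phi>': "\<phi> v \<ge> 1" if "v \<in> V" for v using that Suc.prems \<phi> by auto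
      have pe: "0 \<le> p (key a v) \<and> p (key a v) \<le> 1" if "v \<in> V - {a}" for v
        using that aV Suc.prems by (intro p key_in_pairs_on) auto
      have "(\<integral>\<^sup>+b. ennreal (z ^ card (reach b A V)) \<partial>edge_pmf p (pairs_on V)) =
        (\<integral>\<^sup>+b1. \<integral>\<^sup>+b2. ennreal (z ^ card (insert a (reach b2 (?A b1) (V - {a}))))
          \<partial>edge_pmf p (pairs_on (V - {a})) \<partial>edge_pmf p (key a ` (V - {a})))"
        by (rule nn_integral_reach_step[OF finV a Suc.prems(3)])
      also have "\<dots> = (\<integral>\<^sup>+b1. \<integral>\<^sup>+b2. ennreal z * ennreal (z ^ card (reach b2 (?A b1) (V - {a})))
          \<partial>edge_pmf p (pairs_on (V - {a})) \<partial>edge_pmf p (key a ` (V - {a})))"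
      proof -
        have "card (insert a (reach b2 (?A b1) (V - {a}))) = Suc (card (reach b2 (?A b1) (V - {a})))"
          for b1 b2 :: "nat \<times> nat \<Rightarrow> bool"
        proof (rule card_insert_disjoint)
          show "finite (reach b2 (?A b1) (V - {a}))"
            using finV by (rule finite_subset[OF reach_subset, OF finite_Diff])
          show "a \<notin> reach b2 (?A b1) (V - {a})"
            using reach_subset[of b2 "?A b1" "V - {a}"] by auto
        qed
        then show ?thesis using z by (simp add: ennreal_mult)
      qed
      also have "\<dots> \<le> (\<integral>\<^sup>+b1. ennreal z * ennreal (\<Prod>v\<in>?A b1. \<phi> v) \<partial>edge_pmf p (key a ` (V - {a})))"
      proof (intro nn_integral_mono)
        fix b1 :: "nat \<times> nat \<Rightarrow> bool"
        have "(\<integral>\<^sup>+b2. ennreal (z ^ card (reach b2 (?A b1) (V - {a}))) \<partial>edge_pmf p (pairs_on (V - {a})))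
            \<le> ennreal (\<Prod>v\<in>?A b1. \<phi> v)"
          using Suc.hyps(2) Suc.prems aV by (intro Suc.hyps(1)) auto
        then show "(\<integral>\<^sup>+b2. ennreal z * ennreal (z ^ card (reach b2 (?A b1) (V - {a})))
            \<partial>edge_pmf p (pairs_on (V - {a}))) \<le> ennreal z * ennreal (\<Prod>v\<in>?A b1. \<phi> v)"
          by (simp add: nn_integral_cmult mult_left_mono)
      qed
      also have "\<dots> \<le> (\<integral>\<^sup>+b1. ennreal (z * (\<Prod>v\<in>A - {a}. \<phi> v)) *
          (\<Prod>e\<in>key a ` (V - {a}). ennreal (if b1 e then \<phi> (if fst e = a then snd e else fst e) else 1))
          \<partial>edge_pmf p (key a ` (V - {a})))"
      proof (intro nn_integral_mono)
        fix b1 :: "nat \<times> nat \<Rightarrow> bool"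
        let ?N = "{v \<in> V - {a}. b1 (key a v)}"
        \<comment> \<open>Vertices that are both active and newly found are counted twice on the
          right; this can only increase the product, because \<phi> is at least 1.\<close>
        have "(\<Prod>v\<in>?A b1. \<phi> v) \<le> (\<Prod>v\<in>A - {a}. \<phi> v) * (\<Prod>v\<in>?N. \<phi> v)"
        proof -
          have "(\<Prod>v\<in>?A b1. \<phi> v) * 1 \<le> (\<Prod>v\<in>?A b1. \<phi> v) * (\<Prod>v\<in>(A - {a}) \<inter> ?N. \<phi> v)"
            using Suc.prems \<phi>' by (intro mult_left_mono prod_ge_1 prod_nonneg)
              (auto intro: order_trans[OF zero_le_one])
          also have "\<dots> = (\<Prod>v\<in>A - {a}. \<phi> v) * (\<Prod>v\<in>?N. \<phi> v)"
            using finA finV by (intro prod.union_inter) auto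
          finally show ?thesis by simp
        qed
        also have "(\<Prod>v\<in>?N. \<phi> v) = (\<Prod>v\<in>V - {a}. if b1 (key a v) then \<phi> v else 1)"
          using finV by (intro prod.mono_neutral_cong_left) auto
        also have "\<dots> = (\<Prod>e\<in>key a ` (V - {a}). if b1 e then \<phi> (if fst e = a then snd e else fst e) else 1)"
          by (subst prod.reindex[OF inj_on_key], intro prod.cong refl)
            (auto simp: key_def min_def max_def)
        finally have "z * (\<Prod>v\<in>?A b1. \<phi> v) \<le> z * ((\<Prod>v\<in>A - {a}. \<phi> v) *
           (\<Prod>e\<in>key a ` (V - {a}). if b1 e then \<phi> (if fst e = a then snd e else fst e) else 1))"
          using z by (intro mult_left_mono) auto
        moreover have "0 \<le> (if b1 e then \<phi> (if fst e = a then snd e else fst e) else 1)"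
          if e: "e \<in> key a ` (V - {a})" for e
        proof -
          obtain v where "v \<in> V" "e = key a v" "v \<noteq> a" using e by auto
          then show ?thesis using \<phi>'[of v] by (auto simp: key_def min_def max_def)
        qed
        moreover have "0 \<le> \<phi> v" if "v \<in> A" for v
          using \<phi>'[of v] that Suc.prems by (auto intro: order_trans[OF zero_le_one])
        ultimately show "ennreal z * ennreal (\<Prod>v\<in>?A b1. \<phi> v) \<le> ennreal (z * (\<Prod>v\<in>A - {a}. \<phi> v)) *
          (\<Prod>e\<in>key a ` (V - {a}). ennreal (if b1 e then \<phi> (if fst e = a then snd e else fst e) else 1))"
          using z by (subst prod_ennreal, simp)
            (simp add: ennreal_mult'[symmetric] ennreal_mult''[symmetric] prod_nonneg mult.assoc ennreal_leI)
      qed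
      also have "\<dots> = ennreal (z * (\<Prod>v\<in>A - {a}. \<phi> v)) *
          (\<Prod>e\<in>key a ` (V - {a}). \<integral>\<^sup>+x. ennreal (if x then \<phi> (if fst e = a then snd e else fst e) else 1)
            \<partial>bernoulli_pmf (p e))"
        using finV by (subst nn_integral_cmult, simp) (subst nn_integral_prod_Pi_pmf[where
          f = "\<lambda>e x. ennreal (if x then \<phi> (if fst e = a then snd e else fst e) else 1)"], auto)
      also have "\<dots> = ennreal (z * (\<Prod>v\<in>A - {a}. \<phi> v)) *
          (\<Prod>v\<in>V - {a}. ennreal (1 + p (key a v) * (\<phi> v - 1)))"
      proof (subst prod.reindex[OF inj_on_key], intro arg_cong2[of _ _ _ _ "(*)"] refl prod.cong)
        fix v assume v: "v \<in> V - {a}"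
        have *: "(if fst (key a v) = a then snd (key a v) else fst (key a v)) = v"
          using v by (auto simp: key_def min_def max_def)
        have "ennreal (\<phi> v) * ennreal (p (key a v)) + ennreal (1 - p (key a v)) =
            ennreal (\<phi> v * p (key a v) + (1 - p (key a v)))"
          using pe[OF v] \<phi>'[of v] v
          by (subst ennreal_mult[symmetric], simp, simp, subst ennreal_plus[symmetric]) auto
        then show "((\<lambda>e. \<integral>\<^sup>+x. ennreal (if x then \<phi> (if fst e = a then snd e else fst e) else 1)
            \<partial>bernoulli_pmf (p e)) \<circ> key a) v = ennreal (1 + p (key a v) * (\<phi> v - 1))"
          unfolding o_def * using pe[OF v] by (simp add: algebra_simps)
      qed
      also have "\<dots> = ennreal ((\<Prod>v\<in>A - {a}. \<phi> v) * (z * (\<Prod>v\<in>V - {a}. 1 + p (key a v) * (\<phi> v - 1))))"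
      proof -
        have nn: "0 \<le> 1 + p (key a v) * (\<phi> v - 1)" if "v \<in> V - {a}" for v
          using pe[OF that] \<phi>'[of v] that by (intro add_nonneg_nonneg mult_nonneg_nonneg) auto
        then have "0 \<le> (\<Prod>v\<in>V - {a}. 1 + p (key a v) * (\<phi> v - 1))"
          by (rule prod_nonneg)
        then show ?thesis
          by (subst prod_ennreal[OF nn]) (simp_all only: ennreal_mult''[symmetric] mult.assoc mult.left_commute)
      qed
      also have "\<dots> \<le> ennreal ((\<Prod>v\<in>A - {a}. \<phi> v) * \<phi> a)"
      proof (intro ennreal_leI mult_left_mono)
        have "(\<Prod>v\<in>V - {a}. 1 + p (key a v) * (\<phi> v - 1)) \<le> (\<Prod>v\<in>V - {a}. exp (p (key a v) * (\<phi> v - 1)))"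
          using pe \<phi>' by (intro prod_mono conjI add_nonneg_nonneg mult_nonneg_nonneg) auto
        also have "\<dots> = exp (\<Sum>v\<in>V - {a}. p (key a v) * (\<phi> v - 1))"
          using finV by (simp add: exp_sum)
        also have "\<dots> \<le> exp (\<Sum>v\<in>V0 - {a}. p (key a v) * (\<phi> v - 1))"
        proof -
          have "0 \<le> p (key a v) * (\<phi> v - 1)" if "v \<in> V0 - {a}" for v
            using that aV Suc.prems \<phi>[of v] p[OF key_in_pairs_on[of a V0 v]] by (intro mult_nonneg_nonneg) auto
          then have "(\<Sum>v\<in>V - {a}. p (key a v) * (\<phi> v - 1)) \<le> (\<Sum>v\<in>V0 - {a}. p (key a v) * (\<phi> v - 1))"
            using Suc.prems V0 by (intro sum_mono2) auto
          then show ?thesis by simp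
        qed
        finally have "z * (\<Prod>v\<in>V - {a}. 1 + p (key a v) * (\<phi> v - 1)) \<le>
            z * exp (\<Sum>v\<in>V0 - {a}. p (key a v) * (\<phi> v - 1))"
          using z by (intro mult_left_mono) auto
        also have "\<dots> \<le> \<phi> a" using aV Suc.prems by (intro super) auto
        finally show "z * (\<Prod>v\<in>V - {a}. 1 + p (key a v) * (\<phi> v - 1)) \<le> \<phi> a" .
        show "0 \<le> (\<Prod>v\<in>A - {a}. \<phi> v)"
          using Suc.prems \<phi>' by (intro prod_nonneg) (auto intro: order_trans[OF zero_le_one])
      qed
      also have "(\<Prod>v\<in>A - {a}. \<phi> v) * \<phi> a = (\<Prod>v\<in>A. \<phi> v)"
        using a finA by (simp add: prod.remove[of A a] mult.commute)
      finally show ?thesis .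
    qed
  qed
qed


section \<open>Connectivity and isolated components\<close>

lemma sum_Pow_power:
  fixes x y :: real
  assumes "finite B"
  shows "(\<Sum>D\<in>Pow B. x ^ card D * y ^ card (B - D)) = (x + y) ^ card B"
  using prod_add[OF assms, of "\<lambda>_. x" "\<lambda>_. y"] by simp

text \<open>A marked element must lie in \<open>D\<close> and contributes x, while the others
  contribute x + y each. Multiplying through by x + y avoids the exponent
  \<open>card B - 1\<close>.\<close>

lemma sum_Pow_power_weighted:
  fixes x y :: real and w :: "'a \<Rightarrow> real"
  assumes "finite B"
  shows "(\<Sum>D\<in>Pow B. sum w D * x ^ card D * y ^ card (B - D)) * (x + y) = sum w B * x * (x + y) ^ card B"
  using assms
proof (induction rule: finite_induct)
  case (insert e B)
  let ?S = "\<Sum>D\<in>Pow B. sum w D * x ^ card D * y ^ card (B - D)"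
  have fin: "finite D" if "D \<in> Pow B" for D
    using that insert.hyps finite_subset by auto
  have "(\<Sum>D\<in>Pow (insert e B). sum w D * x ^ card D * y ^ card (insert e B - D)) =
      (\<Sum>D\<in>Pow B. sum w D * x ^ card D * y ^ card (insert e B - D)) +
      (\<Sum>D\<in>insert e ` Pow B. sum w D * x ^ card D * y ^ card (insert e B - D))"
    unfolding Pow_insert using insert.hyps by (intro sum.union_disjoint) auto
  also have "(\<Sum>D\<in>Pow B. sum w D * x ^ card D * y ^ card (insert e B - D)) = y * ?S"
    unfolding sum_distrib_left
  proof (intro sum.cong refl)
    fix D assume D: "D \<in> Pow B"
    then have "insert e B - D = insert e (B - D)" "e \<notin> B - D" using insert.hyps by auto
    then show "sum w D * x ^ card D * y ^ card (insert e B - D) = y * (sum w D * x ^ card D * y ^ card (B - D))"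
      using insert.hyps by simp
  qed
  also have "(\<Sum>D\<in>insert e ` Pow B. sum w D * x ^ card D * y ^ card (insert e B - D)) =
      (\<Sum>D\<in>Pow B. x * (sum w D * x ^ card D * y ^ card (B - D)) + x * w e * (x ^ card D * y ^ card (B - D)))"
  proof (subst sum.reindex)
    show "inj_on (insert e) (Pow B)" using insert.hyps by (auto simp: inj_on_def)
    show "sum ((\<lambda>D. sum w D * x ^ card D * y ^ card (insert e B - D)) \<circ> insert e) (Pow B) =
      (\<Sum>D\<in>Pow B. x * (sum w D * x ^ card D * y ^ card (B - D)) + x * w e * (x ^ card D * y ^ card (B - D)))"
    proof (intro sum.cong refl)
      fix D assume D: "D \<in> Pow B"
      then have "e \<notin> D" "insert e B - insert e D = B - D" using insert.hyps by auto
      then show "((\<lambda>D. sum w D * x ^ card D * y ^ card (insert e B - D)) \<circ> insert e) D =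
          x * (sum w D * x ^ card D * y ^ card (B - D)) + x * w e * (x ^ card D * y ^ card (B - D))"
        using fin[OF D] by (simp add: algebra_simps)
    qed
  qed
  also have "\<dots> = x * ?S + x * w e * (x + y) ^ card B"
    by (simp add: sum.distrib sum_distrib_left[symmetric] sum_Pow_power[OF insert.hyps(1)])
  finally have "(\<Sum>D\<in>Pow (insert e B). sum w D * x ^ card D * y ^ card (insert e B - D)) * (x + y)
     = (x + y) * (?S * (x + y)) + x * w e * (x + y) ^ card B * (x + y)"
    by (simp add: algebra_simps)
  also have "\<dots> = sum w (insert e B) * x * (x + y) ^ card (insert e B)"
    unfolding insert.IH using insert.hyps by (simp add: algebra_simps)
  finally show ?case .
qed simp

lemma of_bool_Ball_eq_prod:
  "finite X \<Longrightarrow> (of_bool (\<forall>v\<in>X. Q v) :: 'b :: comm_semiring_1) = (\<Prod>v\<in>X. of_bool (Q v))"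
  by (induction X rule: finite_induct) (simp_all add: of_bool_conj)

text \<open>Supplies the weight of a prescribed neighbourhood when a vertex is removed in the
  recursion for connectedness.\<close>

lemma nn_integral_star_eq:
  fixes p :: "nat \<times> nat \<Rightarrow> real"
  assumes X: "finite X" and D: "D \<subseteq> X" and p: "\<And>v. v \<in> X \<Longrightarrow> 0 \<le> p (key a v) \<and> p (key a v) \<le> 1"
  shows "(\<integral>\<^sup>+b. of_bool ({v \<in> X. b (key a v)} = D) \<partial>edge_pmf p (key a ` X)) =
    ennreal ((\<Prod>v\<in>D. p (key a v)) * (\<Prod>v\<in>X - D. 1 - p (key a v)))"
proof -
  have "of_bool ({v \<in> X. b (key a v)} = D) =
      (\<Prod>e\<in>key a ` X. of_bool (b e = (e \<in> key a ` D)) :: ennreal)" for b :: "nat \<times> nat \<Rightarrow> bool"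
  proof -
    have inj: "key a v \<in> key a ` D \<longleftrightarrow> v \<in> D" for v
      by (metis image_iff inj_on_key inj_onD UNIV_I)
    have "{v \<in> X. b (key a v)} = D \<longleftrightarrow> (\<forall>v\<in>X. b (key a v) = (v \<in> D))"
      using D by auto
    then show ?thesis
      using X by (simp only: prod.reindex[OF inj_on_key] o_def inj of_bool_Ball_eq_prod)
  qed
  then have "(\<integral>\<^sup>+b. of_bool ({v \<in> X. b (key a v)} = D) \<partial>edge_pmf p (key a ` X)) =
    (\<Prod>e\<in>key a ` X. \<integral>\<^sup>+x. of_bool (x = (e \<in> key a ` D)) \<partial>bernoulli_pmf (p e))"
    using X by (simp only:) (subst nn_integral_prod_Pi_pmf[where
        f = "\<lambda>e x. of_bool (x = (e \<in> key a ` D)) :: ennreal"], auto)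
  also have "\<dots> = (\<Prod>v\<in>X. ennreal (if v \<in> D then p (key a v) else 1 - p (key a v)))"
    unfolding prod.reindex[OF inj_on_key] o_def
  proof (intro prod.cong refl)
    fix v assume v: "v \<in> X"
    have inj: "key a v \<in> key a ` D \<longleftrightarrow> v \<in> D"
      by (metis image_iff inj_on_key inj_onD UNIV_I)
    show "(\<integral>\<^sup>+x. of_bool (x = (key a v \<in> key a ` D)) \<partial>bernoulli_pmf (p (key a v))) =
        ennreal (if v \<in> D then p (key a v) else 1 - p (key a v))"
      unfolding inj using p[OF v] by simp
  qed
  also have "\<dots> = ennreal (\<Prod>v\<in>X. if v \<in> D then p (key a v) else 1 - p (key a v))"
    using p by (intro prod_ennreal) auto
  also have "(\<Prod>v\<in>X. if v \<in> D then p (key a v) else 1 - p (key a v)) =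
      (\<Prod>v\<in>D. p (key a v)) * (\<Prod>v\<in>X - D. 1 - p (key a v))"
    using X D by (subst prod.If_cases) (auto simp: Int_absorb1 Diff_eq)
  finally show ?thesis .
qed

text \<open>The right-hand side without \<open>q\<close> is the total weight of the forests on \<open>V\<close> with root set \<open>A\<close>, in
  which an edge \<open>ij\<close> has weight \<open>k w\<^sub>i w\<^sub>j\<close> (a weighted form of Cayley's formula); the factor \<open>q\<close>
  accounts for the absence of all other edges.\<close>

lemma nn_integral_connected_ge:
  fixes p :: "nat \<times> nat \<Rightarrow> real" and w :: "nat \<Rightarrow> real" and k q :: real
  assumes "finite V" "V \<noteq> {}" "A \<subseteq> V"
    and "\<And>i j. i \<in> V \<Longrightarrow> j \<in> V \<Longrightarrow> i \<noteq> j \<Longrightarrow> p (key i j) = k * w i * w j"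
    and "\<And>i. i \<in> V \<Longrightarrow> w i > 0" and "k \<ge> 0"
    and "\<And>e. e \<in> pairs_on V \<Longrightarrow> q \<le> 1 - p e" and "0 \<le> q" "q \<le> 1"
  shows "ennreal (q ^ (card V)\<^sup>2 * k ^ card (V - A) * (\<Prod>v\<in>V - A. w v) * sum w A * sum w V ^ card (V - A) / sum w V)
     \<le> (\<integral>\<^sup>+b. of_bool (reach b A V = V) \<partial>edge_pmf p (pairs_on V))"
  using assms
proof (induction "card V" arbitrary: V A)
  case 0
  then show ?case by simp
next
  case (Suc n)
  show ?case
  proof (cases "A = {}")
    case False
    then obtain a where a: "a \<in> A" by auto
    note V = Suc.prems(1-3) and pkw = Suc.prems(4) and w = Suc.prems(5) and k = Suc.prems(6)
      and pq = Suc.prems(7) and q = Suc.prems(8,9)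
    have aV: "a \<in> V" and finA: "finite A" using a V finite_subset by auto
    define X where "X = V - {a}"
    define B where "B = V - A"
    have X: "finite X" "card X = n" "a \<notin> X" and B: "finite B" "B \<subseteq> X"
      using Suc.hyps(2) V a by (auto simp: X_def B_def)
    have cardV: "card V = Suc n" using Suc.hyps(2) by simp
    have int: "(\<integral>\<^sup>+b. of_bool (reach b A V = V) \<partial>edge_pmf p (pairs_on V)) =
      (\<integral>\<^sup>+b1. \<integral>\<^sup>+b2. of_bool (insert a (reach b2 (A - {a} \<union> {v \<in> X. b1 (key a v)}) X) = V)
        \<partial>edge_pmf p (pairs_on X) \<partial>edge_pmf p (key a ` X))"
      unfolding X_def by (rule nn_integral_reach_step[OF V(1) a V(3)])
    show ?thesis
    proof (cases "X = {}")
      case True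
      then have "V = {a}" using aV X_def by auto
      moreover have "A = {a}" using a V \<open>V = {a}\<close> by auto
      ultimately show ?thesis
        unfolding int True using q w[of a] aV
        by (simp add: reach_def measure_pmf.emeasure_space_1[simplified])
    next
      case False
      have WX: "sum w X > 0" using w False X by (intro sum_pos) (auto simp: X_def)
      have WV: "sum w V = w a + sum w X" using aV V by (simp add: X_def sum.remove)
      have WA: "sum w A = w a + sum w (A - {a})" using a finA by (simp add: sum.remove)
      have WB: "sum w B = sum w V - sum w A" using V by (simp add: B_def sum_diff)
      define R where "R D = (\<integral>\<^sup>+b2. of_bool (reach b2 (A - {a} \<union> D) X = X) \<partial>edge_pmf p (pairs_on X))" for D
      have eqX: "insert a (reach b2 Y X) = V \<longleftrightarrow> reach b2 Y X = X" for b2 Y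
        using reach_subset[of b2 Y X] aV X(3) by (auto simp: X_def)
      \<comment> \<open>The inductive lower bound for the graph on \<open>X\<close> with active set
        \<open>A - {a} \<union> D\<close>, where \<open>D\<close> is the set of neighbours of
        \<open>a\<close> outside \<open>A\<close>.\<close>
      define T where "T D = q ^ n\<^sup>2 * k ^ card (B - D) * (\<Prod>v\<in>B - D. w v) *
         (sum w (A - {a}) + sum w D) * sum w X ^ card (B - D) / sum w X" for D
      have pe: "0 \<le> p (key a v) \<and> p (key a v) \<le> 1" if "v \<in> X" for v
      proof -
        have "v \<in> V" "v \<noteq> a" using that by (auto simp: X_def)
        then show ?thesis
          using pkw[of a v] w[of v] w[of a] k aV pq[OF key_in_pairs_on[of a V v]] q by auto
      qed
      have RT: "ennreal (T D) \<le> R D" if D: "D \<in> Pow B" for D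
      proof -
        have e1: "X - (A - {a} \<union> D) = B - D" using a by (auto simp: X_def B_def)
        have e2: "sum w (A - {a} \<union> D) = sum w (A - {a}) + sum w D"
          using finA D finite_subset[OF _ B(1)] by (intro sum.union_disjoint) (auto simp: B_def)
        have "ennreal (q ^ (card X)\<^sup>2 * k ^ card (X - (A - {a} \<union> D)) * (\<Prod>v\<in>X - (A - {a} \<union> D). w v) *
            sum w (A - {a} \<union> D) * sum w X ^ card (X - (A - {a} \<union> D)) / sum w X)
          \<le> (\<integral>\<^sup>+b. of_bool (reach b (A - {a} \<union> D) X = X) \<partial>edge_pmf p (pairs_on X))"
        proof (rule Suc.hyps(1))
          show "q \<le> 1 - p e" if "e \<in> pairs_on X" for e
            using that pairs_on_mono[of X V] by (intro pq) (auto simp: X_def)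
          show "A - {a} \<union> D \<subseteq> X" using D V a by (auto simp: X_def B_def)
        qed (use X False pkw w k q V in \<open>auto simp: X_def\<close>)
        then show ?thesis unfolding e1 e2 X(2) T_def R_def .
      qed
      have Tn: "T D \<ge> 0" if "D \<in> Pow B" for D
      proof -
        have "(\<Prod>v\<in>B - D. w v) \<ge> 0" using w by (intro prod_nonneg) (auto simp: B_def less_imp_le)
        moreover have "sum w (A - {a}) \<ge> 0" "sum w D \<ge> 0"
          using that w V by (auto intro!: sum_nonneg simp: B_def less_imp_le subset_iff)
        ultimately show ?thesis unfolding T_def using q k WX by simp
      qed
      define C where "C D = (\<Prod>v\<in>D. p (key a v)) * (\<Prod>v\<in>X - D. 1 - p (key a v))" for D
      have Cn: "C D \<ge> 0" if "D \<in> Pow B" for D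
        using that pe B unfolding C_def by (intro mult_nonneg_nonneg prod_nonneg) auto
      \<comment> \<open>The neighbourhood weight supplies at least \<open>q ^ n\<close> for the
        absent edges at \<open>a\<close> and a factor \<open>k * w a * w v\<close> for each edge to
        \<open>D\<close>. Together with \<open>T D\<close> the power of \<open>k\<close> and the
        product of weights are then those of all of \<open>B\<close>, independent of
        \<open>D\<close>.\<close>
      have CT: "q ^ (n\<^sup>2 + n) * k ^ card B * (\<Prod>v\<in>B. w v) / sum w X *
          (w a ^ card D * sum w X ^ card (B - D) * (sum w (A - {a}) + sum w D)) \<le> C D * T D"
        if D: "D \<in> Pow B" for D
      proof -
        have finD: "finite D" using D B finite_subset by auto
        have cB: "card B = card D + card (B - D)"
          using D B finD by (metis Pow_iff card_Diff_subset card_mono le_add_diff_inverse)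
        have pB: "(\<Prod>v\<in>B. w v) = (\<Prod>v\<in>D. w v) * (\<Prod>v\<in>B - D. w v)"
          using D B by (subst prod.subset_diff[of D B]) (auto simp: mult.commute)
        have "(\<Prod>v\<in>D. p (key a v)) = (\<Prod>v\<in>D. k * w a * w v)"
        proof (intro prod.cong refl)
          fix v assume "v \<in> D"
          then have "v \<in> V" "v \<noteq> a" using D B X by (auto simp: X_def)
          then show "p (key a v) = k * w a * w v" using aV by (intro pkw) auto
        qed
        also have "\<dots> = k ^ card D * w a ^ card D * (\<Prod>v\<in>D. w v)"
          by (simp add: prod.distrib power_mult_distrib)
        finally have p1: "(\<Prod>v\<in>D. p (key a v)) = k ^ card D * w a ^ card D * (\<Prod>v\<in>D. w v)" .
        have "q ^ n \<le> q ^ card (X - D)"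
          using q X by (intro power_decreasing) (auto intro: card_mono)
        also have "\<dots> = (\<Prod>v\<in>X - D. q)" by simp
        also have "\<dots> \<le> (\<Prod>v\<in>X - D. 1 - p (key a v))"
        proof (intro prod_mono conjI q)
          fix v assume "v \<in> X - D"
          then show "q \<le> 1 - p (key a v)"
            using aV by (intro pq key_in_pairs_on) (auto simp: X_def)
        qed
        finally have p2: "q ^ n \<le> (\<Prod>v\<in>X - D. 1 - p (key a v))" .
        have "(\<Prod>v\<in>D. p (key a v)) * q ^ n * T D \<le> C D * T D"
          unfolding C_def using p2 Tn[OF D] pe D B
          by (intro mult_right_mono mult_left_mono prod_nonneg) auto
        moreover have "(\<Prod>v\<in>D. p (key a v)) * q ^ n * T D = q ^ (n\<^sup>2 + n) * k ^ card B * (\<Prod>v\<in>B. w v) / sum w X *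
          (w a ^ card D * sum w X ^ card (B - D) * (sum w (A - {a}) + sum w D))"
          unfolding p1 T_def cB pB by (simp add: power_add mult_ac)
        ultimately show ?thesis by simp
      qed
      have "q ^ (card V)\<^sup>2 * k ^ card (V - A) * (\<Prod>v\<in>V - A. w v) * sum w A * sum w V ^ card (V - A) / sum w V
         \<le> q ^ (n\<^sup>2 + n) * k ^ card B * (\<Prod>v\<in>B. w v) * (sum w A * sum w V ^ card B / sum w V)"
      proof -
        \<comment> \<open>(n + 1)^2 is at least n^2 + n, so the removed vertex pays for its at most
          n absent edges.\<close>
        have "q ^ (card V)\<^sup>2 \<le> q ^ (n\<^sup>2 + n)"
          using q unfolding cardV by (intro power_decreasing) (auto simp: power2_eq_square)
        moreover have "0 \<le> k ^ card B * (\<Prod>v\<in>B. w v) * (sum w A * sum w V ^ card B / sum w V)"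
          using w V k by (intro mult_nonneg_nonneg prod_nonneg divide_nonneg_nonneg sum_nonneg zero_le_power)
            (auto simp: B_def less_imp_le subset_iff)
        ultimately have "q ^ (card V)\<^sup>2 * (k ^ card B * (\<Prod>v\<in>B. w v) * (sum w A * sum w V ^ card B / sum w V))
          \<le> q ^ (n\<^sup>2 + n) * (k ^ card B * (\<Prod>v\<in>B. w v) * (sum w A * sum w V ^ card B / sum w V))"
          by (rule mult_right_mono)
        then show ?thesis by (simp add: B_def mult.assoc)
      qed
      \<comment> \<open>The forest recursion: summing over the children \<open>D\<close> of the root
        \<open>a\<close> with the two subset identities turns the formula for \<open>X\<close> into
        the one for \<open>V\<close>.\<close>
      also have "sum w A * sum w V ^ card B / sum w V = (1 / sum w X) *
          (\<Sum>D\<in>Pow B. w a ^ card D * sum w X ^ card (B - D) * (sum w (A - {a}) + sum w D))"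
      proof -
        let ?S1 = "\<Sum>D\<in>Pow B. w a ^ card D * sum w X ^ card (B - D)"
        let ?S2 = "\<Sum>D\<in>Pow B. sum w D * w a ^ card D * sum w X ^ card (B - D)"
        have WVp: "sum w V > 0" unfolding WV using WX w[OF aV] by simp
        have s1: "?S1 = sum w V ^ card B" unfolding WV by (rule sum_Pow_power[OF B(1)])
        have s2: "?S2 * sum w V = sum w B * w a * sum w V ^ card B"
          unfolding WV by (rule sum_Pow_power_weighted[OF B(1)])
        have "(\<Sum>D\<in>Pow B. w a ^ card D * sum w X ^ card (B - D) * (sum w (A - {a}) + sum w D)) =
            sum w (A - {a}) * ?S1 + ?S2"
          by (simp add: sum_distrib_left sum.distrib[symmetric] algebra_simps)
        also have "\<dots> * sum w V = (sum w (A - {a}) * sum w V + sum w B * w a) * sum w V ^ card B"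
          unfolding s1 distrib_right s2 by (simp add: algebra_simps)
        also have "sum w (A - {a}) * sum w V + sum w B * w a = sum w A * sum w X"
          unfolding WB WV WA by (simp add: algebra_simps)
        finally show ?thesis using WVp WX by (simp add: field_simps)
      qed
      also have "q ^ (n\<^sup>2 + n) * k ^ card B * (\<Prod>v\<in>B. w v) * ((1 / sum w X) *
          (\<Sum>D\<in>Pow B. w a ^ card D * sum w X ^ card (B - D) * (sum w (A - {a}) + sum w D))) =
          (\<Sum>D\<in>Pow B. q ^ (n\<^sup>2 + n) * k ^ card B * (\<Prod>v\<in>B. w v) / sum w X *
          (w a ^ card D * sum w X ^ card (B - D) * (sum w (A - {a}) + sum w D)))"
        by (simp add: sum_distrib_left)
      also have "\<dots> \<le> (\<Sum>D\<in>Pow B. C D * T D)"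
        by (intro sum_mono CT)
      finally have "ennreal (q ^ (card V)\<^sup>2 * k ^ card (V - A) * (\<Prod>v\<in>V - A. w v) * sum w A *
         sum w V ^ card (V - A) / sum w V) \<le> ennreal (\<Sum>D\<in>Pow B. C D * T D)"
        by (rule ennreal_leI)
      also have "\<dots> = (\<Sum>D\<in>Pow B. ennreal (C D) * ennreal (T D))"
        using Cn Tn by (subst sum_ennreal[symmetric]) (auto simp: ennreal_mult)
      also have "\<dots> \<le> (\<Sum>D\<in>Pow B. ennreal (C D) * R D)"
        by (intro sum_mono mult_left_mono RT) auto
      also have "\<dots> = (\<Sum>D\<in>Pow B. (\<integral>\<^sup>+b. of_bool ({v \<in> X. b (key a v)} = D) \<partial>edge_pmf p (key a ` X)) * R D)"
        unfolding C_def using X B pe by (intro sum.cong refl arg_cong2[of _ _ _ _ "(*)"] nn_integral_star_eq[symmetric]) auto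
      also have "\<dots> = (\<integral>\<^sup>+b. (\<Sum>D\<in>Pow B. of_bool ({v \<in> X. b (key a v)} = D) * R D) \<partial>edge_pmf p (key a ` X))"
        by (simp add: nn_integral_sum nn_integral_multc)
      \<comment> \<open>Only neighbourhoods inside \<open>B\<close> were kept, that is, those in
        which \<open>a\<close> has no edge to another active vertex; dropping the others gives an
        inequality.\<close>
      also have "\<dots> \<le> (\<integral>\<^sup>+b. R {v \<in> X. b (key a v)} \<partial>edge_pmf p (key a ` X))"
      proof (intro nn_integral_mono)
        fix b
        have "(\<Sum>D\<in>Pow B. of_bool ({v \<in> X. b (key a v)} = D) * R D) =
           (\<Sum>D\<in>Pow B. if {v \<in> X. b (key a v)} = D then R D else 0)"
          by (intro sum.cong) auto
        also have "\<dots> \<le> R {v \<in> X. b (key a v)}"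
          using B by (subst sum.delta') auto
        finally show "(\<Sum>D\<in>Pow B. of_bool ({v \<in> X. b (key a v)} = D) * R D) \<le> R {v \<in> X. b (key a v)}" .
      qed
      also have "\<dots> = (\<integral>\<^sup>+b. of_bool (reach b A V = V) \<partial>edge_pmf p (pairs_on V))"
        unfolding int eqX R_def ..
      finally show ?thesis .
    qed
  qed simp
qed

section \<open>Events depending on disjoint sets of edges\<close>

lemma nn_integral_of_bool_pmf:
  "(\<integral>\<^sup>+b. of_bool (P b) \<partial>measure_pmf M) = ennreal (measure_pmf.prob M {b. P b})"
proof -
  have "(\<lambda>b. of_bool (P b) :: ennreal) = indicator {b. P b}" by (auto simp: indicator_def)
  then show ?thesis by (simp add: measure_pmf.emeasure_eq_measure)
qed

lemma prob_Pi_pmf_restrict: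
  assumes "finite I" "A \<subseteq> I" and dep: "\<And>b b'. (\<And>e. e \<in> A \<Longrightarrow> b e = b' e) \<Longrightarrow> P b = P b'"
  shows "measure_pmf.prob (Pi_pmf I d p) {b. P b} = measure_pmf.prob (Pi_pmf A d p) {b. P b}"
proof -
  have "P (\<lambda>x. if x \<in> A then b x else d) = P b" for b by (intro dep) simp
  then show ?thesis by (subst Pi_pmf_subset[OF assms(1,2)]) (simp add: vimage_def)
qed

lemma prob_Pi_pmf_inter:
  assumes I: "finite I" "A \<subseteq> I" "B \<subseteq> I" "A \<inter> B = {}"
    and P: "\<And>b b'. (\<And>e. e \<in> A \<Longrightarrow> b e = b' e) \<Longrightarrow> P b = P b'"
    and Q: "\<And>b b'. (\<And>e. e \<in> B \<Longrightarrow> b e = b' e) \<Longrightarrow> Q b = Q b'"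
  shows "measure_pmf.prob (Pi_pmf I d p) {b. P b \<and> Q b} =
    measure_pmf.prob (Pi_pmf I d p) {b. P b} * measure_pmf.prob (Pi_pmf I d p) {b. Q b}"
proof -
  have fin: "finite A" "finite B"
    using finite_subset[OF I(2,1)] finite_subset[OF I(3,1)] by auto
  have "measure_pmf.prob (Pi_pmf I d p) {b. P b \<and> Q b} =
      measure_pmf.prob (Pi_pmf (A \<union> B) d p) {b. P b \<and> Q b}"
  proof (rule prob_Pi_pmf_restrict)
    show "(P b \<and> Q b) = (P b' \<and> Q b')" if "\<And>e. e \<in> A \<union> B \<Longrightarrow> b e = b' e" for b b'
      using that by (intro arg_cong2[of _ _ _ _ "(\<and>)"] P Q) auto
  qed (use I in auto)
  also have "ennreal \<dots> = (\<integral>\<^sup>+b1. \<integral>\<^sup>+b2. of_bool (P b1) * of_bool (Q b2) \<partial>Pi_pmf B d p \<partial>Pi_pmf A d p)"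
  proof -
    let ?b = "\<lambda>b1 b2 x. if x \<in> A then b1 x else b2 x"
    have "P (?b b1 b2) = P b1" for b1 b2 by (intro P) simp
    moreover have "Q (?b b1 b2) = Q b2" for b1 b2 using I by (intro Q) auto
    ultimately show ?thesis
      unfolding nn_integral_of_bool_pmf[symmetric]
      by (subst nn_integral_Pi_pmf_union[OF fin I(4)]) (simp add: of_bool_conj)
  qed
  also have "\<dots> = ennreal (measure_pmf.prob (Pi_pmf A d p) {b. P b}) * ennreal (measure_pmf.prob (Pi_pmf B d p) {b. Q b})"
    by (simp add: nn_integral_cmult nn_integral_multc nn_integral_of_bool_pmf)
  also have "measure_pmf.prob (Pi_pmf A d p) {b. P b} = measure_pmf.prob (Pi_pmf I d p) {b. P b}"
    by (rule prob_Pi_pmf_restrict[symmetric, OF I(1,2) P])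
  also have "measure_pmf.prob (Pi_pmf B d p) {b. Q b} = measure_pmf.prob (Pi_pmf I d p) {b. Q b}"
    by (rule prob_Pi_pmf_restrict[symmetric, OF I(1,3) Q])
  finally show ?thesis by (simp add: ennreal_mult[symmetric])
qed

lemma prob_no_edges:
  fixes p :: "nat \<times> nat \<Rightarrow> real"
  assumes I: "finite I" "Z \<subseteq> I" and p: "\<And>e. e \<in> Z \<Longrightarrow> 0 \<le> p e \<and> p e \<le> 1"
  shows "measure_pmf.prob (edge_pmf p I) {b. \<forall>e\<in>Z. \<not> b e} = (\<Prod>e\<in>Z. 1 - p e)"
proof -
  have finZ: "finite Z" using I finite_subset by auto
  have "measure_pmf.prob (edge_pmf p I) {b. \<forall>e\<in>Z. \<not> b e} = measure_pmf.prob (edge_pmf p Z) {b. \<forall>e\<in>Z. \<not> b e}"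
    by (intro prob_Pi_pmf_restrict[OF I]) auto
  also have "ennreal \<dots> = (\<integral>\<^sup>+b. (\<Prod>e\<in>Z. of_bool (\<not> b e)) \<partial>edge_pmf p Z)"
  proof -
    have "of_bool (\<forall>e\<in>Z. \<not> b e) = (\<Prod>e\<in>Z. of_bool (\<not> b e) :: ennreal)" for b
      using finZ by (auto simp: of_bool_def)
    then show ?thesis by (simp add: nn_integral_of_bool_pmf[symmetric])
  qed
  also have "\<dots> = (\<Prod>e\<in>Z. \<integral>\<^sup>+x. of_bool (\<not> x) \<partial>bernoulli_pmf (p e))"
    using finZ by (subst nn_integral_prod_Pi_pmf[where f = "\<lambda>e x. of_bool (\<not> x)"]) auto
  also have "\<dots> = (\<Prod>e\<in>Z. ennreal (1 - p e))"
    using p by (intro prod.cong refl) simp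
  also have "\<dots> = ennreal (\<Prod>e\<in>Z. 1 - p e)"
    using p by (intro prod_ennreal) auto
  finally show ?thesis using p by (simp add: prod_nonneg)
qed

section \<open>Isolated vertex sets and their second moment\<close>

definition cut :: "nat set \<Rightarrow> nat set \<Rightarrow> (nat \<times> nat) set" where
  "cut U W = (\<lambda>(i, j). key i j) ` (U \<times> W)"

text \<open>Connectedness is tested from \<open>Min U\<close>, an arbitrary vertex. Isolation is
  required only inside \<open>V\<close>: edges leaving \<open>V\<close> are free, so
  \<open>U\<close> lies in a component of the whole graph that may be larger. This suffices for a
  lower bound and allows vertices to be discarded.\<close>

definition isolated_component :: "(nat \<times> nat \<Rightarrow> bool) \<Rightarrow> nat set \<Rightarrow> nat set \<Rightarrow> bool" where
  "isolated_component b V U \<longleftrightarrow> reach b {Min U} U = U \<and> (\<forall>e\<in>cut U (V - U). \<not> b e)"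

lemma finite_cut: "finite U \<Longrightarrow> finite W \<Longrightarrow> finite (cut U W)"
  by (simp add: cut_def)

lemma cut_subset_pairs_on: "U \<subseteq> V \<Longrightarrow> W \<subseteq> V \<Longrightarrow> U \<inter> W = {} \<Longrightarrow> cut U W \<subseteq> pairs_on V"
  by (auto simp: cut_def intro!: key_in_pairs_on)

lemma cut_disjoint_pairs_on: "U \<inter> W = {} \<Longrightarrow> U' \<inter> W = {} \<or> U' \<inter> U = {} \<Longrightarrow> cut U W \<inter> pairs_on U' = {}"
  by (auto simp: cut_def pairs_on_def key_def min_def max_def split: if_splits)

lemma isolated_component_no_exit:
  assumes U: "isolated_component b V U" and "u \<in> U" "w \<in> V" "adj b u w"
  shows "w \<in> U"
proof (rule ccontr)
  assume "w \<notin> U"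
  then have "key u w \<in> cut U (V - U)" using assms by (auto simp: cut_def)
  then show False using assms by (auto simp: isolated_component_def adj_def)
qed

text \<open>Membership in \<open>U'\<close> propagates along the edges inside \<open>U\<close>,
  since no edge leaves \<open>U'\<close> within \<open>V\<close>. By symmetry two overlapping
  isolated sets are equal, so in a second moment only equal and disjoint pairs contribute.\<close>

lemma isolated_component_subset:
  assumes U: "isolated_component b V U" and U': "isolated_component b V U'"
    and V: "U \<subseteq> V" "U' \<subseteq> V" "finite U" and x: "x \<in> U" "x \<in> U'"
  shows "U \<subseteq> U'"
proof -
  have ne: "U \<noteq> {}" using x by auto
  then have M: "{Min U} \<subseteq> U" using V by auto
  have R: "reach b {Min U} U = U" using U by (simp add: isolated_component_def)
  have "v \<in> U' \<longleftrightarrow> Min U \<in> U'" if "v \<in> U" for v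
  proof -
    have "v \<in> reach b {Min U} U" using that R by simp
    then show ?thesis using M
    proof (induction rule: reach_induct)
      case (step u w)
      then show ?case
        using isolated_component_no_exit[OF U', of u w] isolated_component_no_exit[OF U', of w u] V
        by (auto simp: adj_commute)
    qed simp
  qed
  then show ?thesis using x by blast
qed

lemma prob_isolated_component:
  fixes p :: "nat \<times> nat \<Rightarrow> real"
  assumes V: "finite V" "U \<subseteq> V" "V \<subseteq> V0" "finite V0" "U \<noteq> {}"
    and p: "\<And>e. e \<in> pairs_on V0 \<Longrightarrow> 0 \<le> p e \<and> p e \<le> 1"
  shows "measure_pmf.prob (edge_pmf p (pairs_on V0)) {b. isolated_component b V U} =
    measure_pmf.prob (edge_pmf p (pairs_on U)) {b. reach b {Min U} U = U} * (\<Prod>e\<in>cut U (V - U). 1 - p e)"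
proof -
  have finU: "finite U" using finite_subset[OF V(2,1)] .
  then have M: "{Min U} \<subseteq> U" using V by auto
  have dep: "(reach b {Min U} U = U) = (reach b' {Min U} U = U)"
    if "\<And>e. e \<in> pairs_on U \<Longrightarrow> b e = b' e" for b b'
    using reach_cong[OF M that] by simp
  have c: "cut U (V - U) \<subseteq> pairs_on V0" using V by (intro cut_subset_pairs_on) auto
  have "measure_pmf.prob (edge_pmf p (pairs_on V0)) {b. isolated_component b V U} =
    measure_pmf.prob (edge_pmf p (pairs_on V0)) {b. reach b {Min U} U = U} *
    measure_pmf.prob (edge_pmf p (pairs_on V0)) {b. \<forall>e\<in>cut U (V - U). \<not> b e}"
    unfolding isolated_component_def
  proof (rule prob_Pi_pmf_inter[where A = "pairs_on U" and B = "cut U (V - U)"])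
    show "pairs_on U \<inter> cut U (V - U) = {}"
      using cut_disjoint_pairs_on[of U "V - U" U] by auto
    show "pairs_on U \<subseteq> pairs_on V0" using V by (intro pairs_on_mono) auto
    show "finite (pairs_on V0)" using V by (intro finite_pairs_on)
  qed (use c dep in \<open>blast+\<close>)
  also have "measure_pmf.prob (edge_pmf p (pairs_on V0)) {b. reach b {Min U} U = U} =
      measure_pmf.prob (edge_pmf p (pairs_on U)) {b. reach b {Min U} U = U}"
    using V by (intro prob_Pi_pmf_restrict finite_pairs_on pairs_on_mono dep) auto
  also have "measure_pmf.prob (edge_pmf p (pairs_on V0)) {b. \<forall>e\<in>cut U (V - U). \<not> b e} =
      (\<Prod>e\<in>cut U (V - U). 1 - p e)"
    using V c p by (intro prob_no_edges finite_pairs_on) auto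
  finally show ?thesis .
qed

text \<open>The only dependence between disjoint \<open>U\<close> and \<open>U'\<close> comes from
  the at most k^2 pairs joining them, whose absence is required by both events but has to be paid
  only once.\<close>

lemma prob_two_isolated_components:
  fixes p :: "nat \<times> nat \<Rightarrow> real" and q :: real
  assumes V: "finite V" "U \<subseteq> V" "U' \<subseteq> V" "V \<subseteq> V0" "finite V0" "U \<noteq> {}" "U' \<noteq> {}"
    and disj: "U \<inter> U' = {}" and card: "card U = k" "card U' = k"
    and p: "\<And>e. e \<in> pairs_on V0 \<Longrightarrow> 0 \<le> p e \<and> p e \<le> 1"
    and q: "\<And>e. e \<in> pairs_on V \<Longrightarrow> q \<le> 1 - p e" "0 < q" "q \<le> 1"
  shows "measure_pmf.prob (edge_pmf p (pairs_on V0)) {b. isolated_component b V U \<and> isolated_component b V U'}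
    \<le> measure_pmf.prob (edge_pmf p (pairs_on V0)) {b. isolated_component b V U} *
      measure_pmf.prob (edge_pmf p (pairs_on V0)) {b. isolated_component b V U'} / q ^ k\<^sup>2"
proof -
  let ?P = "\<lambda>R. measure_pmf.prob (edge_pmf p (pairs_on V0)) {b. R b}"
  let ?C = "cut U (V - U)" and ?C' = "cut U' (V - U')"
  have fin: "finite U" "finite U'"
    using finite_subset[OF V(2,1)] finite_subset[OF V(3,1)] by auto
  then have M: "{Min U} \<subseteq> U" "{Min U'} \<subseteq> U'" using V by auto
  have dep: "(reach b {Min U} U = U) = (reach b' {Min U} U = U)"
    if "\<And>e. e \<in> pairs_on U \<Longrightarrow> b e = b' e" for b b'
    using reach_cong[OF M(1) that] by simp
  have dep': "(reach b {Min U'} U' = U') = (reach b' {Min U'} U' = U')"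
    if "\<And>e. e \<in> pairs_on U' \<Longrightarrow> b e = b' e" for b b'
    using reach_cong[OF M(2) that] by simp
  have c: "?C \<subseteq> pairs_on V" "?C' \<subseteq> pairs_on V" 
    using V cut_subset_pairs_on[of U V "V - U"] cut_subset_pairs_on[of U' V "V - U'"] by auto
  have cV: "pairs_on V \<subseteq> pairs_on V0" "pairs_on U \<subseteq> pairs_on V" "pairs_on U' \<subseteq> pairs_on V"
    using V by (auto intro!: pairs_on_mono)
  have finC: "finite ?C" "finite ?C'" using c V finite_pairs_on finite_subset by blast+
  have d1: "pairs_on U \<inter> (pairs_on U' \<union> (?C \<union> ?C')) = {}"
    using cut_disjoint_pairs_on[of U "V - U" U] cut_disjoint_pairs_on[of U' "V - U'" U]
      pairs_on_disjoint[OF disj] disj by auto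
  have d2: "pairs_on U' \<inter> (?C \<union> ?C') = {}"
    using cut_disjoint_pairs_on[of U "V - U" U'] cut_disjoint_pairs_on[of U' "V - U'" U'] disj by auto
  have p01: "0 \<le> p e \<and> p e \<le> 1" if "e \<in> pairs_on V" for e
    by (rule p[OF subsetD[OF cV(1) that]])
  have "?P (\<lambda>b. isolated_component b V U \<and> isolated_component b V U') =
      ?P (\<lambda>b. reach b {Min U} U = U \<and> (reach b {Min U'} U' = U' \<and> (\<forall>e\<in>?C \<union> ?C'. \<not> b e)))"
    by (intro arg_cong[of _ _ "measure_pmf.prob _"]) (auto simp: isolated_component_def)
  also have "\<dots> = ?P (\<lambda>b. reach b {Min U} U = U) *
      ?P (\<lambda>b. reach b {Min U'} U' = U' \<and> (\<forall>e\<in>?C \<union> ?C'. \<not> b e))"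
  proof (rule prob_Pi_pmf_inter[OF _ _ _ d1])
    show "(reach b {Min U'} U' = U' \<and> (\<forall>e\<in>?C \<union> ?C'. \<not> b e)) =
        (reach b' {Min U'} U' = U' \<and> (\<forall>e\<in>?C \<union> ?C'. \<not> b' e))"
      if "\<And>e. e \<in> pairs_on U' \<union> (?C \<union> ?C') \<Longrightarrow> b e = b' e" for b b'
      using that by (intro arg_cong2[of _ _ _ _ "(\<and>)"] dep') auto
    show "finite (pairs_on V0)" using V by (intro finite_pairs_on)
    show "pairs_on U' \<union> (?C \<union> ?C') \<subseteq> pairs_on V0" "pairs_on U \<subseteq> pairs_on V0" using c cV by auto
  qed (rule dep)
  also have "?P (\<lambda>b. reach b {Min U'} U' = U' \<and> (\<forall>e\<in>?C \<union> ?C'. \<not> b e)) =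
      ?P (\<lambda>b. reach b {Min U'} U' = U') * ?P (\<lambda>b. \<forall>e\<in>?C \<union> ?C'. \<not> b e)"
  proof (rule prob_Pi_pmf_inter[OF _ _ _ d2])
    show "finite (pairs_on V0)" using V by (intro finite_pairs_on)
    show "?C \<union> ?C' \<subseteq> pairs_on V0" "pairs_on U' \<subseteq> pairs_on V0" using c cV by auto
  qed (use dep' in \<open>blast+\<close>)
  also have "?P (\<lambda>b. reach b {Min U} U = U) =
      measure_pmf.prob (edge_pmf p (pairs_on U)) {b. reach b {Min U} U = U}" (is "_ = ?R")
    using V cV by (intro prob_Pi_pmf_restrict finite_pairs_on dep) auto
  also have "?P (\<lambda>b. reach b {Min U'} U' = U') =
      measure_pmf.prob (edge_pmf p (pairs_on U')) {b. reach b {Min U'} U' = U'}" (is "_ = ?R'")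
    using V cV by (intro prob_Pi_pmf_restrict finite_pairs_on dep') auto
  also have "?P (\<lambda>b. \<forall>e\<in>?C \<union> ?C'. \<not> b e) = (\<Prod>e\<in>?C \<union> ?C'. 1 - p e)"
    using V c cV p by (intro prob_no_edges finite_pairs_on) auto
  also have "\<dots> \<le> (\<Prod>e\<in>?C. 1 - p e) * (\<Prod>e\<in>?C'. 1 - p e) / q ^ k\<^sup>2"
  proof -
    have sub: "?C \<inter> ?C' \<subseteq> cut U U'"
    proof
      fix e assume e: "e \<in> ?C \<inter> ?C'"
      from e obtain i j where "e = key i j" "i \<in> U" "j \<in> V - U" unfolding cut_def by auto
      moreover from e obtain i' j' where "e = key i' j'" "i' \<in> U'" "j' \<in> V - U'" unfolding cut_def by auto
      ultimately have "j \<in> U'" using disj by (auto simp: key_eq_iff)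
      then have "(i, j) \<in> U \<times> U'" "e = (\<lambda>(i, j). key i j) (i, j)"
        using \<open>i \<in> U\<close> \<open>e = key i j\<close> by auto
      then show "e \<in> cut U U'" unfolding cut_def by (rule rev_image_eqI)
    qed
    have "card (?C \<inter> ?C') \<le> card (cut U U')"
      using fin sub by (intro card_mono finite_cut)
    also have "\<dots> \<le> card (U \<times> U')"
      unfolding cut_def using fin by (intro card_image_le) auto
    also have "\<dots> = k\<^sup>2" using card by (simp add: card_cartesian_product power2_eq_square)
    finally have "q ^ k\<^sup>2 \<le> q ^ card (?C \<inter> ?C')"
      using q by (intro power_decreasing) auto
    also have "\<dots> = (\<Prod>e\<in>?C \<inter> ?C'. q)" by simp
    also have "\<dots> \<le> (\<Prod>e\<in>?C \<inter> ?C'. 1 - p e)"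
      using c q by (intro prod_mono) (auto intro: less_imp_le)
    finally have "(\<Prod>e\<in>?C \<union> ?C'. 1 - p e) * q ^ k\<^sup>2 \<le>
        (\<Prod>e\<in>?C \<union> ?C'. 1 - p e) * (\<Prod>e\<in>?C \<inter> ?C'. 1 - p e)"
      using c p01 by (intro mult_left_mono prod_nonneg) auto
    also have "\<dots> = (\<Prod>e\<in>?C. 1 - p e) * (\<Prod>e\<in>?C'. 1 - p e)"
      by (rule prod.union_inter[OF finC])
    finally show ?thesis using q by (simp add: field_simps)
  qed
  finally have "?P (\<lambda>b. isolated_component b V U \<and> isolated_component b V U') \<le>
      ?R * (?R' * ((\<Prod>e\<in>?C. 1 - p e) * (\<Prod>e\<in>?C'. 1 - p e) / q ^ k\<^sup>2))"
    by (simp add: mult_left_mono)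
  also have "\<dots> = (?R * (\<Prod>e\<in>?C. 1 - p e)) * (?R' * (\<Prod>e\<in>?C'. 1 - p e)) / q ^ k\<^sup>2"
    by (simp add: mult_ac)
  also have "?R * (\<Prod>e\<in>?C. 1 - p e) = ?P (\<lambda>b. isolated_component b V U)"
    using V p by (intro prob_isolated_component[symmetric]) auto
  also have "?R' * (\<Prod>e\<in>?C'. 1 - p e) = ?P (\<lambda>b. isolated_component b V U')"
    using V p by (intro prob_isolated_component[symmetric]) auto
  finally show ?thesis .
qed

text \<open>Chebyshev's inequality. The variance of the number of isolated sets is at most \<Lambda>
  + (\<open>1 / q ^ k\<^sup>2\<close> - 1) \<Lambda>^2, so failure is unlikely as soon as the mean
  is large and \<open>q ^ k\<^sup>2\<close> is close to 1.\<close>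

lemma prob_some_isolated_component_ge:
  fixes p :: "nat \<times> nat \<Rightarrow> real" and q :: real and \<U> :: "nat set set"
  assumes V: "finite V" "V \<subseteq> V0" "finite V0"
    and \<U>: "\<And>U. U \<in> \<U> \<Longrightarrow> U \<subseteq> V \<and> card U = k" "k > 0"
    and p: "\<And>e. e \<in> pairs_on V0 \<Longrightarrow> 0 \<le> p e \<and> p e \<le> 1"
    and q: "\<And>e. e \<in> pairs_on V \<Longrightarrow> q \<le> 1 - p e" "0 < q" "q \<le> 1"
    and mean: "(\<Sum>U\<in>\<U>. measure_pmf.prob (edge_pmf p (pairs_on V0)) {b. isolated_component b V U}) \<ge> l"
      "l > 0"
  shows "measure_pmf.prob (edge_pmf p (pairs_on V0)) {b. \<forall>U\<in>\<U>. \<not> isolated_component b V U}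
    \<le> 1 / l + (1 / q ^ k\<^sup>2 - 1)"
proof -
  define M where "M = edge_pmf p (pairs_on V0)"
  define P where "P U = measure_pmf.prob M {b. isolated_component b V U}" for U
  define N where "N b = (\<Sum>U\<in>\<U>. of_bool (isolated_component b V U) :: real)" for b
  define \<Lambda> where "\<Lambda> = (\<Sum>U\<in>\<U>. P U)"
  have fin\<U>: "finite \<U>"
    using V \<U>(1) by (intro finite_subset[of \<U> "Pow V"]) auto
  have ne: "U \<noteq> {}" "finite U" if "U \<in> \<U>" for U
    using \<U>(1)[OF that] \<U>(2) V finite_subset by auto
  have "finite (set_pmf M)"
    unfolding M_def by (rule finite_subset[OF set_Pi_pmf_subset'[OF finite_pairs_on[OF V(3)]]])
      (auto intro!: finite_PiE_dflt finite_pairs_on V)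
  then have int: "integrable M f" for f :: "_ \<Rightarrow> real" by (rule integrable_measure_pmf_finite)
  have prob: "measure_pmf.prob M {b. R b} = measure_pmf.expectation M (\<lambda>b. of_bool (R b))" for R
  proof -
    have "(\<lambda>b. of_bool (R b) :: real) = indicator {b. R b}" by (auto simp: indicator_def)
    then show ?thesis by simp
  qed
  have \<Lambda>: "\<Lambda> \<ge> l" "\<Lambda> > 0" using mean by (auto simp: \<Lambda>_def P_def M_def)
  have EN: "measure_pmf.expectation M N = \<Lambda>"
    unfolding N_def \<Lambda>_def P_def prob using int by (subst Bochner_Integration.integral_sum) auto
  have q1: "q ^ k\<^sup>2 > 0" using q by simp
  have "measure_pmf.expectation M (\<lambda>b. (N b)\<^sup>2) =
      (\<Sum>U\<in>\<U>. \<Sum>U'\<in>\<U>. measure_pmf.prob M {b. isolated_component b V U \<and> isolated_component b V U'})"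
    unfolding N_def power2_eq_square sum_product prob of_bool_conj
    using int by (subst Bochner_Integration.integral_sum, simp)
      (intro sum.cong refl Bochner_Integration.integral_sum, simp)
  also have "\<dots> \<le> (\<Sum>U\<in>\<U>. \<Sum>U'\<in>\<U>. (if U = U' then P U else 0) + P U * P U' / q ^ k\<^sup>2)"
  proof (intro sum_mono)
    fix U U' assume U: "U \<in> \<U>" and U': "U' \<in> \<U>"
    have nn: "0 \<le> P U * P U' / q ^ k\<^sup>2" using q1 by (simp add: P_def)
    consider "U = U'" | "U \<noteq> U'" "U \<inter> U' \<noteq> {}" | "U \<inter> U' = {}" by blast
    then show "measure_pmf.prob M {b. isolated_component b V U \<and> isolated_component b V U'}
      \<le> (if U = U' then P U else 0) + P U * P U' / q ^ k\<^sup>2"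
    proof cases
      case 1
      then show ?thesis using nn by (simp add: P_def)
    next
      case 2
      have "\<not> (isolated_component b V U \<and> isolated_component b V U')" for b
      proof
        assume *: "isolated_component b V U \<and> isolated_component b V U'"
        obtain x where "x \<in> U" "x \<in> U'" using 2 by auto
        then have "U \<subseteq> U'" "U' \<subseteq> U"
          using * \<U>(1)[OF U] \<U>(1)[OF U'] ne[OF U] ne[OF U'] isolated_component_subset by blast+
        then show False using 2 by auto
      qed
      then have none: "{b. isolated_component b V U \<and> isolated_component b V U'} = {}" by auto
      show ?thesis unfolding none using nn 2 by simp
    next
      case 3
      then have "measure_pmf.prob M {b. isolated_component b V U \<and> isolated_component b V U'}
        \<le> P U * P U' / q ^ k\<^sup>2"
        unfolding M_def P_def using V \<U>(1)[OF U] \<U>(1)[OF U'] ne[OF U] ne[OF U'] p q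
        by (intro prob_two_isolated_components) auto
      then show ?thesis using 3 ne[OF U] by auto
    qed
  qed
  also have "\<dots> = \<Lambda> + \<Lambda>\<^sup>2 / q ^ k\<^sup>2"
    using fin\<U> unfolding sum.distrib
    by (simp add: \<Lambda>_def power2_eq_square sum_product sum_divide_distrib)
  finally have EN2: "measure_pmf.expectation M (\<lambda>b. (N b)\<^sup>2) \<le> \<Lambda> + \<Lambda>\<^sup>2 / q ^ k\<^sup>2" .
  \<comment> \<open>Pointwise comparison: when no set of the family is isolated, (N - \<Lambda>)^2
    equals \<Lambda>^2.\<close>
  have "\<Lambda>\<^sup>2 * measure_pmf.prob M {b. \<forall>U\<in>\<U>. \<not> isolated_component b V U} =
      measure_pmf.expectation M (\<lambda>b. \<Lambda>\<^sup>2 * of_bool (\<forall>U\<in>\<U>. \<not> isolated_component b V U))"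
    unfolding prob by simp
  also have "\<dots> \<le> measure_pmf.expectation M (\<lambda>b. (N b)\<^sup>2 - 2 * \<Lambda> * N b + \<Lambda>\<^sup>2)"
  proof (intro integral_mono int)
    fix b
    show "\<Lambda>\<^sup>2 * of_bool (\<forall>U\<in>\<U>. \<not> isolated_component b V U) \<le> (N b)\<^sup>2 - 2 * \<Lambda> * N b + \<Lambda>\<^sup>2"
    proof (cases "\<forall>U\<in>\<U>. \<not> isolated_component b V U")
      case True
      then have "N b = 0" by (simp add: N_def)
      then show ?thesis using True by simp
    next
      case False
      have "(N b)\<^sup>2 - 2 * \<Lambda> * N b + \<Lambda>\<^sup>2 = (N b - \<Lambda>)\<^sup>2" by (simp add: power2_diff)
      moreover have "of_bool (\<forall>U\<in>\<U>. \<not> isolated_component b V U) = (0::real)"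
        using False by (simp only: of_bool_eq)
      ultimately show ?thesis by (simp only: mult_zero_right zero_le_power2)
    qed
  qed
  also have "\<dots> = measure_pmf.expectation M (\<lambda>b. (N b)\<^sup>2) - 2 * \<Lambda> * measure_pmf.expectation M N + \<Lambda>\<^sup>2"
    using int by (subst Bochner_Integration.integral_add, simp, simp)
      (subst Bochner_Integration.integral_diff, auto)
  also have "\<dots> \<le> \<Lambda> + \<Lambda>\<^sup>2 / q ^ k\<^sup>2 - \<Lambda>\<^sup>2"
    using EN2 unfolding EN by (simp add: power2_eq_square)
  finally have "measure_pmf.prob M {b. \<forall>U\<in>\<U>. \<not> isolated_component b V U} \<le>
      (\<Lambda> + \<Lambda>\<^sup>2 / q ^ k\<^sup>2 - \<Lambda>\<^sup>2) / \<Lambda>\<^sup>2"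
    using \<Lambda> by (simp add: pos_le_divide_eq mult.commute)
  also have "\<dots> = 1 / \<Lambda> + (1 / q ^ k\<^sup>2 - 1)"
    using \<Lambda> q1 by (simp add: field_simps power2_eq_square)
  also have "\<dots> \<le> 1 / l + (1 / q ^ k\<^sup>2 - 1)"
    using \<Lambda> mean by (simp add: frac_le)
  finally show ?thesis by (simp add: M_def)
qed

text \<open>Connectedness comes from the forest bound with the single root \<open>Min U\<close>,
  whose weight completes the product over \<open>U\<close>; the absence of the cut edges costs the
  exponential factor.\<close>

lemma prob_isolated_component_ge:
  fixes p :: "nat \<times> nat \<Rightarrow> real" and w :: "nat \<Rightarrow> real" and k \<delta> :: real
  assumes V: "finite V" "U \<subseteq> V" "V \<subseteq> V0" "finite V0" "U \<noteq> {}"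
    and p: "\<And>e. e \<in> pairs_on V0 \<Longrightarrow> 0 \<le> p e \<and> p e \<le> 1"
    and pkw: "\<And>i j. i \<in> V \<Longrightarrow> j \<in> V \<Longrightarrow> i \<noteq> j \<Longrightarrow> p (key i j) = k * w i * w j"
    and w: "\<And>i. i \<in> V \<Longrightarrow> w i > 0" and k: "k \<ge> 0"
    and \<delta>: "\<And>e. e \<in> pairs_on V \<Longrightarrow> p e \<le> \<delta>" "0 \<le> \<delta>" "\<delta> \<le> 1 / 2"
  shows "(1 - \<delta>) ^ (card U)\<^sup>2 * k ^ (card U - 1) * (\<Prod>v\<in>U. w v) * sum w U ^ (card U - 1) / sum w U
      * exp (- (1 + 2 * \<delta>) * k * sum w U * sum w V)
    \<le> measure_pmf.prob (edge_pmf p (pairs_on V0)) {b. isolated_component b V U}"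
proof -
  have finU: "finite U" using finite_subset[OF V(2,1)] .
  have MU: "Min U \<in> U" using finU V by auto
  have wU: "w i > 0" if "i \<in> U" for i using that V w by auto
  have pUV: "pairs_on U \<subseteq> pairs_on V" "pairs_on V \<subseteq> pairs_on V0"
    using V by (auto intro!: pairs_on_mono)
  have 1: "(1 - \<delta>) ^ (card U)\<^sup>2 * k ^ (card U - 1) * (\<Prod>v\<in>U. w v) * sum w U ^ (card U - 1) / sum w U \<le>
      measure_pmf.prob (edge_pmf p (pairs_on U)) {b. reach b {Min U} U = U}"
  proof -
    have "ennreal ((1 - \<delta>) ^ (card U)\<^sup>2 * k ^ card (U - {Min U}) * (\<Prod>v\<in>U - {Min U}. w v) *
        sum w {Min U} * sum w U ^ card (U - {Min U}) / sum w U)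
     \<le> (\<integral>\<^sup>+b. of_bool (reach b {Min U} U = U) \<partial>edge_pmf p (pairs_on U))"
    proof (rule nn_integral_connected_ge)
      show "1 - \<delta> \<le> 1 - p e" if "e \<in> pairs_on U" for e
        using that pUV \<delta>(1)[of e] by auto
      show "p (key i j) = k * w i * w j" if "i \<in> U" "j \<in> U" "i \<noteq> j" for i j
        using that V by (intro pkw) auto
    qed (use finU V MU wU k \<delta> in auto)
    moreover have cU: "card (U - {Min U}) = card U - 1" using finU MU by simp
    moreover have "(\<Prod>v\<in>U. w v) = w (Min U) * (\<Prod>v\<in>U - {Min U}. w v)"
      using finU MU by (simp add: prod.remove)
    ultimately show ?thesis
      unfolding nn_integral_of_bool_pmf by (simp add: mult_ac ennreal_le_iff)
  qed
  have 2: "exp (- (1 + 2 * \<delta>) * k * sum w U * sum w V) \<le> (\<Prod>e\<in>cut U (V - U). 1 - p e)"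
  proof -
    have inj: "inj_on (\<lambda>(i, j). key i j) (U \<times> (V - U))"
      by (auto simp: inj_on_def key_eq_iff)
    have c: "cut U (V - U) \<subseteq> pairs_on V" using V by (intro cut_subset_pairs_on) auto
    have finC: "finite (cut U (V - U))" using V finU by (intro finite_cut) auto
    have "(\<Sum>e\<in>cut U (V - U). p e) = (\<Sum>(i, j)\<in>U \<times> (V - U). k * w i * w j)"
      unfolding cut_def sum.reindex[OF inj]
      using V by (intro sum.cong refl) (auto intro!: pkw)
    also have "\<dots> = k * sum w U * sum w (V - U)"
      by (simp add: sum.cartesian_product[symmetric] sum_product sum_distrib_left mult_ac)
    \<comment> \<open>Including the pairs inside \<open>U\<close> only weakens the final bound, and
      leaves a dependence on \<open>U\<close> through its total weight alone.\<close>
    also have "\<dots> \<le> k * sum w U * sum w V"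
      using V w k wU by (intro mult_left_mono sum_mono2 mult_nonneg_nonneg sum_nonneg)
        (auto simp: less_imp_le)
    finally have S: "(\<Sum>e\<in>cut U (V - U). p e) \<le> k * sum w U * sum w V" .
    have "exp (- (1 + 2 * \<delta>) * k * sum w U * sum w V) = exp (- ((1 + 2 * \<delta>) * (k * sum w U * sum w V)))"
      by (simp add: algebra_simps)
    also have "\<dots> \<le> exp (- ((1 + 2 * \<delta>) * (\<Sum>e\<in>cut U (V - U). p e)))"
      using S \<delta> by (simp add: mult_left_mono)
    also have "\<dots> = (\<Prod>e\<in>cut U (V - U). exp (- ((1 + 2 * \<delta>) * p e)))"
      using finC by (simp add: exp_sum[symmetric] sum_distrib_left sum_negf)
    also have "\<dots> \<le> (\<Prod>e\<in>cut U (V - U). 1 - p e)"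
    proof (intro prod_mono conjI)
      fix e assume "e \<in> cut U (V - U)"
      then have e: "e \<in> pairs_on V" using c by auto
      then have pe: "0 \<le> p e" "p e \<le> \<delta>" using p[OF subsetD[OF pUV(2) e]] \<delta>(1)[OF e] by auto
      \<comment> \<open>For p <= 1/2 one has ln (1 - p) >= - p - 2 p^2, and p <= \<delta> makes the
        quadratic term a small relative change of the rate.\<close>
      have "- ((1 + 2 * \<delta>) * p e) \<le> - p e - 2 * (p e)\<^sup>2"
        using mult_right_mono[OF pe(2,1)] by (simp add: algebra_simps power2_eq_square)
      also have "\<dots> \<le> ln (1 - p e)"
        using pe \<delta> by (intro ln_one_minus_pos_lower_bound) auto
      finally have "exp (- ((1 + 2 * \<delta>) * p e)) \<le> exp (ln (1 - p e))" by simp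
      then show "exp (- ((1 + 2 * \<delta>) * p e)) \<le> 1 - p e" using pe \<delta> by simp
    qed simp
    finally show ?thesis .
  qed
  have "(1 - \<delta>) ^ (card U)\<^sup>2 * k ^ (card U - 1) * (\<Prod>v\<in>U. w v) * sum w U ^ (card U - 1) / sum w U
      * exp (- (1 + 2 * \<delta>) * k * sum w U * sum w V)
    \<le> measure_pmf.prob (edge_pmf p (pairs_on U)) {b. reach b {Min U} U = U} * (\<Prod>e\<in>cut U (V - U). 1 - p e)"
    by (intro mult_mono 1 2) auto
  also have "\<dots> = measure_pmf.prob (edge_pmf p (pairs_on V0)) {b. isolated_component b V U}"
    using V p by (intro prob_isolated_component[symmetric]) auto
  finally show ?thesis .
qed

section \<open>From edge indicators to the component sizes of the random graph\<close>

definition edge_prob :: "nat \<Rightarrow> (real \<Rightarrow> real \<Rightarrow> real) \<Rightarrow> (nat \<Rightarrow> real) \<Rightarrow> nat \<times> nat \<Rightarrow> real" where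
  "edge_prob n \<kappa> x = (\<lambda>(i, j). min (\<kappa> (x i) (x j) / n) 1)"

definition edge_set :: "nat \<Rightarrow> (nat \<times> nat \<Rightarrow> bool) \<Rightarrow> nat set set" where
  "edge_set n b = {{i, j} | i j. (i, j) \<in> vertex_pairs n \<and> b (i, j)}"

lemma vertex_pairs_eq: "vertex_pairs n = pairs_on {1..n}"
  by (auto simp: vertex_pairs_def pairs_on_def)

lemma graph_given_types_eq:
  "graph_given_types n \<kappa> x = map_pmf (edge_set n) (edge_pmf (edge_prob n \<kappa> x) (pairs_on {1..n}))"
  unfolding graph_given_types_def edge_set_def[abs_def] vertex_pairs_eq edge_prob_def
  by (simp add: case_prod_unfold)

lemma doubleton_in_edge_set:
  "{u, v} \<in> edge_set n b \<longleftrightarrow> u \<in> {1..n} \<and> v \<in> {1..n} \<and> adj b u v"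
proof
  assume "{u, v} \<in> edge_set n b"
  then obtain i j where ij: "{u, v} = {i, j}" "(i, j) \<in> vertex_pairs n" "b (i, j)"
    by (auto simp: edge_set_def)
  then have "key u v = (i, j)" "u \<noteq> v"
    by (auto simp: doubleton_eq_iff vertex_pairs_def key_def)
  then show "u \<in> {1..n} \<and> v \<in> {1..n} \<and> adj b u v"
    using ij by (auto simp: adj_def doubleton_eq_iff vertex_pairs_def)
next
  assume *: "u \<in> {1..n} \<and> v \<in> {1..n} \<and> adj b u v"
  then have "key u v \<in> vertex_pairs n"
    unfolding vertex_pairs_eq by (intro key_in_pairs_on) (auto simp: adj_def)
  moreover have "{u, v} = {fst (key u v), snd (key u v)}"
    by (auto simp: key_def min_def max_def)
  ultimately show "{u, v} \<in> edge_set n b"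
    using * by (force simp: edge_set_def adj_def)
qed

lemma component_edge_set:
  "component n (edge_set n b) u = reach b {u} {1..n}"
  unfolding component_def reach_def doubleton_in_edge_set by simp

lemma C1_edge_set_ge_iff:
  assumes "n \<ge> 1"
  shows "k \<le> C1 n (edge_set n b) \<longleftrightarrow> (\<exists>u\<in>{1..n}. k \<le> card (reach b {u} {1..n}))"
  using assms unfolding C1_def component_edge_set by (subst Max_ge_iff) auto

lemma edge_prob_bounds:
  assumes "\<And>i. i \<in> V \<Longrightarrow> \<psi> (x i) > 0" "c > 0" "e \<in> pairs_on V"
  shows "0 \<le> edge_prob n (rank1_kernel c \<psi>) x e \<and> edge_prob n (rank1_kernel c \<psi>) x e \<le> 1"
proof -
  obtain i j where e: "e = (i, j)" "i \<in> V" "j \<in> V" using assms(3) by (auto simp: pairs_on_def)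
  show ?thesis
    using assms(1)[OF e(2)] assms(1)[OF e(3)] assms(2) by (simp add: e edge_prob_def rank1_kernel_def)
qed

lemma edge_prob_key: "edge_prob n (rank1_kernel c \<psi>) x (key i j) = min (c * \<psi> (x i) * \<psi> (x j) / n) 1"
  by (auto simp: edge_prob_def key_def rank1_kernel_def min_def max_def mult_ac)

text \<open>Markov's inequality for z to the component size, summed over all vertices. The
  hypothesis \<open>super\<close> is the empirical form of z f(s) <= s with t = s - m: subtracting 1
  inside the sum subtracts the mean of \<psi>.\<close>

lemma prob_C1_ge_le:
  fixes \<psi> :: "real \<Rightarrow> real" and x :: "nat \<Rightarrow> real" and c z t :: real
  assumes n: "n \<ge> 1" and w: "\<And>i. i \<in> {1..n} \<Longrightarrow> \<psi> (x i) > 0" and c: "c > 0" and t: "t \<ge> 0" and z: "z \<ge> 1"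
    and super: "(\<Sum>v\<in>{1..n}. \<psi> (x v) * (z * exp (c * \<psi> (x v) * t) - 1)) / n \<le> t"
  shows "measure_pmf.prob (graph_given_types n (rank1_kernel c \<psi>) x) {E. k \<le> C1 n E}
    \<le> (\<Sum>v\<in>{1..n}. z * exp (c * \<psi> (x v) * t)) / z ^ k"
proof -
  define p where "p = edge_prob n (rank1_kernel c \<psi>) x"
  define M where "M = edge_pmf p (pairs_on {1..n})"
  define \<phi> where "\<phi> v = z * exp (c * \<psi> (x v) * t)" for v
  have \<phi>: "\<phi> v \<ge> 1" if "v \<in> {1..n}" for v
  proof -
    have "1 * 1 \<le> z * exp (c * \<psi> (x v) * t)"
      using w[OF that] c t z by (intro mult_mono) auto
    then show ?thesis by (simp add: \<phi>_def)
  qed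
  have 1: "measure_pmf.prob M {b. k \<le> card (reach b {u} {1..n})} \<le> \<phi> u / z ^ k" if u: "u \<in> {1..n}" for u
  proof -
    have "ennreal (z ^ k * measure_pmf.prob M {b. k \<le> card (reach b {u} {1..n})}) =
        (\<integral>\<^sup>+b. ennreal (z ^ k) * of_bool (k \<le> card (reach b {u} {1..n})) \<partial>M)"
      using z by (simp add: nn_integral_cmult nn_integral_of_bool_pmf ennreal_mult)
    also have "\<dots> \<le> (\<integral>\<^sup>+b. ennreal (z ^ card (reach b {u} {1..n})) \<partial>M)"
      using z by (intro nn_integral_mono) (auto simp: of_bool_def intro!: ennreal_leI power_increasing)
    also have "\<dots> \<le> ennreal (\<Prod>v\<in>{u}. \<phi> v)"
      unfolding M_def
    proof (rule nn_integral_reach_le)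
      show "z * exp (\<Sum>v\<in>{1..n} - {a}. p (key a v) * (\<phi> v - 1)) \<le> \<phi> a" if a: "a \<in> {1..n}" for a
      proof -
        have "(\<Sum>v\<in>{1..n} - {a}. p (key a v) * (\<phi> v - 1)) \<le>
            (\<Sum>v\<in>{1..n} - {a}. c * \<psi> (x a) * \<psi> (x v) / n * (\<phi> v - 1))"
          using \<phi> unfolding p_def edge_prob_key by (intro sum_mono mult_right_mono) auto
        also have "\<dots> \<le> (\<Sum>v\<in>{1..n}. c * \<psi> (x a) * \<psi> (x v) / n * (\<phi> v - 1))"
        proof (intro sum_mono2)
          fix v assume "v \<in> {1..n} - ({1..n} - {a})"
          then have v: "v \<in> {1..n}" by auto
          show "0 \<le> c * \<psi> (x a) * \<psi> (x v) / n * (\<phi> v - 1)"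
            using \<phi>[OF v] w[OF v] w[OF a] c by simp
        qed auto
        also have "\<dots> = c * \<psi> (x a) * ((\<Sum>v\<in>{1..n}. \<psi> (x v) * (\<phi> v - 1)) / n)"
          by (simp add: sum_distrib_left sum_divide_distrib mult_ac)
        also have "\<dots> \<le> c * \<psi> (x a) * t"
          using super w[OF a] c by (intro mult_left_mono) (auto simp: \<phi>_def)
        finally show ?thesis
          unfolding \<phi>_def using z by (intro mult_left_mono) auto
      qed
      show "0 \<le> p e \<and> p e \<le> 1" if "e \<in> pairs_on {1..n}" for e
        using that w c unfolding p_def by (intro edge_prob_bounds) auto
    qed (use u z \<phi> in auto)
    finally have "z ^ k * measure_pmf.prob M {b. k \<le> card (reach b {u} {1..n})} \<le> \<phi> u"
      using \<phi>[OF u] by (simp add: ennreal_le_iff)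
    then show ?thesis using z by (simp add: field_simps)
  qed
  have "measure_pmf.prob (graph_given_types n (rank1_kernel c \<psi>) x) {E. k \<le> C1 n E} =
      measure_pmf.prob M (\<Union>u\<in>{1..n}. {b. k \<le> card (reach b {u} {1..n})})"
    unfolding graph_given_types_eq p_def[symmetric] M_def[symmetric]
    by (auto simp: vimage_def C1_edge_set_ge_iff[OF n] intro!: arg_cong[of _ _ "measure_pmf.prob M"])
  also have "\<dots> \<le> (\<Sum>u\<in>{1..n}. measure_pmf.prob M {b. k \<le> card (reach b {u} {1..n})})"
    by (intro measure_pmf.finite_measure_subadditive_finite) auto
  also have "\<dots> \<le> (\<Sum>u\<in>{1..n}. \<phi> u / z ^ k)"
    by (intro sum_mono 1)
  finally show ?thesis by (simp add: \<phi>_def sum_divide_distrib)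
qed

text \<open>It suffices that one set of the family is isolated within \<open>V\<close>, as it is
  then contained in a component of the whole graph. Since \<delta> <= 1/2, the cap at 1 is inactive
  on \<open>V\<close>, where the edge probabilities have exact product form.\<close>

lemma prob_C1_less_le:
  fixes \<psi> :: "real \<Rightarrow> real" and x :: "nat \<Rightarrow> real" and c \<delta> :: real and \<U> :: "nat set set"
  assumes n: "n \<ge> 1" and w: "\<And>i. i \<in> {1..n} \<Longrightarrow> \<psi> (x i) > 0" and c: "c > 0"
    and V: "V \<subseteq> {1..n}"
    and \<U>: "\<And>U. U \<in> \<U> \<Longrightarrow> U \<subseteq> V \<and> card U = k" "k > 0"
    and \<delta>: "\<And>i j. i \<in> V \<Longrightarrow> j \<in> V \<Longrightarrow> c * \<psi> (x i) * \<psi> (x j) / n \<le> \<delta>" "0 \<le> \<delta>" "\<delta> \<le> 1 / 2"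
    and mean: "(\<Sum>U\<in>\<U>. (1 - \<delta>) ^ k\<^sup>2 * (c / n) ^ (k - 1) * (\<Prod>v\<in>U. \<psi> (x v)) *
        (\<Sum>v\<in>U. \<psi> (x v)) ^ (k - 1) / (\<Sum>v\<in>U. \<psi> (x v)) *
        exp (- (1 + 2 * \<delta>) * (c / n) * (\<Sum>v\<in>U. \<psi> (x v)) * (\<Sum>v\<in>V. \<psi> (x v)))) \<ge> l" "l > 0"
  shows "measure_pmf.prob (graph_given_types n (rank1_kernel c \<psi>) x) {E. C1 n E < k}
    \<le> 1 / l + (1 / (1 - \<delta>) ^ k\<^sup>2 - 1)"
proof -
  define p where "p = edge_prob n (rank1_kernel c \<psi>) x"
  have finV: "finite V" using V finite_subset by blast
  have p: "0 \<le> p e \<and> p e \<le> 1" if "e \<in> pairs_on {1..n}" for e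
    using that w c unfolding p_def by (intro edge_prob_bounds) auto
  have pk: "p (key i j) = (c / n) * \<psi> (x i) * \<psi> (x j)" if "i \<in> V" "j \<in> V" for i j
    using \<delta>(1)[OF that] \<delta>(3) unfolding p_def edge_prob_key by (simp add: min_def)
  have p\<delta>: "p e \<le> \<delta>" if eV: "e \<in> pairs_on V" for e
  proof -
    obtain i j where e: "e = (i, j)" "i \<in> V" "j \<in> V" "i < j" using eV by (auto simp: pairs_on_def)
    then have "e = key i j" by (simp add: key_def)
    then show ?thesis using pk[OF e(2,3)] \<delta>(1)[OF e(2,3)] by simp
  qed
  have "measure_pmf.prob (graph_given_types n (rank1_kernel c \<psi>) x) {E. C1 n E < k} \<le>
      measure_pmf.prob (edge_pmf p (pairs_on {1..n})) {b. \<forall>U\<in>\<U>. \<not> isolated_component b V U}"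
    unfolding graph_given_types_eq p_def[symmetric] measure_map_pmf
  proof (intro measure_pmf.finite_measure_mono subsetI CollectI ballI notI)
    fix b U assume b: "b \<in> edge_set n -` {E. C1 n E < k}" and U: "U \<in> \<U>" and i: "isolated_component b V U"
    have finU: "finite U" using \<U>(1)[OF U] finV finite_subset by blast
    moreover have "U \<noteq> {}" using \<U>(1)[OF U] \<U>(2) by auto
    ultimately have M: "Min U \<in> U" by simp
    have UV: "U \<subseteq> {1..n}" using \<U>(1)[OF U] V by auto
    have "U = reach b {Min U} U" using i by (simp add: isolated_component_def)
    also have "\<dots> \<subseteq> reach b {Min U} {1..n}" using UV by (intro reach_mono) auto
    finally have "card U \<le> card (reach b {Min U} {1..n})"
      by (intro card_mono finite_subset[OF reach_subset]) auto
    then have "k \<le> C1 n (edge_set n b)"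
      unfolding C1_edge_set_ge_iff[OF n] using \<U>(1)[OF U] M UV by auto
    then show False using b by simp
  qed simp
  also have "\<dots> \<le> 1 / l + (1 / (1 - \<delta>) ^ k\<^sup>2 - 1)"
  proof (rule prob_some_isolated_component_ge)
    show "l \<le> (\<Sum>U\<in>\<U>. measure_pmf.prob (edge_pmf p (pairs_on {1..n})) {b. isolated_component b V U})"
    proof (rule order_trans[OF mean(1)], intro sum_mono)
      fix U assume U: "U \<in> \<U>"
      have "(1 - \<delta>) ^ (card U)\<^sup>2 * (c / n) ^ (card U - 1) * (\<Prod>v\<in>U. \<psi> (x v)) *
        (\<Sum>v\<in>U. \<psi> (x v)) ^ (card U - 1) / (\<Sum>v\<in>U. \<psi> (x v)) *
        exp (- (1 + 2 * \<delta>) * (c / n) * (\<Sum>v\<in>U. \<psi> (x v)) * (\<Sum>v\<in>V. \<psi> (x v)))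
        \<le> measure_pmf.prob (edge_pmf p (pairs_on {1..n})) {b. isolated_component b V U}"
      proof (rule prob_isolated_component_ge)
        show "U \<noteq> {}" using \<U>(1)[OF U] \<U>(2) by auto
      qed (use finV \<U>(1)[OF U] V p pk w c \<delta>(2,3) p\<delta> in \<open>auto simp: subset_iff\<close>)
      then show "(1 - \<delta>) ^ k\<^sup>2 * (c / n) ^ (k - 1) * (\<Prod>v\<in>U. \<psi> (x v)) *
        (\<Sum>v\<in>U. \<psi> (x v)) ^ (k - 1) / (\<Sum>v\<in>U. \<psi> (x v)) *
        exp (- (1 + 2 * \<delta>) * (c / n) * (\<Sum>v\<in>U. \<psi> (x v)) * (\<Sum>v\<in>V. \<psi> (x v)))
        \<le> measure_pmf.prob (edge_pmf p (pairs_on {1..n})) {b. isolated_component b V U}"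
        using \<U>(1)[OF U] by simp
    qed
    show "1 - \<delta> \<le> 1 - p e" if "e \<in> pairs_on V" for e using p\<delta>[OF that] by simp
  qed (use finV V \<U> p \<delta> mean in auto)
  finally show ?thesis .
qed


section \<open>The radius as a variational problem\<close>

lemma power_over_fact_le_exp:
  fixes x :: real
  assumes "x \<ge> 0"
  shows "x ^ j / fact j \<le> exp x"
proof -
  have "(\<Sum>k\<in>{j}. x ^ k /\<^sub>R fact k) \<le> (\<Sum>k. x ^ k /\<^sub>R fact k)"
    using assms by (intro sum_le_suminf summable_exp_generic) auto
  then show ?thesis by (simp add: exp_def divide_inverse mult.commute)
qed

locale rank1_exponential = rank1_branching +
  assumes exp_moment: "\<exists>a>0. integrable \<mu> (\<lambda>x. exp (a * \<psi> x))"
begin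

text \<open>Half of an exponential moment pays for any power of \<psi>, so one exponent serves all
  powers.\<close>

lemma integrable_power_exp:
  "\<exists>a>0. \<forall>j. integrable \<mu> (\<lambda>x. \<psi> x ^ j * exp (a * \<psi> x))"
proof -
  obtain a where a: "a > 0" "integrable \<mu> (\<lambda>x. exp (a * \<psi> x))" using exp_moment by auto
  have "integrable \<mu> (\<lambda>x. \<psi> x ^ j * exp (a / 2 * \<psi> x))" for j
  proof (rule Bochner_Integration.integrable_bound)
    show "integrable \<mu> (\<lambda>x. (fact j / (a / 2) ^ j) * exp (a * \<psi> x))"
      using a by (intro integrable_mult_right)
    show "AE x in \<mu>. norm (\<psi> x ^ j * exp (a / 2 * \<psi> x)) \<le> norm (fact j / (a / 2) ^ j * exp (a * \<psi> x))"
      unfolding AE_measure_pmf_iff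
    proof
      fix x assume x: "x \<in> set_pmf \<mu>"
      have \<psi>0: "\<psi> x > 0" using \<psi>_pos'[OF x] .
      have "(a / 2 * \<psi> x) ^ j / fact j \<le> exp (a / 2 * \<psi> x)"
        using a \<psi>0 by (intro power_over_fact_le_exp) auto
      then have "\<psi> x ^ j \<le> fact j / (a / 2) ^ j * exp (a / 2 * \<psi> x)"
        using a by (simp add: power_mult_distrib field_simps)
      then have "\<psi> x ^ j * exp (a / 2 * \<psi> x) \<le> fact j / (a / 2) ^ j * exp (a / 2 * \<psi> x) * exp (a / 2 * \<psi> x)"
        by (intro mult_right_mono) auto
      also have "\<dots> = fact j / (a / 2) ^ j * exp (a * \<psi> x)"
        by (simp add: mult.assoc exp_add[symmetric] algebra_simps)
      finally show "norm (\<psi> x ^ j * exp (a / 2 * \<psi> x)) \<le> norm (fact j / (a / 2) ^ j * exp (a * \<psi> x))"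
        using \<psi>0 a by simp
    qed
  qed simp
  then show ?thesis using a by (intro exI[of _ "a / 2"]) auto
qed

lemma integrable_power: "integrable \<mu> (\<lambda>x. \<psi> x ^ j)"
proof -
  obtain a where a: "a > 0" "\<And>j. integrable \<mu> (\<lambda>x. \<psi> x ^ j * exp (a * \<psi> x))"
    using integrable_power_exp by auto
  show ?thesis
  proof (rule Bochner_Integration.integrable_bound[OF a(2)[of j]])
    show "AE x in \<mu>. norm (\<psi> x ^ j) \<le> norm (\<psi> x ^ j * exp (a * \<psi> x))"
      unfolding AE_measure_pmf_iff
    proof
      fix x assume x: "x \<in> set_pmf \<mu>"
      have "\<psi> x ^ j * 1 \<le> \<psi> x ^ j * exp (a * \<psi> x)"
        using \<psi>_pos'[OF x] a by (intro mult_left_mono) auto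
      then show "norm (\<psi> x ^ j) \<le> norm (\<psi> x ^ j * exp (a * \<psi> x))"
        using \<psi>_pos'[OF x] by simp
    qed
  qed simp
qed

definition \<sigma> :: real where "\<sigma> = measure_pmf.expectation \<mu> (\<lambda>x. (\<psi> x)\<^sup>2)"

lemma \<sigma>_pos: "\<sigma> > 0"
proof -
  obtain x where x: "x \<in> set_pmf \<mu>" using set_pmf_not_empty by fast
  have "0 < pmf \<mu> x * (\<psi> x)\<^sup>2" using x \<psi>_pos'[OF x] by (simp add: pmf_positive)
  also have "\<dots> = (\<Sum>x\<in>{x}. pmf \<mu> x * (\<psi> x)\<^sup>2)" by simp
  also have "\<dots> \<le> \<sigma>"
    unfolding \<sigma>_def using integrable_power by (intro sum_pmf_le_integral) auto
  finally show ?thesis .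
qed

lemma c_cr_eq: "c_cr S \<mu> \<psi> = ennreal (1 / \<sigma>)"
proof -
  have "(\<Sum>\<^sub>\<infinity>x\<in>S. ennreal ((\<psi> x)\<^sup>2 * pmf \<mu> x)) = (\<Sum>\<^sub>\<infinity>x\<in>S. ennreal (pmf \<mu> x) * ennreal ((\<psi> x)\<^sup>2))"
    by (intro infsum_cong) (simp add: ennreal_mult mult.commute)
  also have "\<dots> = ennreal \<sigma>"
    unfolding nn_integral_pmf_eq_infsum[OF countable_S supp] \<sigma>_def
    using integrable_power by (intro nn_integral_eq_integral) auto
  finally show ?thesis
    using \<sigma>_pos by (simp add: c_cr_def inverse_ennreal divide_inverse)
qed

text \<open>The tilted function at an intensity \<open>d\<close> other than c. The centre stays m,
  which is a fixed point at every intensity.\<close>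

definition tilted_at :: "real \<Rightarrow> real \<Rightarrow> ennreal" where
  "tilted_at d s = (\<integral>\<^sup>+x. ennreal (\<psi> x * exp (d * \<psi> x * (s - m))) \<partial>\<mu>)"

lemma tilted_eq_tilted_at: "tilted s = tilted_at c s"
  by (simp add: tilted_def tilted_at_def)

text \<open>The tangent at m, from exp u >= 1 + u; it is valid on both sides of m.\<close>

lemma tilted_at_ge: "ennreal (m + d * \<sigma> * (s - m)) \<le> tilted_at d s"
proof (cases "tilted_at d s = top")
  case False
  let ?h = "\<lambda>x. \<psi> x * exp (d * \<psi> x * (s - m))"
  have int: "integrable \<mu> ?h"
  proof (rule integrableI_bounded)
    have "(\<integral>\<^sup>+x. ennreal (norm (?h x)) \<partial>\<mu>) = tilted_at d s"
      unfolding tilted_at_def using \<psi>_pos'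
      by (intro nn_integral_cong_AE) (auto simp: AE_measure_pmf_iff less_imp_le abs_mult)
    then show "(\<integral>\<^sup>+x. ennreal (norm (?h x)) \<partial>\<mu>) < \<infinity>" using False by (simp add: less_top)
  qed simp
  have "m + d * \<sigma> * (s - m) = measure_pmf.expectation \<mu> (\<lambda>x. \<psi> x + d * (s - m) * (\<psi> x)\<^sup>2)"
    unfolding m_def \<sigma>_def using \<psi>_integrable integrable_power[of 2]
    by (subst Bochner_Integration.integral_add) (auto simp: mult_ac)
  also have "\<dots> \<le> measure_pmf.expectation \<mu> ?h"
  proof (intro integral_mono_AE int)
    show "integrable \<mu> (\<lambda>x. \<psi> x + d * (s - m) * (\<psi> x)\<^sup>2)"
      using \<psi>_integrable integrable_power[of 2] by auto
    show "AE x in \<mu>. \<psi> x + d * (s - m) * (\<psi> x)\<^sup>2 \<le> ?h x"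
      unfolding AE_measure_pmf_iff
    proof
      fix x assume x: "x \<in> set_pmf \<mu>"
      have "\<psi> x * (1 + d * \<psi> x * (s - m)) \<le> ?h x"
        using \<psi>_pos'[OF x] by (intro mult_left_mono) auto
      then show "\<psi> x + d * (s - m) * (\<psi> x)\<^sup>2 \<le> ?h x"
        by (simp add: algebra_simps power2_eq_square)
    qed
  qed
  finally have "ennreal (m + d * \<sigma> * (s - m)) \<le> ennreal (measure_pmf.expectation \<mu> ?h)"
    by (rule ennreal_leI)
  also have "\<dots> = tilted_at d s"
    unfolding tilted_at_def using \<psi>_pos' int
    by (intro nn_integral_eq_integral[symmetric]) (auto simp: AE_measure_pmf_iff less_imp_le)
  finally show ?thesis .
qed simp

lemma r_radius_ge_1: "r_radius S \<mu> \<psi> c \<ge> 1"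
  unfolding r_radius_eq
  by (rule Sup_upper) (auto intro!: exI[of _ 1] exI[of _ m] simp: tilted_m)

text \<open>The tangent bound turns z f(s) <= s into z (m + c \<sigma> (s - m)) <= s, and the ratio
  of the two affine functions is at most the larger of 1 and 1 / (c \<sigma>). This gives finiteness
  of the radius and, at or above criticality, the value 1.\<close>

lemma r_radius_upper:
  assumes z: "z \<ge> 1" and s: "s \<ge> m" and le: "ennreal z * tilted s \<le> ennreal s"
  shows "z \<le> max 1 (1 / (c * \<sigma>))"
proof -
  have pos: "m + c * \<sigma> * (s - m) > 0" using m_pos c_pos \<sigma>_pos s by (intro add_pos_nonneg) auto
  have "ennreal (z * (m + c * \<sigma> * (s - m))) \<le> ennreal z * tilted s"
    unfolding tilted_eq_tilted_at using z tilted_at_ge[of c s] pos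
    by (simp add: ennreal_mult mult_left_mono)
  also note le
  finally have le: "z * (m + c * \<sigma> * (s - m)) \<le> s" using s m_pos by (simp add: ennreal_le_iff)
  define K where "K = max 1 (1 / (c * \<sigma>))"
  have K: "K \<ge> 1" "K * (c * \<sigma>) \<ge> 1"
  proof -
    have "c * \<sigma> > 0" using c_pos \<sigma>_pos by simp
    then have "1 = 1 / (c * \<sigma>) * (c * \<sigma>)" using c_pos \<sigma>_pos by simp
    also have "\<dots> \<le> K * (c * \<sigma>)" using \<open>c * \<sigma> > 0\<close> by (intro mult_right_mono) (auto simp: K_def)
    finally show "K * (c * \<sigma>) \<ge> 1" .
  qed (simp add: K_def)
  have "s = m + (s - m)" by simp
  also have "\<dots> \<le> K * m + K * (c * \<sigma>) * (s - m)"
    using K m_pos s mult_right_mono[of 1 K m] mult_right_mono[of 1 "K * (c * \<sigma>)" "s - m"] by (intro add_mono) auto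
  also have "\<dots> = K * (m + c * \<sigma> * (s - m))" by (simp add: algebra_simps)
  finally have "z * (m + c * \<sigma> * (s - m)) \<le> K * (m + c * \<sigma> * (s - m))" using le by simp
  then have "z \<le> K" using pos by simp
  then show ?thesis by (simp add: K_def)
qed

lemma r_radius_le: "r_radius S \<mu> \<psi> c \<le> ereal (max 1 (1 / (c * \<sigma>)))"
  unfolding r_radius_eq
proof (rule Sup_least)
  fix y assume "y \<in> {ereal z |z. 1 \<le> z \<and> (\<exists>s\<ge>m. ennreal z * tilted s \<le> ennreal s)}"
  then obtain z s where "y = ereal z" "1 \<le> z" "s \<ge> m" "ennreal z * tilted s \<le> ennreal s" by auto
  then show "y \<le> ereal (max 1 (1 / (c * \<sigma>)))"
    using r_radius_upper[of z s] by (simp only: ereal_less_eq)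
qed

lemma r_radius_supercritical:
  assumes "c_cr S \<mu> \<psi> \<le> ennreal c"
  shows "r_radius S \<mu> \<psi> c = 1"
proof -
  have "1 / \<sigma> \<le> c" using assms c_pos by (simp add: c_cr_eq)
  then have "max 1 (1 / (c * \<sigma>)) = 1" using \<sigma>_pos c_pos by (simp add: field_simps max_def)
  then show ?thesis using r_radius_le r_radius_ge_1 by (simp add: antisym one_ereal_def)
qed

text \<open>Below criticality the slope of f at m is less than 1, so f(m + t) < m + t for small t >
  0, with the quadratic remainder controlled by the exponential moment. With \<open>b\<close> an
  upper bound for f(m + t), the value (m + t) / b is admissible.\<close>

lemma r_radius_subcritical:
  assumes "ennreal c < c_cr S \<mu> \<psi>"
  shows "r_radius S \<mu> \<psi> c > 1"
proof -
  have "c < 1 / \<sigma>" using assms c_pos by (simp add: c_cr_eq ennreal_less_iff)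
  then have c\<sigma>: "c * \<sigma> < 1" using \<sigma>_pos by (simp add: field_simps)
  obtain a where a: "a > 0" "\<And>j. integrable \<mu> (\<lambda>x. \<psi> x ^ j * exp (a * \<psi> x))"
    using integrable_power_exp by auto
  define K where "K = measure_pmf.expectation \<mu> (\<lambda>x. \<psi> x ^ 3 * exp (a * \<psi> x))"
  have K: "K \<ge> 0" unfolding K_def using \<psi>_pos'
    by (intro integral_nonneg_AE) (auto simp: AE_measure_pmf_iff less_imp_le)
  \<comment> \<open>The first entry keeps the tilt within the available exponential moment; the
    second makes the quadratic remainder smaller than the linear gain.\<close>
  define t where "t = min (a / c) ((1 - c * \<sigma>) / (2 * (c\<^sup>2 * K + 1)))"
  have cK: "c\<^sup>2 * K + 1 > 0" using K by (intro add_nonneg_pos) auto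
  have t: "t > 0" "c * t \<le> a" "t * (c\<^sup>2 * K + 1) < 1 - c * \<sigma>"
  proof -
    show "t > 0" using a c_pos c\<sigma> cK by (simp add: t_def)
    have "c * t \<le> c * (a / c)" using c_pos by (intro mult_left_mono) (auto simp: t_def)
    then show "c * t \<le> a" using c_pos by simp
    have "t * (c\<^sup>2 * K + 1) \<le> (1 - c * \<sigma>) / (2 * (c\<^sup>2 * K + 1)) * (c\<^sup>2 * K + 1)"
      using cK by (intro mult_right_mono) (auto simp: t_def)
    also have "\<dots> = (1 - c * \<sigma>) / 2" using cK by (simp add: field_simps)
    also have "\<dots> < 1 - c * \<sigma>" using c\<sigma> by simp
    finally show "t * (c\<^sup>2 * K + 1) < 1 - c * \<sigma>" .
  qed
  define b where "b = m + c * \<sigma> * t + c\<^sup>2 * t\<^sup>2 * K"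
  have b: "b > 0" "b < m + t"
  proof -
    show "b > 0" unfolding b_def using m_pos c_pos \<sigma>_pos t K by (intro add_pos_nonneg add_pos_pos) auto
    have "c * \<sigma> + t * c\<^sup>2 * K < 1" using t(1,3) by (simp add: algebra_simps)
    then have "t * (c * \<sigma> + t * c\<^sup>2 * K) < t * 1" using t by (intro mult_strict_left_mono) auto
    then show "b < m + t" by (simp add: b_def algebra_simps power2_eq_square)
  qed
  have "tilted (m + t) \<le> ennreal b"
  proof -
    let ?g = "\<lambda>x. \<psi> x + c * t * (\<psi> x)\<^sup>2 + c\<^sup>2 * t\<^sup>2 * (\<psi> x ^ 3 * exp (a * \<psi> x))"
    have int: "integrable \<mu> ?g"
      using \<psi>_integrable integrable_power[of 2] a(2)[of 3] by auto
    have "tilted (m + t) \<le> (\<integral>\<^sup>+x. ennreal (?g x) \<partial>\<mu>)"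
      unfolding tilted_def
    proof (intro nn_integral_mono_AE, unfold AE_measure_pmf_iff, intro ballI ennreal_leI)
      fix x assume x: "x \<in> set_pmf \<mu>"
      define u where "u = c * \<psi> x * t"
      have u: "u \<ge> 0" "u \<le> a * \<psi> x"
        using \<psi>_pos'[OF x] c_pos t mult_right_mono[OF t(2), of "\<psi> x"] by (auto simp: u_def mult_ac)
      have "exp u \<le> 1 + u + u\<^sup>2 * exp (a * \<psi> x)"
      proof -
        \<comment> \<open>Applied twice, exp u <= 1 + u exp u yields the second-order bound with
          remainder u^2 exp u.\<close>
        have "exp u - 1 \<le> u * exp u"
          using exp_ge_add_one_self[of "-u"] by (simp add: exp_minus field_simps)
        then have "exp u \<le> 1 + u * exp u" by simp
        then have "u * exp u \<le> u * (1 + u * exp u)" using u by (intro mult_left_mono)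
        then have "exp u \<le> 1 + u + u\<^sup>2 * exp u"
          using \<open>exp u \<le> 1 + u * exp u\<close> by (simp add: algebra_simps power2_eq_square)
        also have "\<dots> \<le> 1 + u + u\<^sup>2 * exp (a * \<psi> x)" using u by (intro add_left_mono mult_left_mono) auto
        finally show ?thesis .
      qed
      then have "\<psi> x * exp u \<le> \<psi> x * (1 + u + u\<^sup>2 * exp (a * \<psi> x))"
        using \<psi>_pos'[OF x] by (intro mult_left_mono) auto
      then show "\<psi> x * exp (c * \<psi> x * (m + t - m)) \<le> ?g x"
        by (simp add: u_def algebra_simps power2_eq_square power3_eq_cube)
    qed
    also have "\<dots> = ennreal (measure_pmf.expectation \<mu> ?g)"
    proof (rule nn_integral_eq_integral[OF int], unfold AE_measure_pmf_iff, rule ballI)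
      fix x assume x: "x \<in> set_pmf \<mu>"
      show "0 \<le> ?g x"
        by (intro add_nonneg_nonneg mult_nonneg_nonneg zero_le_power less_imp_le[OF \<psi>_pos'[OF x]])
          (use c_pos t in auto)
    qed
    also have "measure_pmf.expectation \<mu> ?g = b"
      using \<psi>_integrable integrable_power[of 2] a(2)[of 3]
      by (simp add: b_def m_def \<sigma>_def K_def algebra_simps)
    finally show ?thesis .
  qed
  then have "ennreal ((m + t) / b) * tilted (m + t) \<le> ennreal ((m + t) / b) * ennreal b"
    by (intro mult_left_mono) auto
  also have "\<dots> = ennreal (m + t)"
    using b m_pos t by (simp add: ennreal_mult[symmetric])
  finally have "ereal ((m + t) / b) \<le> r_radius S \<mu> \<psi> c"
    unfolding r_radius_eq using b t by (intro Sup_upper) (auto intro!: exI[of _ "m + t"])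
  moreover have "1 < ereal ((m + t) / b)" using b by simp
  ultimately show ?thesis by (rule less_le_trans[rotated])
qed

section \<open>Passage to finitely many types\<close>

definition restricted_tilted :: "real set \<Rightarrow> real \<Rightarrow> real \<Rightarrow> real" where
  "restricted_tilted F d s = (\<Sum>x\<in>F. pmf \<mu> x * \<psi> x * exp (d * \<psi> x * (s - m)))"

text \<open>At intensity \<open>d = 1 / \<sigma>\<close> the tangent of \<open>tilted_at d\<close> at \<open>m\<close> is the identity; this is why in the
  supercritical case the lower bound is obtained by thinning the vertices down to criticality.\<close>

lemma tilted_at_gt:
  assumes z: "r_radius S \<mu> \<psi> c < ereal z" and d: "d = min c (1 / \<sigma>)" and s: "s > 0"
  shows "ennreal s < ennreal z * tilted_at d s"
proof -
  have z1: "z > 1" using z r_radius_ge_1 by (metis ereal_less(3) le_less_trans one_ereal_def ereal_less_eq(3) less_ereal.simps(1))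
  have *: "ennreal s < ennreal z * tilted_at d s" if "s \<le> m + d * \<sigma> * (s - m)"
  proof -
    have "s < z * s" using z1 s by simp
    then have "ennreal s < ennreal (z * s)" using s by (simp add: ennreal_less_iff)
    also have "\<dots> \<le> ennreal z * ennreal (m + d * \<sigma> * (s - m))"
      using z1 s that by (simp add: ennreal_mult mult_left_mono ennreal_leI)
    also have "\<dots> \<le> ennreal z * tilted_at d s"
      by (intro mult_left_mono tilted_at_ge) auto
    finally show ?thesis .
  qed
  have d\<sigma>: "d * \<sigma> \<le> 1" "d * \<sigma> = 1 \<or> d = c" using \<sigma>_pos by (auto simp: d min_def field_simps)
  show ?thesis
  \<comment> \<open>To the left of m, or at criticality, the tangent is already at or above s.
    Otherwise the intensity is c, and the inequality says that z is not admissible for the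
    radius.\<close>
  proof (cases "s \<le> m \<or> d * \<sigma> = 1")
    case True
    have "s \<le> m + d * \<sigma> * (s - m)"
    proof (cases "s \<le> m")
      case le: True
      have "(1 - d * \<sigma>) * (s - m) \<le> 0" using le d\<sigma> by (intro mult_nonneg_nonpos) auto
      then show ?thesis by (simp add: algebra_simps)
    qed (use True in auto)
    then show ?thesis by (rule *)
  next
    case False
    then have "d = c" "s \<ge> m" using d\<sigma> by auto
    have "\<not> ennreal z * tilted s \<le> ennreal s"
    proof
      assume "ennreal z * tilted s \<le> ennreal s"
      then have "ereal z \<le> r_radius S \<mu> \<psi> c"
        unfolding r_radius_eq using z1 \<open>s \<ge> m\<close> by (intro Sup_upper) auto
      then show False using z by simp
    qed
    then show ?thesis using \<open>d = c\<close> by (simp add: tilted_eq_tilted_at)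
  qed
qed

lemma tilted_at_eq_SUP:
  assumes F: "incseq F" "\<And>l. finite (F l)" "(\<Union>l. F l) = set_pmf \<mu>"
  shows "tilted_at d s = (SUP l. ennreal (restricted_tilted (F l) d s))"
proof -
  let ?h = "\<lambda>x. \<psi> x * exp (d * \<psi> x * (s - m))"
  have "tilted_at d s = (\<integral>\<^sup>+x. (SUP l. ennreal (?h x) * indicator (F l) x) \<partial>\<mu>)"
    unfolding tilted_at_def
  proof (intro nn_integral_cong_AE, unfold AE_measure_pmf_iff, intro ballI)
    fix x assume "x \<in> set_pmf \<mu>"
    then obtain l where "x \<in> F l" unfolding F(3)[symmetric] by auto
    then show "ennreal (?h x) = (SUP l. ennreal (?h x) * indicator (F l) x)"
      by (intro antisym SUP_least SUP_upper2[of l]) (auto split: split_indicator)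
  qed
  also have "\<dots> = (SUP l. \<integral>\<^sup>+x. ennreal (?h x) * indicator (F l) x \<partial>\<mu>)"
    using F(1) by (intro nn_integral_monotone_convergence_SUP)
      (auto simp: incseq_def le_fun_def split: split_indicator)
  moreover have "(\<integral>\<^sup>+x. ennreal (?h x) * indicator (F l) x \<partial>\<mu>) = ennreal (restricted_tilted (F l) d s)" for l
  proof -
    have FS: "F l \<subseteq> set_pmf \<mu>" using F(3) by auto
    have "(\<integral>\<^sup>+x. ennreal (?h x) * indicator (F l) x \<partial>\<mu>) = (\<Sum>x\<in>F l. ennreal (pmf \<mu> x) * ennreal (?h x))"
      unfolding nn_integral_measure_pmf
      by (subst nn_integral_count_space'[of "F l"]) (use F in \<open>auto split: split_indicator\<close>)
    also have "\<dots> = (\<Sum>x\<in>F l. ennreal (pmf \<mu> x * \<psi> x * exp (d * \<psi> x * (s - m))))"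
      by (intro sum.cong refl) (simp add: ennreal_mult'[symmetric] mult.assoc)
    also have "\<dots> = ennreal (restricted_tilted (F l) d s)"
      unfolding restricted_tilted_def using FS \<psi>_pos' by (intro sum_ennreal) (auto simp: less_imp_le subset_iff)
    finally show ?thesis .
  qed
  ultimately show ?thesis by simp
qed

lemma restricted_tilted_mono:
  assumes "F \<subseteq> F'" "finite F'" "F' \<subseteq> set_pmf \<mu>"
  shows "restricted_tilted F d s \<le> restricted_tilted F' d s"
  unfolding restricted_tilted_def using assms \<psi>_pos'
  by (intro sum_mono2) (auto simp: less_imp_le subset_iff)

text \<open>Compactness by contradiction. If an exhausting sequence of finite type sets failed at
  intensities increasing to \<open>d0\<close>, the offending points s would stay bounded, because
  one fixed type already grows exponentially, and a limit point would contradict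
  \<open>tilted_at_gt\<close>. The strict bound \<open>d < c\<close> leaves room for
  thinning.\<close>

lemma exists_truncation:
  assumes z: "r_radius S \<mu> \<psi> c < ereal z"
  shows "\<exists>F d. finite F \<and> F \<noteq> {} \<and> F \<subseteq> set_pmf \<mu> \<and> 0 < d \<and> d < c \<and> (\<forall>s>0. s < z * restricted_tilted F d s)"
proof (rule ccontr)
  assume contra: "\<not> ?thesis"
  have z1: "z > 1" using z r_radius_ge_1 by (metis ereal_less(3) le_less_trans one_ereal_def ereal_less_eq(3) less_ereal.simps(1))
  obtain F where F: "incseq F" "\<And>l. finite (F l)" "(\<Union>l. F l) = set_pmf \<mu>"
    by (rule countable_exhaustion[OF countable_set_pmf[of \<mu>]]) (rule that)
  have FS: "F l \<subseteq> set_pmf \<mu>" for l using F(3) by auto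
  define d0 where "d0 = min c (1 / \<sigma>)"
  have d0: "d0 > 0" "d0 \<le> c" using c_pos \<sigma>_pos by (auto simp: d0_def)
  \<comment> \<open>Strictly below c even when \<open>d0\<close> equals c, convergent to
    \<open>d0\<close>, and at least half of it, so that the growth rate used to bound s is uniform
    in \<open>l\<close>.\<close>
  define d where "d l = d0 * (1 - 1 / (real l + 2))" for l
  have d: "0 < d l" "d l < c" "d0 / 2 \<le> d l" for l
  proof -
    have "1 - 1 / (real l + 2) > 0" "1 - 1 / (real l + 2) < 1" "1 / 2 \<le> 1 - 1 / (real l + 2)"
      by (auto simp: field_simps)
    then have "d0 * (1 - 1 / (real l + 2)) < d0 * 1" "d0 * (1 / 2) \<le> d0 * (1 - 1 / (real l + 2))"
      using d0 by (metis mult_strict_left_mono, metis mult_left_mono less_imp_le)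
    then show "0 < d l" "d l < c" "d0 / 2 \<le> d l" using d0 unfolding d_def by linarith+
  qed
  obtain x0 where x0: "x0 \<in> set_pmf \<mu>" using set_pmf_not_empty by fast
  obtain l0 where l0: "x0 \<in> F l0" using x0 unfolding F(3)[symmetric] by auto
  have l0': "x0 \<in> F l" if "l \<ge> l0" for l using l0 F(1) that by (auto simp: incseq_def)
  have "\<exists>s>0. z * restricted_tilted (F (l + l0)) (d l) s \<le> s" for l
  proof -
    have "F (l + l0) \<noteq> {}" using l0'[of "l + l0"] by auto
    then show ?thesis using contra F(2) FS d[of l] by (meson not_less)
  qed
  then obtain s where s: "\<And>l. s l > 0" "\<And>l. z * restricted_tilted (F (l + l0)) (d l) (s l) \<le> s l" by metis
  define A where "A = z * (pmf \<mu> x0 * \<psi> x0)"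
  define B where "B = d0 / 2 * \<psi> x0"
  have A: "A > 0" using z1 \<psi>_pos'[OF x0] x0 by (simp add: A_def pmf_positive)
  have B: "B > 0" using d0 \<psi>_pos'[OF x0] by (simp add: B_def)
  have x0le: "z * (pmf \<mu> x0 * \<psi> x0 * exp (d l * \<psi> x0 * (s l - m))) \<le> s l" for l
  proof -
    have "restricted_tilted {x0} (d l) (s l) \<le> restricted_tilted (F (l + l0)) (d l) (s l)"
      using l0'[of "l + l0"] F FS by (intro restricted_tilted_mono) auto
    then have "z * restricted_tilted {x0} (d l) (s l) \<le> s l"
      using s(2)[of l] z1 by (meson mult_left_mono order_trans less_imp_le zero_less_one order_less_trans)
    then show ?thesis by (simp add: restricted_tilted_def)
  qed
  \<comment> \<open>With u = s - m > 0, the inequality A exp (B u) <= m + u, weakened by exp v >=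
    v^2 / 2, bounds u by the expression in parentheses; the final 1 covers u <= 1.\<close>
  define K where "K = m + (2 * (m + 1) / (A * B\<^sup>2) + 1)"
  have bdd: "s l \<le> K" for l
  proof (cases "s l \<le> m")
    case True
    have "0 \<le> 2 * (m + 1) / (A * B\<^sup>2) + 1" using A B m_pos by simp
    then show ?thesis using True unfolding K_def by linarith
  next
    case False
    define u where "u = s l - m"
    have u: "u > 0" using False by (simp add: u_def)
    have "A * exp (B * u) \<le> m + u"
    proof -
      have "B * u \<le> d l * \<psi> x0 * u"
        using d(3)[of l] u \<psi>_pos'[OF x0] by (simp add: B_def mult_right_mono)
      then have "A * exp (B * u) \<le> A * exp (d l * \<psi> x0 * u)" using A by simp
      also have "\<dots> \<le> s l" using x0le[of l] by (simp add: A_def u_def mult_ac)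
      finally show ?thesis by (simp add: u_def)
    qed
    moreover have "(B * u)\<^sup>2 / 2 \<le> exp (B * u)"
      using power_over_fact_le_exp[of "B * u" 2] B u by (simp add: numeral_2_eq_2)
    ultimately have "A * ((B * u)\<^sup>2 / 2) \<le> m + u"
      using A by (meson mult_left_mono order_trans less_imp_le)
    then have q: "A * B\<^sup>2 * u\<^sup>2 \<le> 2 * (m + u)" by (simp add: power_mult_distrib algebra_simps)
    have "u \<le> 2 * (m + 1) / (A * B\<^sup>2) + 1"
    proof (cases "u \<le> 1")
      case True
      moreover have "0 \<le> 2 * (m + 1) / (A * B\<^sup>2)" using A B m_pos by simp
      ultimately show ?thesis by linarith
    next
      case False
      have "m * 1 \<le> m * u" using False m_pos by (intro mult_left_mono) auto
      then have "A * B\<^sup>2 * u\<^sup>2 \<le> 2 * (m * u + u)"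
        by (intro order_trans[OF q] mult_left_mono add_right_mono) auto
      then have "(A * B\<^sup>2 * u) * u \<le> (2 * (m + 1)) * u" by (simp add: algebra_simps power2_eq_square)
      then have "A * B\<^sup>2 * u \<le> 2 * (m + 1)" using u by simp
      then have "u \<le> 2 * (m + 1) / (A * B\<^sup>2)" using A B by (simp add: field_simps)
      then show ?thesis by simp
    qed
    then show ?thesis by (simp add: K_def u_def)
  qed
  have "\<forall>l. s l \<in> {0..K}" using s(1) bdd by (auto simp: less_imp_le)
  then obtain s' r where r: "strict_mono r" and lim: "(s \<circ> r) \<longlonglongrightarrow> s'"
    using compact_Icc[of 0 K] unfolding compact_def by blast
  have "d \<longlonglongrightarrow> d0 * (1 - 0)"
    unfolding d_def by (intro tendsto_intros) real_asymp
  then have dlim: "(\<lambda>l. d (r l)) \<longlonglongrightarrow> d0"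
    using LIMSEQ_subseq_LIMSEQ[OF _ r] by (simp add: o_def)
  have slim: "(\<lambda>l. s (r l)) \<longlonglongrightarrow> s'" using lim by (simp add: o_def)
  \<comment> \<open>The set of types is held fixed while d and s converge, which is a limit in a
    finite sum; only afterwards do the types exhaust the support.\<close>
  have le: "z * restricted_tilted (F (j + l0)) d0 s' \<le> s'" for j
  proof (rule LIMSEQ_le)
    show "(\<lambda>l. z * restricted_tilted (F (j + l0)) (d (r l)) (s (r l))) \<longlonglongrightarrow>
        z * restricted_tilted (F (j + l0)) d0 s'"
      unfolding restricted_tilted_def by (intro tendsto_intros dlim slim)
    show "\<exists>N. \<forall>l\<ge>N. z * restricted_tilted (F (j + l0)) (d (r l)) (s (r l)) \<le> s (r l)"
    proof (intro exI[of _ j] allI impI)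
      fix l assume "l \<ge> j"
      then have "j \<le> r l" using seq_suble[OF r, of l] by linarith
      then have "F (j + l0) \<subseteq> F (r l + l0)" using F(1) by (auto simp: incseq_def)
      then have "z * restricted_tilted (F (j + l0)) (d (r l)) (s (r l)) \<le>
          z * restricted_tilted (F (r l + l0)) (d (r l)) (s (r l))"
        using z1 F FS by (intro mult_left_mono restricted_tilted_mono) auto
      also have "\<dots> \<le> s (r l)" by (rule s(2))
      finally show "z * restricted_tilted (F (j + l0)) (d (r l)) (s (r l)) \<le> s (r l)" .
    qed
  qed (rule slim)
  \<comment> \<open>\<open>tilted_at_gt\<close> asks for a positive point; the contribution of the
    single type \<open>x0\<close> keeps the limit away from 0.\<close>
  have "0 < restricted_tilted {x0} d0 s'"
    using x0 \<psi>_pos'[OF x0] by (simp add: restricted_tilted_def pmf_positive)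
  also have "\<dots> \<le> restricted_tilted (F (0 + l0)) d0 s'"
    using l0 F FS by (intro restricted_tilted_mono) auto
  finally have "0 < z * restricted_tilted (F (0 + l0)) d0 s'" using z1 by simp
  with le[of 0] have s': "s' > 0" by linarith
  have "tilted_at d0 s' \<le> ennreal (s' / z)"
    unfolding tilted_at_eq_SUP[OF F]
  proof (intro SUP_least ennreal_leI)
    fix j
    have "F j \<subseteq> F (j + l0)" using F(1) by (auto simp: incseq_def)
    then have "restricted_tilted (F j) d0 s' \<le> restricted_tilted (F (j + l0)) d0 s'"
      using F FS by (intro restricted_tilted_mono) auto
    also have "\<dots> \<le> s' / z" using le[of j] z1 by (simp add: field_simps)
    finally show "restricted_tilted (F j) d0 s' \<le> s' / z" .
  qed
  then have "ennreal z * tilted_at d0 s' \<le> ennreal z * ennreal (s' / z)"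
    by (intro mult_left_mono) auto
  also have "\<dots> = ennreal s'" using z1 s' by (simp add: ennreal_mult[symmetric])
  finally show False
    using tilted_at_gt[OF z d0_def s'] by simp
qed

end


section \<open>The upper tail\<close>

context rank1_exponential
begin

text \<open>The concentration event for one sequence of types, so that both tail estimates can be
  stated for deterministic types.\<close>

definition good_types :: "real \<Rightarrow> real \<Rightarrow> nat \<Rightarrow> (nat \<Rightarrow> real) \<Rightarrow> bool" where
  "good_types \<epsilon> q n x \<longleftrightarrow>
     (\<forall>k\<in>S. \<bar>count_in x n {k} / n - pmf \<mu> k\<bar> \<le> \<epsilon> * exp (q * \<psi> k) * pmf \<mu> k)"

text \<open>The fluctuation factor of the type counts moves into the integrand, so a sum over the
  vertices is bounded by a single integral against \<mu>.\<close>

lemma sum_over_types_le: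
  assumes n: "n \<ge> 1" and x: "\<And>i. i \<in> {1..n} \<Longrightarrow> x i \<in> S" and good: "good_types \<epsilon> q n x"
    and g: "\<And>k. k \<in> S \<Longrightarrow> g k \<ge> 0" and \<epsilon>: "\<epsilon> \<ge> 0"
    and int: "integrable \<mu> (\<lambda>k. (1 + \<epsilon> * exp (q * \<psi> k)) * g k)"
  shows "(\<Sum>i\<in>{1..n}. g (x i)) \<le> real n * measure_pmf.expectation \<mu> (\<lambda>k. (1 + \<epsilon> * exp (q * \<psi> k)) * g k)"
proof -
  let ?T = "x ` {1..n}"
  have T: "?T \<subseteq> S" using x by auto
  have "(\<Sum>i\<in>{1..n}. g (x i)) = (\<Sum>k\<in>?T. \<Sum>i\<in>{i \<in> {1..n}. x i = k}. g (x i))"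
    by (rule sum.image_gen) simp
  also have "\<dots> = (\<Sum>k\<in>?T. real (count_in x n {k}) * g k)"
    by (intro sum.cong refl) (simp add: count_in_def)
  also have "\<dots> \<le> (\<Sum>k\<in>?T. real n * (pmf \<mu> k * ((1 + \<epsilon> * exp (q * \<psi> k)) * g k)))"
  proof (intro sum_mono)
    fix k assume k: "k \<in> ?T"
    then have "count_in x n {k} / n \<le> pmf \<mu> k * (1 + \<epsilon> * exp (q * \<psi> k))"
      using good T unfolding good_types_def by (fastforce simp: algebra_simps abs_le_iff)
    then have "real (count_in x n {k}) \<le> real n * (pmf \<mu> k * (1 + \<epsilon> * exp (q * \<psi> k)))"
      using n by (simp add: field_simps)
    then have "real (count_in x n {k}) * g k \<le> real n * (pmf \<mu> k * (1 + \<epsilon> * exp (q * \<psi> k))) * g k"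
      using g k T by (intro mult_right_mono) auto
    then show "real (count_in x n {k}) * g k \<le> real n * (pmf \<mu> k * ((1 + \<epsilon> * exp (q * \<psi> k)) * g k))"
      by (simp add: mult.assoc)
  qed
  also have "\<dots> = real n * (\<Sum>k\<in>?T. pmf \<mu> k * ((1 + \<epsilon> * exp (q * \<psi> k)) * g k))"
    by (simp add: sum_distrib_left)
  also have "\<dots> \<le> real n * measure_pmf.expectation \<mu> (\<lambda>k. (1 + \<epsilon> * exp (q * \<psi> k)) * g k)"
    using int g supp \<epsilon> by (intro mult_left_mono sum_pmf_le_integral) (auto intro!: mult_nonneg_nonneg)
  finally show ?thesis .
qed

text \<open>There is an admissible pair (z1, s1) with z1 above exp (1 / \<alpha>). Moving to z < z1
  and s < s1 leaves two gaps: the factor \<open>exp (q * \<psi> k)\<close> turns the tilt at s into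
  the tilt at s1, which is still integrable, and \<epsilon> is small enough to fit into the gap z
  f(s) < s.\<close>

lemma C1_upper_tail:
  assumes \<alpha>: "\<alpha> > 0" and r: "ereal (exp (1 / \<alpha>)) < r_radius S \<mu> \<psi> c"
  shows "\<exists>\<epsilon>>0. \<exists>q>0. \<exists>K \<beta>. \<beta> > 0 \<and> (\<forall>n\<ge>1. \<forall>x. (\<forall>i\<in>{1..n}. x i \<in> S) \<longrightarrow> good_types \<epsilon> q n x \<longrightarrow>
    measure_pmf.prob (graph_given_types n (rank1_kernel c \<psi>) x) {E. \<alpha> * ln (real n) < C1 n E} \<le> K * real n powr -\<beta>)"
proof -
  from r obtain z1 s1 where z1: "exp (1 / \<alpha>) < z1" "z1 \<ge> 1" and s1: "s1 \<ge> m"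
    and le1: "ennreal z1 * tilted s1 \<le> ennreal s1"
    unfolding r_radius_eq less_Sup_iff by auto
  define z where "z = (exp (1 / \<alpha>) + z1) / 2"
  have e1: "exp (1 / \<alpha>) > 1" using \<alpha> by simp
  have z: "exp (1 / \<alpha>) < z" "z < z1" "z > 1" 
  proof -
    show "exp (1 / \<alpha>) < z" "z < z1" using z1 by (auto simp: z_def)
    then show "z > 1" using e1 by linarith
  qed
  have fin: "tilted s1 < \<infinity>"
  proof (rule ccontr)
    assume "\<not> tilted s1 < \<infinity>"
    then have "tilted s1 = top" unfolding infinity_ennreal_def by (meson less_top)
    then have "ennreal z1 * tilted s1 = top" using z z1 by (simp add: ennreal_mult_top)
    with le1 show False by (simp add: top_unique)
  qed
  note T1 = tilted_finite_imp[OF fin]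
  define T where "T s = measure_pmf.expectation \<mu> (\<lambda>x. \<psi> x * exp (c * \<psi> x * (s - m)))" for s
  have zT1: "z1 * T s1 \<le> s1"
    using le1 z1 s1 m_pos unfolding T1(2) T_def by (simp add: ennreal_mult'[symmetric])
  have mono: "tilted s \<le> tilted s1" if "s \<le> s1" for s
    unfolding tilted_def using that \<psi>_pos' c_pos
    by (intro nn_integral_mono_AE) (auto simp: AE_measure_pmf_iff less_imp_le intro!: ennreal_leI mult_left_mono)
  have intT: "integrable \<mu> (\<lambda>x. \<psi> x * exp (c * \<psi> x * (s - m)))" if "s \<le> s1" for s
    using mono[OF that] fin by (intro tilted_finite_imp) auto
  have Tmono: "T s \<le> T s'" if "s \<le> s'" "s' \<le> s1" for s s'
    unfolding T_def using that \<psi>_pos' c_pos intT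
    by (intro integral_mono_AE) (auto simp: AE_measure_pmf_iff less_imp_le intro!: mult_left_mono)
  have Tm: "T m = m" by (simp add: T_def m_def)
  have s1m: "s1 > m"
  proof (rule ccontr)
    assume "\<not> s1 > m"
    then have "z1 * m \<le> 1 * m" using s1 zT1 Tm by simp
    then show False using m_pos z1 e1 by (simp del: mult_1)
  qed
  have zz: "z / z1 * s1 < s1"
  proof -
    have "z / z1 < 1" using z z1 by simp
    then have "z / z1 * s1 < 1 * s1" using s1m m_pos by (intro mult_strict_right_mono) auto
    then show ?thesis by simp
  qed
  \<comment> \<open>A point above (z / z1) s1 is wanted because f(s) <= f(s1) <= s1 / z1 then gives
    z f(s) < s.\<close>
  obtain s where s: "m < s" "s < s1" "z / z1 * s1 < s"
    using dense[of "max m (z / z1 * s1)" s1] zz s1m by (auto simp only: max_less_iff_conj)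
  have Tpos: "T s1 > 0" using Tmono[of m s1] Tm m_pos s1m by simp
  have zTs: "z * T s < s"
  proof -
    have "z * T s \<le> z * T s1" using z s Tmono[of s s1] by simp
    also have "\<dots> = z / z1 * (z1 * T s1)" using z1 by (simp add: less_imp_neq[OF less_le_trans[OF zero_less_one], symmetric])
    also have "\<dots> \<le> z / z1 * s1" using z z1 zT1 by (intro mult_left_mono) auto
    also have "\<dots> < s" using s by simp
    finally show ?thesis .
  qed
  \<comment> \<open>Exactly the value for which z f(s) + \<epsilon> z f(s1) = s.\<close>
  define \<epsilon> where "\<epsilon> = (s - z * T s) / (z * T s1)"
  define q where "q = c * (s1 - s)"
  define t where "t = s - m"
  have \<epsilon>: "\<epsilon> > 0" using zTs z Tpos by (simp add: \<epsilon>_def)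
  have q: "q > 0" using c_pos s by (simp add: q_def)
  have t: "t \<ge> 0" using s by (simp add: t_def)
  have expq: "exp (q * \<psi> k) * exp (c * \<psi> k * t) = exp (c * \<psi> k * (s1 - m))" for k
    by (simp add: exp_add[symmetric] q_def t_def algebra_simps)
  define H where "H = measure_pmf.expectation \<mu> (\<lambda>k. (1 + \<epsilon> * exp (q * \<psi> k)) * (z * exp (c * \<psi> k * t)))"
  \<comment> \<open>Where \<psi> is below 1 the weighted exponential does not dominate the
    unweighted one; there the constant \<open>exp (c * (u - m))\<close> does.\<close>
  have intexp: "integrable \<mu> (\<lambda>k. exp (c * \<psi> k * (u - m)))" if u: "m \<le> u" "u \<le> s1" for u
  proof (rule Bochner_Integration.integrable_bound)
    show "integrable \<mu> (\<lambda>k. exp (c * (u - m)) + \<psi> k * exp (c * \<psi> k * (u - m)))"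
      using intT[OF u(2)] by (intro Bochner_Integration.integrable_add) auto
    show "AE k in \<mu>. norm (exp (c * \<psi> k * (u - m))) \<le> norm (exp (c * (u - m)) + \<psi> k * exp (c * \<psi> k * (u - m)))"
      unfolding AE_measure_pmf_iff
    proof
      fix k assume k: "k \<in> set_pmf \<mu>"
      have p: "\<psi> k > 0" using \<psi>_pos'[OF k] .
      have "exp (c * \<psi> k * (u - m)) \<le> exp (c * (u - m)) + \<psi> k * exp (c * \<psi> k * (u - m))"
      proof (cases "\<psi> k \<le> 1")
        case True
        have "\<psi> k * (c * (u - m)) \<le> 1 * (c * (u - m))" using True c_pos u by (intro mult_right_mono) auto
        then have "exp (c * \<psi> k * (u - m)) \<le> exp (c * (u - m))" by (simp add: mult_ac)
        moreover have "0 \<le> \<psi> k * exp (c * \<psi> k * (u - m))" using p by simp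
        ultimately show ?thesis by linarith
      next
        case False
        have "1 * exp (c * \<psi> k * (u - m)) \<le> \<psi> k * exp (c * \<psi> k * (u - m))"
          using False by (intro mult_right_mono) auto
        moreover have "0 < exp (c * (u - m))" by simp
        ultimately show ?thesis by linarith
      qed
      then show "norm (exp (c * \<psi> k * (u - m))) \<le> norm (exp (c * (u - m)) + \<psi> k * exp (c * \<psi> k * (u - m)))"
        using p by simp
    qed
  qed simp
  have key: "measure_pmf.prob (graph_given_types n (rank1_kernel c \<psi>) x) {E. \<alpha> * ln (real n) < C1 n E}
      \<le> H * real n powr -(\<alpha> * ln z - 1)"
    if n: "n \<ge> 1" and x: "\<forall>i\<in>{1..n}. x i \<in> S" and good: "good_types \<epsilon> q n x" for n x
  proof -
    define k where "k = nat \<lceil>\<alpha> * ln (real n)\<rceil>"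
    have k: "\<alpha> * ln (real n) \<le> k" unfolding k_def by linarith
    have ln0: "\<alpha> * ln (real n) \<ge> 0" using \<alpha> n by simp
    have sub: "{E. \<alpha> * ln (real n) < C1 n E} \<subseteq> {E. k \<le> C1 n E}"
      unfolding k_def by (auto simp: nat_le_iff ceiling_le_iff less_imp_le)
    have "measure_pmf.prob (graph_given_types n (rank1_kernel c \<psi>) x) {E. \<alpha> * ln (real n) < C1 n E} \<le>
        measure_pmf.prob (graph_given_types n (rank1_kernel c \<psi>) x) {E. k \<le> C1 n E}"
      by (intro measure_pmf.finite_measure_mono sub) simp
    also have "\<dots> \<le> (\<Sum>v\<in>{1..n}. z * exp (c * \<psi> (x v) * t)) / z ^ k"
    proof (rule prob_C1_ge_le)
      have eq: "(1 + \<epsilon> * exp (q * \<psi> k)) * (\<psi> k * (z * exp (c * \<psi> k * t) - 1)) =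
         (z * (\<psi> k * exp (c * \<psi> k * (s - m))) - \<psi> k) + (\<epsilon> * z * (\<psi> k * exp (c * \<psi> k * (s1 - m))) -
           \<epsilon> * (\<psi> k * exp (q * \<psi> k)))" for k
        unfolding expq[symmetric] by (simp add: t_def algebra_simps)
      \<comment> \<open>The factor \<open>exp (q * \<psi> k)\<close> is itself the tilt at the point
        m + s1 - s, which is below s1.\<close>
      have qm: "q * \<psi> k = c * \<psi> k * ((m + s1 - s) - m)" for k by (simp add: q_def)
      have intq: "integrable \<mu> (\<lambda>k. \<psi> k * exp (q * \<psi> k))"
        unfolding qm using s by (intro intT) auto
      have int: "integrable \<mu> (\<lambda>k. (1 + \<epsilon> * exp (q * \<psi> k)) * (\<psi> k * (z * exp (c * \<psi> k * t) - 1)))"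
        unfolding eq using intT[of s] intT[of s1] s intq \<psi>_integrable
        by (intro Bochner_Integration.integrable_add Bochner_Integration.integrable_diff integrable_mult_right) auto
      have "(\<Sum>v\<in>{1..n}. \<psi> (x v) * (z * exp (c * \<psi> (x v) * t) - 1)) \<le>
         real n * measure_pmf.expectation \<mu> (\<lambda>k. (1 + \<epsilon> * exp (q * \<psi> k)) * (\<psi> k * (z * exp (c * \<psi> k * t) - 1)))"
      proof (rule sum_over_types_le)
        fix k assume k: "k \<in> S"
        have "1 * 1 \<le> z * exp (c * \<psi> k * t)"
          using z c_pos t \<psi>_pos[OF k] by (intro mult_mono) auto
        then show "0 \<le> \<psi> k * (z * exp (c * \<psi> k * t) - 1)" using \<psi>_pos[OF k] by simp
      qed (use n x good \<epsilon> int in auto)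
      also have "measure_pmf.expectation \<mu> (\<lambda>k. (1 + \<epsilon> * exp (q * \<psi> k)) * (\<psi> k * (z * exp (c * \<psi> k * t) - 1)))
        \<le> t"
      proof -
        have "measure_pmf.expectation \<mu> (\<lambda>k. (1 + \<epsilon> * exp (q * \<psi> k)) * (\<psi> k * (z * exp (c * \<psi> k * t) - 1)))
            \<le> measure_pmf.expectation \<mu> (\<lambda>k. (z * (\<psi> k * exp (c * \<psi> k * (s - m))) - \<psi> k) +
              \<epsilon> * z * (\<psi> k * exp (c * \<psi> k * (s1 - m))))"
        proof (intro integral_mono_AE int)
          show "integrable \<mu> (\<lambda>k. (z * (\<psi> k * exp (c * \<psi> k * (s - m))) - \<psi> k) +
              \<epsilon> * z * (\<psi> k * exp (c * \<psi> k * (s1 - m))))"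
            using intT[of s] intT[of s1] s \<psi>_integrable
            by (intro Bochner_Integration.integrable_add Bochner_Integration.integrable_diff integrable_mult_right) auto
          show "AE k in \<mu>. (1 + \<epsilon> * exp (q * \<psi> k)) * (\<psi> k * (z * exp (c * \<psi> k * t) - 1)) \<le>
            (z * (\<psi> k * exp (c * \<psi> k * (s - m))) - \<psi> k) + \<epsilon> * z * (\<psi> k * exp (c * \<psi> k * (s1 - m)))"
            unfolding eq AE_measure_pmf_iff using \<epsilon> \<psi>_pos' by (auto simp: less_imp_le)
        qed
        also have "\<dots> = z * T s - m + \<epsilon> * z * T s1"
          using intT[of s] intT[of s1] s \<psi>_integrable by (simp add: T_def m_def)
        also have "\<epsilon> * z * T s1 = s - z * T s" using z Tpos by (simp add: \<epsilon>_def)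
        finally show ?thesis by (simp add: t_def)
      qed
      finally show "(\<Sum>v\<in>{1..n}. \<psi> (x v) * (z * exp (c * \<psi> (x v) * t) - 1)) / n \<le> t"
        using n by (simp add: field_simps)
    qed (use n x z t c_pos \<psi>_pos in auto)
    also have "\<dots> \<le> (real n * H) / real n powr (\<alpha> * ln z)"
    proof (intro frac_le)
      show "(\<Sum>v\<in>{1..n}. z * exp (c * \<psi> (x v) * t)) \<le> real n * H"
        unfolding H_def
      proof (rule sum_over_types_le)
        have eq: "(1 + \<epsilon> * exp (q * \<psi> k)) * (z * exp (c * \<psi> k * t)) =
           z * exp (c * \<psi> k * (s - m)) + \<epsilon> * z * exp (c * \<psi> k * (s1 - m))" for k
          unfolding expq[symmetric] by (simp add: t_def algebra_simps)
        show "integrable \<mu> (\<lambda>k. (1 + \<epsilon> * exp (q * \<psi> k)) * (z * exp (c * \<psi> k * t)))"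
          unfolding eq using intexp[of s] intexp[of s1] s
          by (intro Bochner_Integration.integrable_add integrable_mult_right) auto
      qed (use n x good \<epsilon> z in auto)
      have "real n powr (\<alpha> * ln z) = z powr (\<alpha> * ln (real n))"
        using n z by (simp add: powr_def mult_ac)
      also have "\<dots> \<le> z powr real k" using k z by (intro powr_mono) auto
      also have "\<dots> = z ^ k" using z by (simp add: powr_realpow)
      finally show "real n powr (\<alpha> * ln z) \<le> z ^ k" .
      show "0 \<le> real n * H" unfolding H_def using \<epsilon> z
        by (intro mult_nonneg_nonneg Bochner_Integration.integral_nonneg) auto
    qed (use n in simp)
    also have "\<dots> = H * real n powr -(\<alpha> * ln z - 1)"
      using n by (simp add: powr_minus powr_diff field_simps)
    finally show ?thesis .
  qed
  \<comment> \<open>The union bound costs a factor n; z > exp (1 / \<alpha>) makes the remaining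
    exponent \<beta> = \<alpha> ln z - 1 positive.\<close>
  have "1 / \<alpha> < ln z" using z by (metis exp_gt_zero less_trans ln_exp ln_less_cancel_iff)
  then have "\<alpha> * ln z - 1 > 0" using \<alpha> by (simp add: field_simps)
  then show ?thesis
    using \<epsilon> q key by blast
qed

end


section \<open>The lower tail\<close>

text \<open>Intersecting the union with \<open>A y\<close> recovers the \<open>y\<close>-th part, so
  vertex sets with a prescribed number of vertices of each type are counted by a product of binomial
  coefficients.\<close>

lemma card_blockwise_subsets:
  assumes "finite F" "\<And>y. y \<in> F \<Longrightarrow> finite (A y)" "disjoint_family_on A F"
  shows "card ((\<lambda>f. \<Union>y\<in>F. f y) ` PiE F (\<lambda>y. {U. U \<subseteq> A y \<and> card U = k y})) =
    (\<Prod>y\<in>F. card (A y) choose k y)"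
proof -
  let ?P = "PiE F (\<lambda>y. {U. U \<subseteq> A y \<and> card U = k y})"
  have rec: "f y = (\<Union>y\<in>F. f y) \<inter> A y" if "f \<in> ?P" "y \<in> F" for f y
  proof
    show "f y \<subseteq> (\<Union>y\<in>F. f y) \<inter> A y" using that by (auto simp: PiE_iff)
    show "(\<Union>y\<in>F. f y) \<inter> A y \<subseteq> f y"
    proof
      fix v assume "v \<in> (\<Union>y\<in>F. f y) \<inter> A y"
      then obtain y' where y': "y' \<in> F" "v \<in> f y'" "v \<in> A y" by auto
      then have "v \<in> A y'" using that by (auto simp: PiE_iff)
      then have "y' = y" using assms(3) y' that by (auto simp: disjoint_family_on_def)
      then show "v \<in> f y" using y' by simp
    qed
  qed
  have "inj_on (\<lambda>f. \<Union>y\<in>F. f y) ?P"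
  proof (rule inj_onI)
    fix f g assume f: "f \<in> ?P" and g: "g \<in> ?P" and eq: "(\<Union>y\<in>F. f y) = (\<Union>y\<in>F. g y)"
    show "f = g"
    proof (rule PiE_ext[OF f g])
      fix y assume "y \<in> F"
      then show "f y = g y" using rec[OF f] rec[OF g] eq by metis
    qed
  qed
  then have "card ((\<lambda>f. \<Union>y\<in>F. f y) ` ?P) = card ?P" by (rule card_image)
  also have "\<dots> = (\<Prod>y\<in>F. card {U. U \<subseteq> A y \<and> card U = k y})"
    using assms by (intro card_PiE)
  also have "\<dots> = (\<Prod>y\<in>F. card (A y) choose k y)"
    using assms by (intro prod.cong refl n_subsets) auto
  finally show ?thesis .
qed

text \<open>Exactly \<open>N y\<close> of the vertices of type \<open>y\<close> are retained; this
  is the thinning. All sets of the family then have the same weights, so the first moment is bounded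
  below by their number times one explicit term.\<close>

lemma prob_C1_less_types_le:
  fixes \<psi> :: "real \<Rightarrow> real" and x :: "nat \<Rightarrow> real" and c \<delta> l :: real
    and F :: "real set" and N k :: "real \<Rightarrow> nat"
  assumes n: "n \<ge> 1" and w: "\<And>i. i \<in> {1..n} \<Longrightarrow> \<psi> (x i) > 0" and c: "c > 0"
    and F: "finite F" "\<And>y. y \<in> F \<Longrightarrow> N y \<le> count_in x n {y}"
    and K: "K = (\<Sum>y\<in>F. k y)" "K > 0"
    and \<Psi>: "\<Psi> = (\<Sum>y\<in>F. k y * \<psi> y)" and \<Phi>: "\<Phi> = (\<Sum>y\<in>F. N y * \<psi> y)"
    and \<delta>: "\<And>y y'. y \<in> F \<Longrightarrow> y' \<in> F \<Longrightarrow> c * \<psi> y * \<psi> y' / n \<le> \<delta>" "0 \<le> \<delta>" "\<delta> \<le> 1 / 2"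
    and mean: "l \<le> (\<Prod>y\<in>F. real (N y choose k y)) * ((1 - \<delta>) ^ K\<^sup>2 * (c / n) ^ (K - 1) *
        (\<Prod>y\<in>F. \<psi> y ^ k y) * \<Psi> ^ (K - 1) / \<Psi> * exp (- (1 + 2 * \<delta>) * (c / n) * \<Psi> * \<Phi>))" "l > 0"
  shows "measure_pmf.prob (graph_given_types n (rank1_kernel c \<psi>) x) {E. C1 n E < K}
    \<le> 1 / l + (1 / (1 - \<delta>) ^ K\<^sup>2 - 1)"
proof -
  have "\<exists>B. B \<subseteq> {i \<in> {1..n}. x i \<in> {y}} \<and> card B = N y" if "y \<in> F" for y
    using obtain_subset_with_card_n[OF F(2)[OF that, unfolded count_in_def]] by metis
  then obtain A where A: "\<And>y. y \<in> F \<Longrightarrow> A y \<subseteq> {i \<in> {1..n}. x i \<in> {y}}" "\<And>y. y \<in> F \<Longrightarrow> card (A y) = N y"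
    by metis
  have Ax: "x i = y" "i \<in> {1..n}" if "i \<in> A y" "y \<in> F" for i y using A(1) that by auto
  have finA: "finite (A y)" if "y \<in> F" for y using A(1)[OF that] finite_subset by fastforce
  have disj: "disjoint_family_on A F" by (auto simp: disjoint_family_on_def dest: Ax)
  define V where "V = (\<Union>y\<in>F. A y)"
  define P where "P = PiE F (\<lambda>y. {U. U \<subseteq> A y \<and> card U = k y})"
  define \<U> where "\<U> = (\<lambda>f. \<Union>y\<in>F. f y) ` P"
  have card\<U>: "card \<U> = (\<Prod>y\<in>F. N y choose k y)"
    unfolding \<U>_def P_def using card_blockwise_subsets[OF F(1) finA disj] A(2) by simp
  have sumU: "(\<Sum>v\<in>(\<Union>y\<in>F. f y). g v) = (\<Sum>y\<in>F. sum g (f y))"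
    if "\<And>y. y \<in> F \<Longrightarrow> f y \<subseteq> A y" for f and g :: "nat \<Rightarrow> 'a :: comm_monoid_add"
    using that disj F(1) finA finite_subset[OF that]
    by (intro sum.UNION_disjoint) (auto simp: disjoint_family_on_def, blast)
  have prodU: "(\<Prod>v\<in>(\<Union>y\<in>F. f y). g v) = (\<Prod>y\<in>F. prod g (f y))"
    if "\<And>y. y \<in> F \<Longrightarrow> f y \<subseteq> A y" for f and g :: "nat \<Rightarrow> real"
    using that disj F(1) finA finite_subset[OF that]
    by (intro prod.UNION_disjoint) (auto simp: disjoint_family_on_def, blast)
  have PA: "f y \<subseteq> A y" "card (f y) = k y" if "f \<in> P" "y \<in> F" for f y
    using that by (auto simp: P_def PiE_iff)
  have sA: "(\<Sum>v\<in>B. \<psi> (x v)) = card B * \<psi> y" if "B \<subseteq> A y" "y \<in> F" for B y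
  proof -
    have "(\<Sum>v\<in>B. \<psi> (x v)) = (\<Sum>v\<in>B. \<psi> y)" using that Ax by (intro sum.cong) auto
    then show ?thesis by simp
  qed
  have pA: "(\<Prod>v\<in>B. \<psi> (x v)) = \<psi> y ^ card B" if "B \<subseteq> A y" "y \<in> F" for B y
  proof -
    have "(\<Prod>v\<in>B. \<psi> (x v)) = (\<Prod>v\<in>B. \<psi> y)" using that Ax by (intro prod.cong) auto
    then show ?thesis by simp
  qed
  have U1: "card U = K" "(\<Sum>v\<in>U. \<psi> (x v)) = \<Psi>" "(\<Prod>v\<in>U. \<psi> (x v)) = (\<Prod>y\<in>F. \<psi> y ^ k y)" "U \<subseteq> V"
    if U: "U \<in> \<U>" for U
  proof -
    obtain f where f: "f \<in> P" "U = (\<Union>y\<in>F. f y)" using U by (auto simp: \<U>_def)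
    have "(\<Sum>v\<in>U. 1::nat) = (\<Sum>y\<in>F. k y)"
      unfolding f(2) using PA[OF f(1)] by (subst sumU) (auto intro!: sum.cong)
    then show "card U = K" by (simp add: K)
    show "(\<Sum>v\<in>U. \<psi> (x v)) = \<Psi>"
    proof -
      have "(\<Sum>v\<in>f y. \<psi> (x v)) = k y * \<psi> y" if "y \<in> F" for y
        using sA[OF PA(1)[OF f(1) that] that] PA(2)[OF f(1) that] by simp
      then show ?thesis unfolding f(2) \<Psi> using PA[OF f(1)] by (subst sumU) auto
    qed
    show "(\<Prod>v\<in>U. \<psi> (x v)) = (\<Prod>y\<in>F. \<psi> y ^ k y)"
    proof -
      have "(\<Prod>v\<in>f y. \<psi> (x v)) = \<psi> y ^ k y" if "y \<in> F" for y
        using pA[OF PA(1)[OF f(1) that] that] PA(2)[OF f(1) that] by simp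
      then show ?thesis unfolding f(2) using PA[OF f(1)] by (subst prodU) auto
    qed
    show "U \<subseteq> V" unfolding f(2) V_def using PA[OF f(1)] by blast
  qed
  have V1: "(\<Sum>v\<in>V. \<psi> (x v)) = \<Phi>"
  proof -
    have "(\<Sum>v\<in>A y. \<psi> (x v)) = N y * \<psi> y" if "y \<in> F" for y
      using sA[OF order_refl that] A(2)[OF that] by simp
    then show ?thesis unfolding V_def \<Phi> by (subst sumU) auto
  qed
  show ?thesis
  proof (rule prob_C1_less_le)
    show "V \<subseteq> {1..n}" unfolding V_def using Ax(2) by blast
    show "c * \<psi> (x i) * \<psi> (x j) / n \<le> \<delta>" if "i \<in> V" "j \<in> V" for i j
      using that Ax \<delta>(1) unfolding V_def by blast
    show "U \<subseteq> V \<and> card U = K" if "U \<in> \<U>" for U using U1[OF that] by simp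
    have "l \<le> real (card \<U>) * ((1 - \<delta>) ^ K\<^sup>2 * (c / n) ^ (K - 1) *
        (\<Prod>y\<in>F. \<psi> y ^ k y) * \<Psi> ^ (K - 1) / \<Psi> * exp (- (1 + 2 * \<delta>) * (c / n) * \<Psi> * \<Phi>))"
      using mean(1) unfolding card\<U> by simp
    also have "\<dots> = (\<Sum>U\<in>\<U>. (1 - \<delta>) ^ K\<^sup>2 * (c / n) ^ (K - 1) * (\<Prod>v\<in>U. \<psi> (x v)) *
        (\<Sum>v\<in>U. \<psi> (x v)) ^ (K - 1) / (\<Sum>v\<in>U. \<psi> (x v)) *
        exp (- (1 + 2 * \<delta>) * (c / n) * (\<Sum>v\<in>U. \<psi> (x v)) * (\<Sum>v\<in>V. \<psi> (x v))))"
      by (simp add: U1 V1)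
    finally show "l \<le> \<dots>" .
  qed (use n w c K \<delta> mean in auto)
qed

section \<open>Stirling-type estimates and the exponent of the first moment\<close>

lemma fact_le_exp_bound:
  assumes "k \<ge> 1"
  shows "fact k \<le> exp (real k * ln (real k) - real k + 1 + ln (real k))"
  using assms
proof (induction k rule: dec_induct)
  case (step k)
  have k: "real k \<ge> 1" using step by simp
  have "1 \<le> (real k + 1) * (ln (real k + 1) - ln (real k))"
  proof -
    have "ln (real k / (real k + 1)) \<le> real k / (real k + 1) - 1"
      using k by (intro ln_le_minus_one) simp
    also have "\<dots> = - 1 / (real k + 1)" using k by (simp add: field_simps)
    finally have "1 / (real k + 1) \<le> ln (real k + 1) - ln (real k)" using k by (simp add: ln_div)
    then have "(real k + 1) * (1 / (real k + 1)) \<le> (real k + 1) * (ln (real k + 1) - ln (real k))"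
      by (intro mult_left_mono) auto
    then show ?thesis using k by simp
  qed
  then have le: "real k * ln (real k) - real k + 1 + ln (real k) + ln (real k + 1) \<le>
      (real k + 1) * ln (real k + 1) - (real k + 1) + 1 + ln (real k + 1)"
    by (simp add: algebra_simps)
  have "fact (Suc k) = (real k + 1) * fact k" by simp
  also have "\<dots> \<le> exp (ln (real k + 1)) * exp (real k * ln (real k) - real k + 1 + ln (real k))"
    using step.IH k by (intro mult_mono) auto
  also have "\<dots> = exp (real k * ln (real k) - real k + 1 + ln (real k) + ln (real k + 1))"
    by (simp add: exp_add)
  also have "\<dots> \<le> exp ((real k + 1) * ln (real k + 1) - (real k + 1) + 1 + ln (real k + 1))"
    using le by simp
  finally show ?case by (simp add: add.commute)
qed simp

text \<open>The coefficient is at least (N - k)^k / k!, and k! is at most e k (k / e)^k. The real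
  numbers \<open>a\<close> above \<open>k\<close> and \<open>r\<close> below \<open>N - k\<close>
  replace the rounded quantities, so that the exponent is linear in \<open>k\<close> up to a
  constant and ln b.\<close>

lemma binomial_ge_exp:
  assumes k: "k \<ge> 1" "2 * k \<le> N" and a: "a > 0" "real k \<le> a" "a \<le> b" and N: "real N - real k \<ge> r" "r > 0"
  shows "exp (real k * (ln r - ln a + 1) - 1 - ln b) \<le> real (N choose k)"
proof -
  have "real (N - k) ^ k = (\<Prod>i<k. real (N - k))" by simp
  also have "\<dots> \<le> (\<Prod>i<k. real (N - i))" by (intro prod_mono) auto
  also have "\<dots> = (\<Prod>i<k. real (N - i) / real (k - i)) * (\<Prod>i<k. real (k - i))"
    by (simp add: prod.distrib[symmetric])
  also have "(\<Prod>i<k. real (N - i) / real (k - i)) = real (N choose k)"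
    using k by (subst binomial_altdef_of_nat) (auto simp: atLeast0LessThan)
  also have "(\<Prod>i<k. real (k - i)) = fact k"
    by (simp add: fact_prod_rev atLeast0LessThan)
  finally have "real (N - k) ^ k \<le> real (N choose k) * fact k" .
  also have "\<dots> \<le> real (N choose k) * exp (real k * ln (real k) - real k + 1 + ln (real k))"
    using fact_le_exp_bound[OF k(1)] by (intro mult_left_mono) auto
  finally have "real (N - k) ^ k * exp (- (real k * ln (real k) - real k + 1 + ln (real k))) \<le>
      real (N choose k) * exp (real k * ln (real k) - real k + 1 + ln (real k)) *
        exp (- (real k * ln (real k) - real k + 1 + ln (real k)))"
    by (rule mult_right_mono) simp
  then have 1: "real (N - k) ^ k * exp (- (real k * ln (real k) - real k + 1 + ln (real k))) \<le> real (N choose k)"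
    by (simp only: mult.assoc exp_add[symmetric]) simp
  have "real k * ln r \<le> real k * ln (real (N - k))" using N k by (intro mult_left_mono) (auto simp: of_nat_diff)
  moreover have "real k * ln (real k) \<le> real k * ln a" using k a by (intro mult_left_mono) auto
  moreover have "ln (real k) \<le> ln b" using k a by simp
  ultimately have "real k * (ln r - ln a + 1) - 1 - ln b \<le>
      real k * ln (real (N - k)) - (real k * ln (real k) - real k + 1 + ln (real k))"
    by (simp add: algebra_simps)
  then have "exp (real k * (ln r - ln a + 1) - 1 - ln b) \<le>
      exp (real k * ln (real (N - k)) - (real k * ln (real k) - real k + 1 + ln (real k)))" by simp
  also have "\<dots> = real (N - k) ^ k * exp (- (real k * ln (real k) - real k + 1 + ln (real k)))"
  proof -
    have "exp (real k * ln (real (N - k))) = real (N - k) ^ k"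
      using N k by (subst exp_of_nat_mult) (simp add: of_nat_diff)
    moreover have "exp (A - B) = exp A * exp (- B)" for A B :: real
      by (simp add: exp_diff exp_minus divide_inverse)
    ultimately show ?thesis by simp
  qed
  finally show ?thesis using 1 by linarith
qed

lemma mult_five_mono:
  fixes a b x y d e :: real
  assumes "0 \<le> a" "a \<le> A" "0 \<le> b" "b \<le> B" "0 \<le> x" "0 \<le> y" "0 \<le> d" "d \<le> D" "0 \<le> e" "e \<le> E"
  shows "a * (b * x * y * d * e) \<le> A * (B * x * y * D * E)"
proof -
  have "b * x * y \<le> B * x * y" using assms by (intro mult_right_mono) auto
  then have "b * x * y * d \<le> B * x * y * D" using assms by (intro mult_mono) auto
  then have "b * x * y * d * e \<le> B * x * y * D * E" using assms by (intro mult_mono) auto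
  then show ?thesis using assms by (intro mult_mono) auto
qed

text \<open>The number of components with type profile \<open>k y\<close> close to \<open>\<alpha> ln n \<cdot> \<tau> y\<close> has mean
  \<open>n powr (1 + \<alpha> * ln (f / s) + o(1))\<close>; the profile \<open>\<tau>\<close> is the optimal (tilted) one, and the
  stationarity condition on \<open>s\<close> makes the exponent collapse to \<open>ln (f / s)\<close>.\<close>

lemma C1_lower_tail_profile:
  fixes F :: "real set" and \<rho> \<psi> \<tau> :: "real \<Rightarrow> real" and c s f m' \<Psi>b \<alpha> :: real
  assumes F: "finite F" "F \<noteq> {}" and \<rho>: "\<And>y. y \<in> F \<Longrightarrow> \<rho> y > 0" and \<psi>: "\<And>y. y \<in> F \<Longrightarrow> \<psi> y > 0"
    and c: "c > 0" and s: "s > 0" and \<alpha>: "\<alpha> > 0"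
    and m': "m' = (\<Sum>y\<in>F. \<rho> y * \<psi> y)"
    and f: "f = (\<Sum>y\<in>F. \<rho> y * \<psi> y * exp (c * \<psi> y * (s - m')))"
    and \<tau>: "\<tau> = (\<lambda>y. \<rho> y * \<psi> y * exp (c * \<psi> y * (s - m')) / f)"
    and \<Psi>b: "\<Psi>b = (\<Sum>y\<in>F. \<tau> y * \<psi> y)"
    and stat: "c * s * \<Psi>b = 1"
    and pos: "1 + \<alpha> * ln (f / s) > 0"
  shows "\<exists>g. g \<longlonglongrightarrow> 0 \<and> (\<forall>\<^sub>F n in sequentially. \<forall>x. (\<forall>i\<in>{1..n}. \<psi> (x i) > 0) \<longrightarrow>
    (\<forall>y\<in>F. \<rho> y * real n \<le> real (count_in x n {y})) \<longrightarrow>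
    measure_pmf.prob (graph_given_types n (rank1_kernel c \<psi>) x) {E. C1 n E < \<alpha> * ln (real n) - card F} \<le> g n)"
proof -
  have fpos: "f > 0" unfolding f using F \<rho> \<psi> by (intro sum_pos) auto
  have \<tau>pos: "\<tau> y > 0" if "y \<in> F" for y using that \<rho> \<psi> fpos by (simp add: \<tau>)
  have \<tau>sum: "(\<Sum>y\<in>F. \<tau> y) = 1"
    using fpos by (simp add: \<tau> f sum_divide_distrib[symmetric])
  have \<tau>le: "\<tau> y \<le> 1" if "y \<in> F" for y
    using that F \<tau>pos member_le_sum[of y F \<tau>] unfolding \<tau>sum by (auto simp: less_imp_le)
  have \<Psi>bpos: "\<Psi>b > 0" unfolding \<Psi>b using F \<tau>pos \<psi> by (intro sum_pos) auto
  have m'pos: "m' > 0" unfolding m' using F \<rho> \<psi> by (intro sum_pos) auto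
  define W where "W = (\<Sum>y\<in>F. \<psi> y)"
  have W: "\<psi> y \<le> W" if "y \<in> F" for y
    unfolding W_def using that F \<psi> by (intro member_le_sum) (auto simp: less_imp_le)
  have Wpos: "W > 0" unfolding W_def using F \<psi> by (intro sum_pos) auto
  define L where "L n = \<alpha> * ln (real n)" for n
  \<comment> \<open>Rounding down costs at most one vertex per type, so the total \<open>K n\<close>
    falls short of \<alpha> ln n by at most \<open>card F\<close>; this is the shift in the
    statement.\<close>
  define k where "k n y = nat \<lfloor>\<tau> y * L n\<rfloor>" for n y
  define N where "N n y = nat \<lfloor>\<rho> y * real n\<rfloor>" for n y
  define K where "K n = (\<Sum>y\<in>F. k n y)" for n
  define \<delta> where "\<delta> n = c * W\<^sup>2 / real n" for n
  define \<Psi> where "\<Psi> n = (\<Sum>y\<in>F. k n y * \<psi> y)" for n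
  define \<Phi> where "\<Phi> n = (\<Sum>y\<in>F. N n y * \<psi> y)" for n
  \<comment> \<open>The contribution to the exponent per vertex of type \<open>y\<close>, namely ln
    (\<rho> y) - ln (\<tau> y) + ln (\<psi> y) + 1 + ln c + ln \<Psi>b, simplified by the definition
    of \<tau> and by stationarity.\<close>
  define B where "B y = ln f - ln s + 1 - c * \<psi> y * (s - m')" for y
  \<comment> \<open>A factor ln n is lost once per binomial coefficient and twice in
    \<open>\<Psi> n ^ (K n - 1) / \<Psi> n\<close>; \<open>D'\<close> collects the losses that stay
    bounded. With these, \<open>ell n\<close> is a lower bound for the logarithm of the first
    moment.\<close>
  define D where "D = real (card F) + 2"
  define D' where "D' = (\<Sum>y\<in>F. \<bar>B y\<bar>) + ln c + 2 * real (card F) + 2 + (W / \<Psi>b + 1) + 2 * ln \<Psi>b"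
  define ell where "ell n = ln (real n) * (1 + \<alpha> * ln (f / s)) - D * ln (L n) - D'" for n
  define g where "g n = exp (- ell n) + (exp (- ((L n)\<^sup>2 * ln (1 - \<delta> n))) - 1)" for n
  have b: "1 + \<alpha> * ln (f / s) > 0" by (rule pos)
  have g0: "g \<longlonglongrightarrow> 0"
  proof -
    have "(\<lambda>n. exp (- (ln (real n) * \<beta> - D * ln (\<alpha> * ln (real n)) - D'))) \<longlonglongrightarrow> 0" if "\<beta> > 0" for \<beta>
      using that \<alpha> by real_asymp
    from this[OF b] have 1: "(\<lambda>n. exp (- ell n)) \<longlonglongrightarrow> 0" unfolding ell_def L_def .
    have 2: "(\<lambda>n. exp (- ((L n)\<^sup>2 * ln (1 - \<delta> n))) - 1) \<longlonglongrightarrow> 0"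
      unfolding L_def \<delta>_def using c Wpos \<alpha> by real_asymp
    show ?thesis unfolding g_def using tendsto_add[OF 1 2] by simp
  qed
  have ev1: "\<forall>\<^sub>F n in sequentially. \<forall>y\<in>F. 1 \<le> \<tau> y * L n"
    unfolding L_def using \<tau>pos \<alpha> by (intro eventually_ball_finite F ballI) real_asymp
  have ev2: "\<forall>\<^sub>F n in sequentially. \<forall>y\<in>F. 2 * L n + 1 \<le> \<rho> y * real n \<and> 0 < \<rho> y * real n - 1 - L n
      \<and> L n * (ln (\<rho> y * real n) - ln (\<rho> y * real n - 1 - L n)) \<le> 1"
  proof (intro eventually_ball_finite F ballI eventually_conj)
    fix y assume y: "y \<in> F"
    show "\<forall>\<^sub>F n in sequentially. 2 * L n + 1 \<le> \<rho> y * real n"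
      "\<forall>\<^sub>F n in sequentially. 0 < \<rho> y * real n - 1 - L n"
      "\<forall>\<^sub>F n in sequentially. L n * (ln (\<rho> y * real n) - ln (\<rho> y * real n - 1 - L n)) \<le> 1"
      unfolding L_def using \<rho>[OF y] \<alpha> by real_asymp+
  qed
  have ev3: "\<forall>\<^sub>F n in sequentially. 1 \<le> L n \<and> -1 \<le> (L n)\<^sup>2 * ln (1 - \<delta> n) \<and> \<delta> n \<le> 1 / 2
     \<and> 2 * \<delta> n * (c * L n * \<Psi>b * m') \<le> 1"
    unfolding L_def \<delta>_def using c Wpos \<alpha> \<Psi>bpos m'pos by (intro eventually_conj) real_asymp+
  have ev4: "\<forall>\<^sub>F n in sequentially. 0 < L n * \<Psi>b - W \<and>
      L n * (ln (L n * \<Psi>b) - ln (L n * \<Psi>b - W)) \<le> W / \<Psi>b + 1"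
  proof (intro eventually_conj)
    show "\<forall>\<^sub>F n in sequentially. 0 < L n * \<Psi>b - W"
      unfolding L_def using \<alpha> \<Psi>bpos by real_asymp
    have eq: "W / \<Psi>b = \<alpha> * (inverse \<alpha> * inverse \<Psi>b * W)" using \<alpha> by (simp add: divide_inverse)
    have "(\<lambda>n. L n * (ln (L n * \<Psi>b) - ln (L n * \<Psi>b - W))) \<longlonglongrightarrow> W / \<Psi>b"
      unfolding L_def eq using \<alpha> \<Psi>bpos Wpos by real_asymp
    then show "\<forall>\<^sub>F n in sequentially. L n * (ln (L n * \<Psi>b) - ln (L n * \<Psi>b - W)) \<le> W / \<Psi>b + 1"
      by (rule order_tendstoD(2)[where a = "W / \<Psi>b + 1", THEN eventually_mono]) auto
  qed
  have main: "measure_pmf.prob (graph_given_types n (rank1_kernel c \<psi>) x) {E. C1 n E < \<alpha> * ln (real n) - card F} \<le> g n"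
    if n: "n \<ge> 1" and 1: "\<forall>y\<in>F. 1 \<le> \<tau> y * L n"
      and 2: "\<forall>y\<in>F. 2 * L n + 1 \<le> \<rho> y * real n \<and> 0 < \<rho> y * real n - 1 - L n
        \<and> L n * (ln (\<rho> y * real n) - ln (\<rho> y * real n - 1 - L n)) \<le> 1"
      and 3: "1 \<le> L n" "-1 \<le> (L n)\<^sup>2 * ln (1 - \<delta> n)" "\<delta> n \<le> 1 / 2" "2 * \<delta> n * (c * L n * \<Psi>b * m') \<le> 1"
      and 4: "0 < L n * \<Psi>b - W" "L n * (ln (L n * \<Psi>b) - ln (L n * \<Psi>b - W)) \<le> W / \<Psi>b + 1"
      and x: "\<forall>i\<in>{1..n}. \<psi> (x i) > 0" and cnt: "\<forall>y\<in>F. \<rho> y * real n \<le> real (count_in x n {y})" for n x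
  proof -
    have k: "real (k n y) \<le> \<tau> y * L n" "\<tau> y * L n - 1 \<le> real (k n y)" "1 \<le> k n y" if "y \<in> F" for y
    proof -
      have "1 \<le> \<tau> y * L n" using 1 that by auto
      then show "real (k n y) \<le> \<tau> y * L n" "\<tau> y * L n - 1 \<le> real (k n y)" "1 \<le> k n y"
        unfolding k_def by linarith+
    qed
    have kL: "real (k n y) \<le> L n" if "y \<in> F" for y
    proof -
      have "\<tau> y * L n \<le> 1 * L n" using \<tau>le[OF that] 3(1) by (intro mult_right_mono) auto
      then show ?thesis using k(1)[OF that] by linarith
    qed
    have N: "real (N n y) \<le> \<rho> y * real n" "\<rho> y * real n - 1 \<le> real (N n y)" if "y \<in> F" for y
    proof -
      have "0 \<le> \<rho> y * real n" using \<rho>[OF that] by simp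
      then show "real (N n y) \<le> \<rho> y * real n" "\<rho> y * real n - 1 \<le> real (N n y)"
        unfolding N_def by linarith+
    qed
    have Ksum: "real (K n) = (\<Sum>y\<in>F. real (k n y))" by (simp add: K_def)
    have KL: "real (K n) \<le> L n"
    proof -
      have "real (K n) \<le> (\<Sum>y\<in>F. \<tau> y * L n)" unfolding Ksum by (intro sum_mono k)
      also have "\<dots> = L n" by (simp add: sum_distrib_right[symmetric] \<tau>sum)
      finally show ?thesis .
    qed
    have KL': "L n - card F \<le> real (K n)"
    proof -
      have "L n - card F = (\<Sum>y\<in>F. \<tau> y * L n - 1)"
        by (simp add: sum_subtractf sum_distrib_right[symmetric] \<tau>sum)
      also have "\<dots> \<le> real (K n)" unfolding Ksum by (intro sum_mono k)
      finally show ?thesis .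
    qed
    have Kpos: "K n > 0"
    proof -
      obtain y where y: "y \<in> F" using F by auto
      have "k n y \<le> K n" unfolding K_def using F y by (intro member_le_sum) auto
      then show ?thesis using k(3)[OF y] by linarith
    qed
    have \<Psi>le: "\<Psi> n \<le> L n * \<Psi>b"
    proof -
      have "\<Psi> n \<le> (\<Sum>y\<in>F. \<tau> y * L n * \<psi> y)"
        unfolding \<Psi>_def using \<psi> k(1) by (intro sum_mono mult_right_mono) (auto simp: less_imp_le)
      also have "\<dots> = L n * \<Psi>b" by (simp add: \<Psi>b sum_distrib_left mult_ac)
      finally show ?thesis .
    qed
    have \<Psi>ge: "L n * \<Psi>b - W \<le> \<Psi> n"
    proof -
      have "L n * \<Psi>b - W = (\<Sum>y\<in>F. (\<tau> y * L n - 1) * \<psi> y)"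
        by (simp add: \<Psi>b W_def sum_distrib_left sum_subtractf[symmetric] algebra_simps)
      also have "\<dots> \<le> \<Psi> n"
        unfolding \<Psi>_def using \<psi> k(2) by (intro sum_mono mult_right_mono) (auto simp: less_imp_le)
      finally show ?thesis .
    qed
    have \<Psi>pos: "\<Psi> n > 0" using \<Psi>ge 4(1) by linarith
    have \<Phi>le: "\<Phi> n \<le> real n * m'"
    proof -
      have "\<Phi> n \<le> (\<Sum>y\<in>F. \<rho> y * real n * \<psi> y)"
        unfolding \<Phi>_def using \<psi> N(1) by (intro sum_mono mult_right_mono) (auto simp: less_imp_le)
      also have "\<dots> = real n * m'" by (simp add: m' sum_distrib_left mult_ac)
      finally show ?thesis .
    qed
    have \<Phi>0: "\<Phi> n \<ge> 0" unfolding \<Phi>_def using \<psi> by (intro sum_nonneg) (auto simp: less_imp_le)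
    have \<delta>0: "\<delta> n \<ge> 0" unfolding \<delta>_def using c by simp
    have n0: "real n > 0" using n by simp
    have L0: "L n > 0" using 3 by linarith
    have i1: "exp (\<Sum>y\<in>F. real (k n y) * (ln (\<rho> y) + ln n - ln (\<tau> y) - ln (L n) + 1) - 2 - ln (L n)) \<le>
        (\<Prod>y\<in>F. real (N n y choose k n y))"
    proof -
      have "exp (real (k n y) * (ln (\<rho> y) + ln n - ln (\<tau> y) - ln (L n) + 1) - 2 - ln (L n)) \<le>
          real (N n y choose k n y)" if y: "y \<in> F" for y
      proof -
        \<comment> \<open>A lower bound for \<open>N n y - k n y\<close> free of rounding; replacing
          it by \<open>\<rho> y * real n\<close> costs at most 1 in the exponent.\<close>
        define r where "r = \<rho> y * real n - 1 - L n"
        have r: "r > 0" "2 * L n + 1 \<le> \<rho> y * real n" "L n * (ln (\<rho> y * real n) - ln r) \<le> 1"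
          using 2 y by (auto simp: r_def)
        have "r \<le> \<rho> y * real n" using 3(1) by (simp add: r_def)
        then have d0: "0 \<le> ln (\<rho> y * real n) - ln r" using r by simp
        have "real (k n y) * (ln (\<rho> y * real n) - ln r) \<le> L n * (ln (\<rho> y * real n) - ln r)"
          using kL[OF y] d0 by (intro mult_right_mono)
        then have d1: "real (k n y) * (ln (\<rho> y * real n) - ln r) \<le> 1" using r(3) by linarith
        have "exp (real (k n y) * (ln r - ln (\<tau> y * L n) + 1) - 1 - ln (L n)) \<le> real (N n y choose k n y)"
        proof (rule binomial_ge_exp)
          have "2 * real (k n y) \<le> real (N n y)" using kL[OF y] N(2)[OF y] r(2) by linarith
          then show "2 * k n y \<le> N n y" by linarith
          show "\<tau> y * L n \<le> L n" using \<tau>le[OF y] L0 by simp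
          show "r \<le> real (N n y) - real (k n y)" using kL[OF y] N(2)[OF y] unfolding r_def by linarith
        qed (use k[OF y] \<tau>pos[OF y] L0 r in auto)
        moreover have "real (k n y) * (ln (\<rho> y) + ln n - ln (\<tau> y) - ln (L n) + 1) - 2 - ln (L n) \<le>
            real (k n y) * (ln r - ln (\<tau> y * L n) + 1) - 1 - ln (L n)"
          using d1 \<rho>[OF y] n0 \<tau>pos[OF y] L0 by (simp add: ln_mult algebra_simps)
        ultimately show ?thesis by (meson exp_le_cancel_iff order_trans)
      qed
      then show ?thesis
        using F by (subst exp_sum) (auto intro!: prod_mono)
    qed
    have i2: "exp (-1) \<le> (1 - \<delta> n) ^ (K n)\<^sup>2" and i2': "1 / (1 - \<delta> n) ^ (K n)\<^sup>2 \<le> exp (- ((L n)\<^sup>2 * ln (1 - \<delta> n)))"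
    proof -
      have e: "(1 - \<delta> n) ^ (K n)\<^sup>2 = exp ((real (K n))\<^sup>2 * ln (1 - \<delta> n))"
        using 3(3) exp_of_nat_mult[of "(K n)\<^sup>2" "ln (1 - \<delta> n)"] by simp
      have "ln (1 - \<delta> n) \<le> 0" using \<delta>0 3(3) by simp
      moreover have "(real (K n))\<^sup>2 \<le> (L n)\<^sup>2" using KL by (intro power_mono) auto
      ultimately have *: "(L n)\<^sup>2 * ln (1 - \<delta> n) \<le> (real (K n))\<^sup>2 * ln (1 - \<delta> n)"
        by (intro mult_right_mono_neg)
      show "exp (-1) \<le> (1 - \<delta> n) ^ (K n)\<^sup>2" unfolding e using * 3(2) by simp
      show "1 / (1 - \<delta> n) ^ (K n)\<^sup>2 \<le> exp (- ((L n)\<^sup>2 * ln (1 - \<delta> n)))"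
        unfolding e using * by (simp add: exp_minus[symmetric] divide_inverse)
    qed
    have i3: "(c / real n) ^ (K n - 1) = exp ((real (K n) - 1) * (ln c - ln n))"
    proof -
      have "c / real n = exp (ln c - ln n)" using c n0 by (simp add: exp_diff)
      then have "(c / real n) ^ (K n - 1) = exp (real (K n - 1) * (ln c - ln n))"
        by (simp only: exp_of_nat_mult)
      then show ?thesis using Kpos by (simp add: of_nat_diff)
    qed
    have i4: "(\<Prod>y\<in>F. \<psi> y ^ k n y) = exp (\<Sum>y\<in>F. real (k n y) * ln (\<psi> y))"
      using F \<psi> by (subst exp_sum) (auto intro!: prod.cong simp: exp_of_nat_mult)
    \<comment> \<open>Rounding changes \<Psi> by at most W, a relative change of order 1 / ln n
      raised to a power of order ln n, so it costs a constant. The two missing powers of \<Psi> cost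
      the last term.\<close>
    have i5: "exp (real (K n) * ln (L n * \<Psi>b) - (W / \<Psi>b + 1) - 2 * ln (L n * \<Psi>b)) \<le> \<Psi> n ^ (K n - 1) / \<Psi> n"
    proof -
      have l1: "ln (L n * \<Psi>b - W) \<le> ln (\<Psi> n)" using \<Psi>ge 4(1) \<Psi>pos by simp
      have l2: "ln (\<Psi> n) \<le> ln (L n * \<Psi>b)" using \<Psi>le \<Psi>pos L0 \<Psi>bpos by simp
      have "real (K n) * (ln (L n * \<Psi>b) - ln (L n * \<Psi>b - W)) \<le> L n * (ln (L n * \<Psi>b) - ln (L n * \<Psi>b - W))"
        using KL l1 l2 by (intro mult_right_mono) auto
      then have "real (K n) * ln (L n * \<Psi>b) - (W / \<Psi>b + 1) \<le> real (K n) * ln (L n * \<Psi>b - W)"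
        using 4(2) by (simp add: algebra_simps)
      also have "\<dots> \<le> real (K n) * ln (\<Psi> n)" using l1 by (intro mult_left_mono) auto
      finally have "real (K n) * ln (L n * \<Psi>b) - (W / \<Psi>b + 1) - 2 * ln (L n * \<Psi>b) \<le>
          real (K n - 1) * ln (\<Psi> n) - ln (\<Psi> n)"
        using l2 Kpos by (simp add: of_nat_diff algebra_simps)
      then have "exp (real (K n) * ln (L n * \<Psi>b) - (W / \<Psi>b + 1) - 2 * ln (L n * \<Psi>b)) \<le>
          exp (real (K n - 1) * ln (\<Psi> n) - ln (\<Psi> n))" by simp
      also have "\<dots> = \<Psi> n ^ (K n - 1) / \<Psi> n"
        using \<Psi>pos by (simp only: exp_diff exp_of_nat_mult exp_ln)
      finally show ?thesis .
    qed
    \<comment> \<open>The correction 2 \<delta> is of order 1 / n while the exponent is of order ln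
      n; the extra 1 covers it.\<close>
    have i6: "exp (- (c * L n * \<Psi>b * m') - 1) \<le> exp (- (1 + 2 * \<delta> n) * (c / real n) * \<Psi> n * \<Phi> n)"
    proof -
      have "\<Psi> n * \<Phi> n \<le> (L n * \<Psi>b) * (real n * m')"
        using \<Psi>le \<Phi>le \<Psi>pos \<Phi>0 L0 \<Psi>bpos by (intro mult_mono) auto
      then have "(1 + 2 * \<delta> n) * (c / real n) * (\<Psi> n * \<Phi> n) \<le>
          (1 + 2 * \<delta> n) * (c / real n) * ((L n * \<Psi>b) * (real n * m'))"
        using \<delta>0 c n0 by (intro mult_left_mono) auto
      also have "\<dots> = (1 + 2 * \<delta> n) * (c * L n * \<Psi>b * m')" using n0 by simp
      also have "\<dots> \<le> c * L n * \<Psi>b * m' + 1" using 3(4) by (simp add: algebra_simps)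
      finally have "- (c * L n * \<Psi>b * m') - 1 \<le> - ((1 + 2 * \<delta> n) * (c / real n) * (\<Psi> n * \<Phi> n))" by linarith
      also have "\<dots> = - (1 + 2 * \<delta> n) * (c / real n) * \<Psi> n * \<Phi> n"
        by (simp only: mult.assoc mult_minus_left)
      finally show ?thesis by (simp only: exp_le_cancel_iff)
    qed
    define S where "S = (\<Sum>y\<in>F. real (k n y) * (ln (\<rho> y) + ln n - ln (\<tau> y) - ln (L n) + 1) - 2 - ln (L n))
       + (-1 + (real (K n) - 1) * (ln c - ln n) + (\<Sum>y\<in>F. real (k n y) * ln (\<psi> y)) +
        (real (K n) * ln (L n * \<Psi>b) - (W / \<Psi>b + 1) - 2 * ln (L n * \<Psi>b)) + (- (c * L n * \<Psi>b * m') - 1))"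
    have low: "exp S \<le> (\<Prod>y\<in>F. real (N n y choose k n y)) * ((1 - \<delta> n) ^ (K n)\<^sup>2 * (c / real n) ^ (K n - 1) *
        (\<Prod>y\<in>F. \<psi> y ^ k n y) * \<Psi> n ^ (K n - 1) / \<Psi> n * exp (- (1 + 2 * \<delta> n) * (c / real n) * \<Psi> n * \<Phi> n))"
    proof -
      have "exp S = exp (\<Sum>y\<in>F. real (k n y) * (ln (\<rho> y) + ln n - ln (\<tau> y) - ln (L n) + 1) - 2 - ln (L n)) *
        (exp (-1) * exp ((real (K n) - 1) * (ln c - ln n)) * exp (\<Sum>y\<in>F. real (k n y) * ln (\<psi> y)) *
        exp (real (K n) * ln (L n * \<Psi>b) - (W / \<Psi>b + 1) - 2 * ln (L n * \<Psi>b)) * exp (- (c * L n * \<Psi>b * m') - 1))"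
        unfolding S_def by (simp only: exp_add)
      also have "\<dots> \<le> (\<Prod>y\<in>F. real (N n y choose k n y)) * ((1 - \<delta> n) ^ (K n)\<^sup>2 * (c / real n) ^ (K n - 1) *
        (\<Prod>y\<in>F. \<psi> y ^ k n y) * (\<Psi> n ^ (K n - 1) / \<Psi> n) * exp (- (1 + 2 * \<delta> n) * (c / real n) * \<Psi> n * \<Phi> n))"
        unfolding i3 i4 by (rule mult_five_mono[OF _ i1 _ i2 _ _ _ i5 _ i6]) simp_all
      finally show ?thesis by (simp only: times_divide_eq_right)
    qed
    have ellS: "ell n \<le> S"
    proof -
      have Beq: "ln (\<rho> y) - ln (\<tau> y) + ln (\<psi> y) + 1 + ln c + ln \<Psi>b = B y" if y: "y \<in> F" for y
      proof -
        have "ln (\<tau> y) = ln (\<rho> y) + ln (\<psi> y) + c * \<psi> y * (s - m') - ln f"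
          using \<rho>[OF y] \<psi>[OF y] fpos by (simp add: \<tau> ln_mult ln_div)
        moreover have "ln c + ln s + ln \<Psi>b = 0"
        proof -
          have "ln (c * s * \<Psi>b) = ln c + ln s + ln \<Psi>b" using c s \<Psi>bpos by (subst ln_mult, simp_all, subst ln_mult) auto
          then show ?thesis unfolding stat by simp
        qed
        ultimately show ?thesis by (simp add: B_def)
      qed
      \<comment> \<open>The binomial coefficients give \<open>K n\<close> factors n, the edge
        probabilities only \<open>K n - 1\<close> factors 1 / n: the surviving \<open>ln n\<close>
        is the 1 in the exponent 1 + \<alpha> ln (f / s).\<close>
      have "S = (\<Sum>y\<in>F. real (k n y) * B y) + ln n - ln c - real (card F) * (2 + ln (L n)) - 2 - (W / \<Psi>b + 1)
          - 2 * ln (L n) - 2 * ln \<Psi>b - c * L n * \<Psi>b * m'"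
      proof -
        have "(\<Sum>y\<in>F. real (k n y) * B y) =
            (\<Sum>y\<in>F. real (k n y) * (ln (\<rho> y) - ln (\<tau> y) + ln (\<psi> y) + 1 + ln c + ln \<Psi>b))"
          by (intro sum.cong refl) (simp add: Beq)
        also have "\<dots> = (\<Sum>y\<in>F. real (k n y) * (ln (\<rho> y) + ln n - ln (\<tau> y) - ln (L n) + 1)) +
            (\<Sum>y\<in>F. real (k n y) * ln (\<psi> y)) + real (K n) * (ln c + ln \<Psi>b + ln (L n) - ln n)"
          unfolding Ksum sum_distrib_right sum.distrib[symmetric]
          by (intro sum.cong refl) (simp add: algebra_simps)
        finally have 1: "(\<Sum>y\<in>F. real (k n y) * B y) =
            (\<Sum>y\<in>F. real (k n y) * (ln (\<rho> y) + ln n - ln (\<tau> y) - ln (L n) + 1)) +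
            (\<Sum>y\<in>F. real (k n y) * ln (\<psi> y)) + real (K n) * (ln c + ln \<Psi>b + ln (L n) - ln n)" .
        have 2: "(\<Sum>y\<in>F. real (k n y) * (ln (\<rho> y) + ln n - ln (\<tau> y) - ln (L n) + 1) - 2 - ln (L n)) =
            (\<Sum>y\<in>F. real (k n y) * (ln (\<rho> y) + ln n - ln (\<tau> y) - ln (L n) + 1)) -
            real (card F) * (2 + ln (L n))"
          unfolding sum_subtractf sum_constant by (simp add: distrib_left)
        have 3: "ln (L n * \<Psi>b) = ln (L n) + ln \<Psi>b" using L0 \<Psi>bpos by (simp add: ln_mult)
        show ?thesis unfolding S_def 1 2 3 by (simp only: algebra_simps)
      qed
      moreover have "L n * (\<Sum>y\<in>F. \<tau> y * B y) - (\<Sum>y\<in>F. \<bar>B y\<bar>) \<le> (\<Sum>y\<in>F. real (k n y) * B y)"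
      proof -
        have "L n * (\<Sum>y\<in>F. \<tau> y * B y) - (\<Sum>y\<in>F. real (k n y) * B y) = (\<Sum>y\<in>F. (\<tau> y * L n - real (k n y)) * B y)"
          unfolding sum_distrib_left sum_subtractf[symmetric]
          by (intro sum.cong refl) (simp add: algebra_simps)
        also have "\<dots> \<le> (\<Sum>y\<in>F. \<bar>B y\<bar>)"
        proof (intro sum_mono)
          fix y assume y: "y \<in> F"
          have "(\<tau> y * L n - real (k n y)) * B y \<le> \<bar>(\<tau> y * L n - real (k n y)) * B y\<bar>" by simp
          also have "\<dots> \<le> 1 * \<bar>B y\<bar>"
            unfolding abs_mult using k[OF y] by (intro mult_right_mono) auto
          finally show "(\<tau> y * L n - real (k n y)) * B y \<le> \<bar>B y\<bar>" by simp
        qed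
        finally show ?thesis by linarith
      qed
      \<comment> \<open>Stationarity cancels the constant 1 in \<open>B\<close>; the summand c
        \<Psi>b m' cancels against the cost of isolation in \<open>S\<close>.\<close>
      moreover have "(\<Sum>y\<in>F. \<tau> y * B y) = ln (f / s) + c * \<Psi>b * m'"
      proof -
        have "(\<Sum>y\<in>F. \<tau> y * B y) = (\<Sum>y\<in>F. \<tau> y) * (ln f - ln s + 1) - c * (s - m') * \<Psi>b"
          unfolding B_def \<Psi>b sum_distrib_left sum_distrib_right sum_subtractf[symmetric]
          by (intro sum.cong refl) (simp add: algebra_simps)
        also have "\<dots> = ln (f / s) + c * \<Psi>b * m'"
          using stat fpos s by (simp add: \<tau>sum ln_div algebra_simps)
        finally show ?thesis .
      qed
      ultimately show ?thesis
        unfolding ell_def D_def D'_def by (simp add: L_def algebra_simps)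
    qed
    have "measure_pmf.prob (graph_given_types n (rank1_kernel c \<psi>) x) {E. C1 n E < \<alpha> * ln (real n) - card F} \<le>
        measure_pmf.prob (graph_given_types n (rank1_kernel c \<psi>) x) {E. C1 n E < K n}"
      using KL' unfolding L_def by (intro measure_pmf.finite_measure_mono) auto
    also have "\<dots> \<le> 1 / exp (ell n) + (1 / (1 - \<delta> n) ^ (K n)\<^sup>2 - 1)"
    proof (rule prob_C1_less_types_le)
      show "N n y \<le> count_in x n {y}" if "y \<in> F" for y
        using N(1)[OF that] cnt that by (meson of_nat_le_iff order_trans)
      show "c * \<psi> y * \<psi> y' / real n \<le> \<delta> n" if "y \<in> F" "y' \<in> F" for y y'
      proof -
        have "\<psi> y * \<psi> y' \<le> W * W" using W \<psi> that Wpos by (intro mult_mono) (auto simp: less_imp_le)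
        then show ?thesis unfolding \<delta>_def using c by (simp add: divide_right_mono power2_eq_square mult.assoc)
      qed
      show "exp (ell n) \<le> (\<Prod>y\<in>F. real (N n y choose k n y)) * ((1 - \<delta> n) ^ (K n)\<^sup>2 * (c / real n) ^ (K n - 1) *
        (\<Prod>y\<in>F. \<psi> y ^ k n y) * \<Psi> n ^ (K n - 1) / \<Psi> n * exp (- (1 + 2 * \<delta> n) * (c / real n) * \<Psi> n * \<Phi> n))"
        using low ellS by (meson exp_le_cancel_iff order_trans)
    qed (use n x c F Kpos \<delta>0 3(3) in \<open>auto simp: K_def \<Psi>_def \<Phi>_def\<close>)
    also have "\<dots> \<le> g n"
      unfolding g_def using i2' by (simp add: exp_minus divide_inverse)
    finally show ?thesis .
  qed
  have "\<forall>\<^sub>F n in sequentially. \<forall>x. (\<forall>i\<in>{1..n}. \<psi> (x i) > 0) \<longrightarrow>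
    (\<forall>y\<in>F. \<rho> y * real n \<le> real (count_in x n {y})) \<longrightarrow>
    measure_pmf.prob (graph_given_types n (rank1_kernel c \<psi>) x) {E. C1 n E < \<alpha> * ln (real n) - card F} \<le> g n"
    using ev1 ev2 ev3 ev4 eventually_ge_at_top[of 1]
    by eventually_elim (use main in blast)
  then show ?thesis using g0 by blast
qed

text \<open>The equation is the stationarity condition of f(s) / s for an exponential sum f. The
  quotient blows up at 0, where f stays positive, and at infinity, where f grows faster than
  linearly, so an interior minimum exists.\<close>

lemma exp_sum_quotient_minimizer:
  fixes a b :: "'a \<Rightarrow> real"
  assumes F: "finite F" "F \<noteq> {}" and a: "\<And>y. y \<in> F \<Longrightarrow> a y > 0" and b: "\<And>y. y \<in> F \<Longrightarrow> b y > 0"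
  obtains s where "s > 0" "s * (\<Sum>y\<in>F. a y * b y * exp (b y * s)) = (\<Sum>y\<in>F. a y * exp (b y * s))"
proof -
  define f where "f s = (\<Sum>y\<in>F. a y * exp (b y * s))" for s
  define h where "h s = f s / s" for s
  have fpos: "f s > 0" for s unfolding f_def using F a by (intro sum_pos) auto
  have fmono: "f s \<le> f t" if "s \<le> t" for s t
    unfolding f_def using that a b by (intro sum_mono mult_left_mono) (auto simp: less_imp_le)
  obtain y where y: "y \<in> F" using F by auto
  define C where "C = a y * (b y)\<^sup>2 / 2"
  have C: "C > 0" using a[OF y] b[OF y] by (simp add: C_def)
  have quad: "C * s\<^sup>2 \<le> f s" if "s \<ge> 0" for s
  proof -
    have "(b y * s)\<^sup>2 / 2 \<le> exp (b y * s)"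
      using power_over_fact_le_exp[of "b y * s" 2] b[OF y] that by (simp add: numeral_2_eq_2)
    then have "a y * ((b y * s)\<^sup>2 / 2) \<le> a y * exp (b y * s)" using a[OF y] by (intro mult_left_mono) auto
    also have "\<dots> \<le> f s"
      unfolding f_def using y F a by (intro member_le_sum) (auto simp: less_imp_le)
    finally show ?thesis by (simp add: C_def power_mult_distrib algebra_simps)
  qed
  \<comment> \<open>To the left of \<open>s0\<close> and to the right of \<open>s1\<close> the
    quotient is at least f(1), its value at the point 1 in between; the minimum over the compact
    interval is therefore global.\<close>
  define s0 where "s0 = f 0 / f 1"
  define s1 where "s1 = f 1 / C"
  have s0: "0 < s0" "s0 \<le> 1" using fpos fmono[of 0 1] by (auto simp: s0_def)
  have s1: "1 \<le> s1" using quad[of 1] C by (simp add: s1_def)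
  have deriv_f: "(f has_real_derivative (\<Sum>y\<in>F. a y * b y * exp (b y * s))) (at s)" for s
    unfolding f_def by (auto intro!: derivative_eq_intros sum.cong simp: mult_ac)
  have deriv_h: "(h has_real_derivative ((\<Sum>y\<in>F. a y * b y * exp (b y * s)) * s - f s * 1) / (s * s)) (at s)"
    if "s > 0" for s
    unfolding h_def[abs_def] using that by (intro DERIV_divide deriv_f DERIV_ident) auto
  have "continuous_on {s0..s1} h"
  proof (intro continuous_at_imp_continuous_on ballI)
    fix x assume "x \<in> {s0..s1}"
    then have "x > 0" using s0 by auto
    from DERIV_isCont[OF deriv_h[OF this]] show "isCont h x" .
  qed
  then obtain s where s: "s \<in> {s0..s1}" "\<And>t. t \<in> {s0..s1} \<Longrightarrow> h s \<le> h t"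
    using continuous_attains_inf[of "{s0..s1}" h] s0 s1 by (metis atLeastAtMost_iff compact_Icc empty_iff order_trans)
  have spos: "s > 0" using s s0 by auto
  have h1: "h s \<le> f 1" using s(2)[of 1] s0 s1 by (simp add: h_def)
  have min: "h s \<le> h t" if t: "t > 0" for t
  proof -
    consider "t < s0" | "t \<in> {s0..s1}" | "t > s1" by force
    then show ?thesis
    proof cases
      case 1
      have "f 1 * t \<le> f 0" using 1 fpos[of 1] by (simp add: s0_def field_simps)
      also have "\<dots> \<le> f t" using t by (intro fmono) auto
      finally have "f 1 \<le> h t" using t by (simp add: h_def field_simps)
      then show ?thesis using h1 by linarith
    next
      case 3
      have "f 1 * t \<le> C * t * t" using 3 C t by (intro mult_right_mono) (auto simp: s1_def field_simps)
      also have "\<dots> \<le> f t" using quad[of t] t by (simp add: power2_eq_square)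
      finally have "f 1 \<le> h t" using t by (simp add: h_def field_simps)
      then show ?thesis using h1 by linarith
    qed (use s in auto)
  qed
  have "((\<Sum>y\<in>F. a y * b y * exp (b y * s)) * s - f s * 1) / (s * s) = 0"
    using deriv_h[OF spos] spos min by (intro DERIV_local_min[where d = s]) auto
  then have "s * (\<Sum>y\<in>F. a y * b y * exp (b y * s)) = f s" using spos by (simp add: mult.commute)
  then show thesis using that spos by (simp add: f_def)
qed

section \<open>Choice of the thinning and of the optimal tilt\<close>

context rank1_exponential
begin

text \<open>When a fraction d / c of the vertices is kept, replacing s by s / \<theta> converts the
  inequality of \<open>exists_truncation\<close> at intensity d into z f(s) > s for the thinned
  model at the true c. The minimiser of f(s) / s then provides the component profile.\<close>

lemma C1_lower_tail:
  assumes \<alpha>: "\<alpha> > 0" and r: "r_radius S \<mu> \<psi> c < ereal (exp (1 / \<alpha>))"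
  shows "\<exists>\<epsilon>>0. \<exists>q>0. \<exists>g. g \<longlonglongrightarrow> 0 \<and> (\<forall>\<^sub>F n in sequentially. \<forall>x. (\<forall>i\<in>{1..n}. x i \<in> S) \<longrightarrow>
    good_types \<epsilon> q n x \<longrightarrow>
    measure_pmf.prob (graph_given_types n (rank1_kernel c \<psi>) x) {E. C1 n E < \<alpha> * ln (real n)} \<le> g n)"
proof -
  obtain z where z: "r_radius S \<mu> \<psi> c < ereal z" "z < exp (1 / \<alpha>)"
    using ereal_dense3[OF r] by auto
  have z1: "z > 1" using z r_radius_ge_1
    by (metis ereal_less(3) le_less_trans one_ereal_def ereal_less_eq(3) less_ereal.simps(1))
  \<comment> \<open>Strictly above \<alpha>; the difference times ln n absorbs the rounding loss
    \<open>card F\<close>.\<close>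
  define \<alpha>' where "\<alpha>' = 1 / ln z"
  have lnz: "ln z > 0" using z1 by simp
  have "ln z < 1 / \<alpha>" using z(2) z1 by (metis exp_less_cancel_iff exp_ln less_trans zero_less_one)
  then have \<alpha>': "\<alpha> < \<alpha>'" using \<alpha> lnz by (simp add: \<alpha>'_def field_simps)
  obtain F d where F: "finite F" "F \<noteq> {}" "F \<subseteq> set_pmf \<mu>" and d: "0 < d" "d < c"
    and trunc: "\<And>s. s > 0 \<Longrightarrow> s < z * restricted_tilted F d s"
    using exists_truncation[OF z(1)] by auto
  define \<theta> where "\<theta> = d / c"
  have \<theta>: "0 < \<theta>" "\<theta> < 1" using d by (auto simp: \<theta>_def)
  define \<rho> where "\<rho> y = \<theta> * pmf \<mu> y" for y
  define m' where "m' = (\<Sum>y\<in>F. \<rho> y * \<psi> y)"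
  have \<rho>: "\<rho> y > 0" if "y \<in> F" for y using that F \<theta> by (auto simp: \<rho>_def pmf_positive)
  have \<psi>F: "\<psi> y > 0" if "y \<in> F" for y using that F \<psi>_pos' by auto
  have m': "m' \<le> \<theta> * m"
  proof -
    have "m' = \<theta> * (\<Sum>y\<in>F. pmf \<mu> y * \<psi> y)" by (simp add: m'_def \<rho>_def sum_distrib_left mult_ac)
    also have "\<dots> \<le> \<theta> * m"
      unfolding m_def using F \<theta> \<psi>_integrable \<psi>_pos'
      by (intro mult_left_mono sum_pmf_le_integral) (auto simp: less_imp_le)
    finally show ?thesis .
  qed
  define f where "f s = (\<Sum>y\<in>F. \<rho> y * \<psi> y * exp (c * \<psi> y * (s - m')))" for s
  have zf: "s < z * f s" if s: "s > 0" for s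
  proof -
    have "s / \<theta> < z * restricted_tilted F d (s / \<theta>)" using s \<theta> by (intro trunc) auto
    then have "s < z * (\<theta> * restricted_tilted F d (s / \<theta>))" using \<theta> by (simp add: field_simps)
    also have "\<theta> * restricted_tilted F d (s / \<theta>) \<le> f s"
      unfolding f_def restricted_tilted_def sum_distrib_left
    proof (intro sum_mono)
      fix y assume y: "y \<in> F"
      have "d * \<psi> y * (s / \<theta> - m) = c * \<psi> y * (s - \<theta> * m)"
        using d c_pos by (simp add: \<theta>_def field_simps)
      \<comment> \<open>The thinned mean m' also lacks the types outside \<open>F\<close>; a smaller
        centre only increases the tilt.\<close>
      also have "\<dots> \<le> c * \<psi> y * (s - m')"
        using m' c_pos \<psi>F[OF y] by (intro mult_left_mono) auto
      finally have "\<theta> * pmf \<mu> y * \<psi> y * exp (d * \<psi> y * (s / \<theta> - m)) \<le> \<theta> * pmf \<mu> y * \<psi> y * exp (c * \<psi> y * (s - m'))"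
        using \<theta> \<psi>F[OF y] by (intro mult_left_mono) auto
      then show "\<theta> * (pmf \<mu> y * \<psi> y * exp (d * \<psi> y * (s / \<theta> - m))) \<le> \<rho> y * \<psi> y * exp (c * \<psi> y * (s - m'))"
        by (simp add: \<rho>_def mult.assoc)
    qed
    then have "z * (\<theta> * restricted_tilted F d (s / \<theta>)) \<le> z * f s" using z1 by (intro mult_left_mono) auto
    finally show ?thesis .
  qed
  obtain s where s: "s > 0"
    and opt: "s * (\<Sum>y\<in>F. \<rho> y * \<psi> y * exp (- (c * \<psi> y * m')) * (c * \<psi> y) * exp (c * \<psi> y * s)) =
      (\<Sum>y\<in>F. \<rho> y * \<psi> y * exp (- (c * \<psi> y * m')) * exp (c * \<psi> y * s))"
    by (rule exp_sum_quotient_minimizer[of F "\<lambda>y. \<rho> y * \<psi> y * exp (- (c * \<psi> y * m'))" "\<lambda>y. c * \<psi> y"])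
      (use F \<rho> \<psi>F c_pos in auto)
  define \<tau> where "\<tau> = (\<lambda>y. \<rho> y * \<psi> y * exp (c * \<psi> y * (s - m')) / f s)"
  have fpos: "f s > 0" unfolding f_def using F \<rho> \<psi>F by (intro sum_pos) auto
  have ex: "exp (c * \<psi> y * (s - m')) = exp (- (c * \<psi> y * m')) * exp (c * \<psi> y * s)" for y
    by (simp add: exp_add[symmetric] algebra_simps)
  have stat: "c * s * (\<Sum>y\<in>F. \<tau> y * \<psi> y) = 1"
  proof -
    have "c * s * (\<Sum>y\<in>F. \<tau> y * \<psi> y) = (s * (\<Sum>y\<in>F. \<rho> y * \<psi> y * exp (- (c * \<psi> y * m')) * (c * \<psi> y) * exp (c * \<psi> y * s))) / f s"
      unfolding sum_distrib_left sum_divide_distrib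
      by (intro sum.cong refl) (simp only: \<tau>_def ex, simp add: mult_ac)
    also have "\<dots> = f s / f s" unfolding opt by (simp only: f_def ex) (simp only: mult.assoc)
    finally show ?thesis using fpos by simp
  qed
  \<comment> \<open>By \<open>zf\<close> one has ln (f(s) / s) > - ln z, and \<alpha>' is the
    reciprocal of ln z.\<close>
  have pos: "1 + \<alpha>' * ln (f s / s) > 0"
  proof -
    have "1 < z * (f s / s)" using zf[OF s] s by (simp add: field_simps)
    then have "0 < ln (z * (f s / s))" by simp
    also have "\<dots> = ln z + ln (f s / s)" using z1 fpos s by (subst ln_mult_pos) auto
    finally have "0 < \<alpha>' * (ln z + ln (f s / s))" using \<alpha> \<alpha>' by simp
    then show ?thesis using lnz by (simp add: \<alpha>'_def distrib_left)
  qed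
  obtain g where g: "g \<longlonglongrightarrow> 0" and ev: "\<forall>\<^sub>F n in sequentially. \<forall>x. (\<forall>i\<in>{1..n}. \<psi> (x i) > 0) \<longrightarrow>
    (\<forall>y\<in>F. \<rho> y * real n \<le> real (count_in x n {y})) \<longrightarrow>
    measure_pmf.prob (graph_given_types n (rank1_kernel c \<psi>) x) {E. C1 n E < \<alpha>' * ln (real n) - card F} \<le> g n"
    using C1_lower_tail_profile[OF F(1,2) \<rho> \<psi>F c_pos s _ m'_def f_def[of s] \<tau>_def refl stat pos] \<alpha> \<alpha>' by auto
  define W where "W = (\<Sum>y\<in>F. \<psi> y)"
  have W: "\<psi> y \<le> W" if "y \<in> F" for y
    unfolding W_def using that F \<psi>F by (intro member_le_sum) (auto simp: less_imp_le)
  \<comment> \<open>On \<open>F\<close>, where \<psi> is at most W, the relative fluctuation with q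
    = 1 is then at most 1 - \<theta>, so the required fraction of each type is present.\<close>
  define \<epsilon> where "\<epsilon> = (1 - \<theta>) * exp (- W)"
  have \<epsilon>: "\<epsilon> > 0" using \<theta> by (simp add: \<epsilon>_def)
  have cnt: "\<rho> y * real n \<le> real (count_in x n {y})" if good: "good_types \<epsilon> 1 n x" and n: "n \<ge> 1" and y: "y \<in> F" for n x y
  proof -
    have yS: "y \<in> S" using y F supp by auto
    have "\<epsilon> * exp (1 * \<psi> y) \<le> (1 - \<theta>) * exp (- W) * exp W"
      unfolding \<epsilon>_def using W[OF y] \<theta> by (intro mult_left_mono) auto
    also have "\<dots> = 1 - \<theta>" by (simp add: mult.assoc exp_add[symmetric])
    finally have "\<epsilon> * exp (1 * \<psi> y) * pmf \<mu> y \<le> (1 - \<theta>) * pmf \<mu> y" by (intro mult_right_mono) auto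
    moreover have "\<bar>count_in x n {y} / n - pmf \<mu> y\<bar> \<le> \<epsilon> * exp (1 * \<psi> y) * pmf \<mu> y"
      using good yS unfolding good_types_def by blast
    ultimately have "\<theta> * pmf \<mu> y \<le> count_in x n {y} / n" by (simp add: abs_le_iff algebra_simps)
    then show ?thesis using n by (simp add: \<rho>_def field_simps)
  qed
  have "\<forall>\<^sub>F n in sequentially. \<alpha> * ln (real n) \<le> \<alpha>' * ln (real n) - card F"
    using \<alpha>' by real_asymp
  then have "\<forall>\<^sub>F n in sequentially. \<forall>x. (\<forall>i\<in>{1..n}. x i \<in> S) \<longrightarrow> good_types \<epsilon> 1 n x \<longrightarrow>
    measure_pmf.prob (graph_given_types n (rank1_kernel c \<psi>) x) {E. C1 n E < \<alpha> * ln (real n)} \<le> g n"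
    using ev eventually_ge_at_top[of 1]
  proof eventually_elim
    case (elim n)
    show ?case
    proof (intro allI impI)
      fix x assume x: "\<forall>i\<in>{1..n}. x i \<in> S" and good: "good_types \<epsilon> 1 n x"
      have "measure_pmf.prob (graph_given_types n (rank1_kernel c \<psi>) x) {E. C1 n E < \<alpha> * ln (real n)} \<le>
        measure_pmf.prob (graph_given_types n (rank1_kernel c \<psi>) x) {E. C1 n E < \<alpha>' * ln (real n) - card F}"
        using elim(1) by (intro measure_pmf.finite_measure_mono) auto
      also have "\<dots> \<le> g n" using elim(2) x good cnt[OF good elim(3)] \<psi>_pos by blast
      finally show "measure_pmf.prob (graph_given_types n (rank1_kernel c \<psi>) x) {E. C1 n E < \<alpha> * ln (real n)} \<le> g n" .
    qed
  qed
  then show ?thesis using \<epsilon> g by (intro exI[of _ \<epsilon>] conjI exI[of _ 1] exI[of _ g]) auto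
qed

end


section \<open>Random types\<close>

text \<open>For bounded \<psi> the exponent 1 works; in the other case the summability condition is
  an exponential moment written as an unordered sum.\<close>

lemma growth_condition_exp_moment:
  assumes S: "countable S" "set_pmf \<mu> \<subseteq> S" and \<psi>: "\<And>x. x \<in> S \<Longrightarrow> \<psi> x > 0" and g: "growth_condition S \<mu> \<psi>"
  shows "\<exists>a>0. integrable \<mu> (\<lambda>x. exp (a * \<psi> x))"
proof -
  have "bdd_above (\<psi> ` S) \<or> (\<exists>a>0. (\<lambda>x. exp (a * \<psi> x) * pmf \<mu> x) summable_on S)"
    using g unfolding growth_condition_def by (elim disjE conjE) (rule disjI1, assumption, rule disjI2, assumption)
  then show ?thesis
  proof
    assume "bdd_above (\<psi> ` S)"
    then obtain B where B: "\<And>x. x \<in> S \<Longrightarrow> \<psi> x \<le> B" by (auto simp: bdd_above_def)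
    have "integrable \<mu> (\<lambda>x. exp (1 * \<psi> x))"
      using B S by (intro measure_pmf.integrable_const_bound[where B = "exp B"]) (auto simp: AE_measure_pmf_iff)
    then show ?thesis by (intro exI[of _ 1]) auto
  next
    assume "\<exists>a>0. (\<lambda>x. exp (a * \<psi> x) * pmf \<mu> x) summable_on S"
    then obtain a where a: "a > 0" and sm: "(\<lambda>x. exp (a * \<psi> x) * pmf \<mu> x) summable_on S" by auto
    have "(\<integral>\<^sup>+x. ennreal (exp (a * \<psi> x)) \<partial>\<mu>) = (\<Sum>\<^sub>\<infinity>x\<in>S. ennreal (pmf \<mu> x) * ennreal (exp (a * \<psi> x)))"
      by (rule nn_integral_pmf_eq_infsum[OF S, symmetric])
    also have "\<dots> = (\<Sum>\<^sub>\<infinity>x\<in>S. ennreal (exp (a * \<psi> x) * pmf \<mu> x))"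
      by (intro infsum_cong) (simp add: ennreal_mult mult.commute)
    also have "\<dots> = (SUP F\<in>{F. finite F \<and> F \<subseteq> S}. (\<Sum>x\<in>F. ennreal (exp (a * \<psi> x) * pmf \<mu> x)))"
      by (rule nonneg_infsum_complete) simp
    also have "\<dots> = (SUP F\<in>{F. finite F \<and> F \<subseteq> S}. ennreal (\<Sum>x\<in>F. exp (a * \<psi> x) * pmf \<mu> x))"
      by (intro SUP_cong refl sum_ennreal) simp
    also have "\<dots> = ennreal (\<Sum>\<^sub>\<infinity>x\<in>S. exp (a * \<psi> x) * pmf \<mu> x)"
      by (rule infsum_nonneg_is_SUPREMUM_ennreal[OF sm, symmetric]) simp
    finally have eq: "(\<integral>\<^sup>+x. ennreal (exp (a * \<psi> x)) \<partial>\<mu>) = ennreal (\<Sum>\<^sub>\<infinity>x\<in>S. exp (a * \<psi> x) * pmf \<mu> x)" .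
    have "integrable \<mu> (\<lambda>x. exp (a * \<psi> x))"
    proof (rule integrableI_bounded)
      show "(\<integral>\<^sup>+x. ennreal (norm (exp (a * \<psi> x))) \<partial>\<mu>) < \<infinity>" using eq by simp
    qed simp
    then show ?thesis using a by auto
  qed
qed

lemma exp_moment_imp_integrable:
  assumes "\<And>x. x \<in> set_pmf \<mu> \<Longrightarrow> \<psi> x > 0" and "\<exists>a>0. integrable (measure_pmf \<mu>) (\<lambda>x. exp (a * \<psi> x))"
  shows "integrable (measure_pmf \<mu>) (\<psi> :: _ \<Rightarrow> real)"
proof -
  obtain a where a: "a > 0" "integrable (measure_pmf \<mu>) (\<lambda>x. exp (a * \<psi> x))" using assms(2) by auto
  show ?thesis
  proof (rule Bochner_Integration.integrable_bound)
    show "integrable (measure_pmf \<mu>) (\<lambda>x. 1 / a * exp (a * \<psi> x))" using a by (intro integrable_mult_right)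
    show "AE x in \<mu>. norm (\<psi> x) \<le> norm (1 / a * exp (a * \<psi> x))"
      unfolding AE_measure_pmf_iff
    proof
      fix x assume x: "x \<in> set_pmf \<mu>"
      have "a * \<psi> x \<le> exp (a * \<psi> x)" using exp_ge_add_one_self[of "a * \<psi> x"] by linarith
      then have "\<psi> x \<le> exp (a * \<psi> x) / a" using a by (simp add: field_simps)
      then show "norm (\<psi> x) \<le> norm (1 / a * exp (a * \<psi> x))" using assms(1)[OF x] a by simp
    qed
  qed simp
qed

section \<open>Averaging over random types\<close>

context
  fixes S :: "real set" and M :: "nat \<Rightarrow> 'w measure" and X :: "nat \<Rightarrow> nat \<Rightarrow> 'w \<Rightarrow> real"
    and \<kappa> :: "real \<Rightarrow> real \<Rightarrow> real" and n :: nat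
  assumes S: "countable S" and M: "prob_space (M n)"
    and X: "\<And>i. i \<in> {1..n} \<Longrightarrow> X n i \<in> borel_measurable (M n)"
      "\<And>i \<omega>. i \<in> {1..n} \<Longrightarrow> \<omega> \<in> space (M n) \<Longrightarrow> X n i \<omega> \<in> S"
begin

lemma graph_given_types_restrict:
  "graph_given_types n \<kappa> x = graph_given_types n \<kappa> (restrict x {1..n})"
  unfolding graph_given_types_def
  by (intro arg_cong[of _ _ "map_pmf _"] Pi_pmf_cong) (auto simp: vertex_pairs_def)

text \<open>The law depends on the types only through the vector of the first n, which takes values
  in the countable set \<open>T\<close>; on a countable discrete space every kernel is
  measurable.\<close>

lemma measurable_graph_given_types:
  "(\<lambda>\<omega>. measure_pmf (graph_given_types n \<kappa> (\<lambda>i. X n i \<omega>)))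
     \<in> measurable (M n) (subprob_algebra (count_space UNIV))"
proof -
  define T where "T = PiE {1..n} (\<lambda>_. S)"
  have T: "countable T" unfolding T_def using S by (intro countable_PiE) auto
  have "(\<lambda>\<omega>. \<lambda>i\<in>{1..n}. X n i \<omega>) \<in> measurable (M n) (count_space T)"
  proof (rule measurableI)
    show "(\<lambda>i\<in>{1..n}. X n i \<omega>) \<in> space (count_space T)" if "\<omega> \<in> space (M n)" for \<omega>
      using X(2) that by (auto simp: T_def)
    fix A assume "A \<in> sets (count_space T)"
    then have A: "A \<subseteq> T" "countable A" using countable_subset[OF _ T] by auto
    have "(\<lambda>\<omega>. \<lambda>i\<in>{1..n}. X n i \<omega>) -` A \<inter> space (M n) =
        (\<Union>x\<in>A. (\<lambda>\<omega>. \<lambda>i\<in>{1..n}. X n i \<omega>) -` {x} \<inter> space (M n))" by auto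
    also have "\<dots> \<in> sets (M n)"
    proof (rule sets.countable_UN''[OF A(2)])
      fix x assume "x \<in> A"
      then have x: "x \<in> T" using A by auto
      have "(\<lambda>\<omega>. \<lambda>i\<in>{1..n}. X n i \<omega>) -` {x} \<inter> space (M n) =
          {\<omega> \<in> space (M n). \<forall>i\<in>{1..n}. X n i \<omega> = x i}"
      proof -
        have "(\<lambda>i\<in>{1..n}. X n i \<omega>) = x \<longleftrightarrow> (\<forall>i\<in>{1..n}. X n i \<omega> = x i)" for \<omega>
          using x PiE_restrict[of x "{1..n}" "\<lambda>_. S"] unfolding T_def by (metis restrict_apply' restrict_ext)
        then show ?thesis by auto
      qed
      also have "\<dots> \<in> sets (M n)"
      proof (intro sets.sets_Collect_finite_All)
        fix i assume i: "i \<in> {1..n}"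
        have "X n i -` {x i} \<inter> space (M n) \<in> sets (M n)"
          using X(1)[OF i] by (rule measurable_sets) simp
        also have "X n i -` {x i} \<inter> space (M n) = {\<omega> \<in> space (M n). X n i \<omega> = x i}" by auto
        finally show "{\<omega> \<in> space (M n). X n i \<omega> = x i} \<in> sets (M n)" .
      qed simp
      finally show "(\<lambda>\<omega>. \<lambda>i\<in>{1..n}. X n i \<omega>) -` {x} \<inter> space (M n) \<in> sets (M n)" .
    qed
    finally show "(\<lambda>\<omega>. \<lambda>i\<in>{1..n}. X n i \<omega>) -` A \<inter> space (M n) \<in> sets (M n)" .
  qed
  moreover have "(\<lambda>x. measure_pmf (graph_given_types n \<kappa> x)) \<in> measurable (count_space T) (subprob_algebra (count_space UNIV))"
    by (simp add: measure_pmf_in_subprob_algebra)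
  ultimately have "(\<lambda>\<omega>. measure_pmf (graph_given_types n \<kappa> (\<lambda>i\<in>{1..n}. X n i \<omega>)))
     \<in> measurable (M n) (subprob_algebra (count_space UNIV))"
    by (rule measurable_compose)
  then show ?thesis
    by (subst graph_given_types_restrict) (simp add: restrict_def)
qed

lemma sets_random_graph: "sets (random_graph M X \<kappa> n) = UNIV"
  and space_random_graph: "space (random_graph M X \<kappa> n) = UNIV"
  and prob_space_random_graph: "prob_space (random_graph M X \<kappa> n)"
proof -
  interpret prob_space "M n" by (rule M)
  show "sets (random_graph M X \<kappa> n) = UNIV"
    unfolding random_graph_def by (subst sets_bind[where N = "count_space UNIV"]) (auto simp: not_empty)
  then show "space (random_graph M X \<kappa> n) = UNIV"
    using sets_eq_imp_space_eq[of "random_graph M X \<kappa> n" "count_space UNIV"] by simp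
  show "prob_space (random_graph M X \<kappa> n)"
    unfolding random_graph_def
    by (rule prob_space_bind[OF _ measurable_graph_given_types]) (auto simp: measure_pmf.prob_space_axioms)
qed

text \<open>Conditioning on the types: on \<open>G\<close> the bound \<open>b\<close> applies,
  elsewhere the conditional probability is at most 1.\<close>

lemma prob_random_graph_le:
  assumes G: "G \<in> sets (M n)" and b: "b \<ge> 0"
    and le: "\<And>\<omega>. \<omega> \<in> G \<Longrightarrow> measure_pmf.prob (graph_given_types n \<kappa> (\<lambda>i. X n i \<omega>)) A \<le> b"
  shows "measure (random_graph M X \<kappa> n) A \<le> b + (1 - measure (M n) G)"
proof -
  interpret prob_space "M n" by (rule M)
  interpret R: prob_space "random_graph M X \<kappa> n" by (rule prob_space_random_graph)
  have "ennreal (measure (random_graph M X \<kappa> n) A) = emeasure (random_graph M X \<kappa> n) A"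
    by (simp add: R.emeasure_eq_measure)
  also have "\<dots> = (\<integral>\<^sup>+\<omega>. emeasure (graph_given_types n \<kappa> (\<lambda>i. X n i \<omega>)) A \<partial>M n)"
    unfolding random_graph_def
    by (rule emeasure_bind[OF not_empty measurable_graph_given_types]) simp
  also have "\<dots> \<le> (\<integral>\<^sup>+\<omega>. ennreal b + indicator (space (M n) - G) \<omega> \<partial>M n)"
  proof (intro nn_integral_mono)
    fix \<omega> assume \<omega>: "\<omega> \<in> space (M n)"
    show "emeasure (graph_given_types n \<kappa> (\<lambda>i. X n i \<omega>)) A \<le> ennreal b + indicator (space (M n) - G) \<omega>"
    proof (cases "\<omega> \<in> G")
      case True
      then show ?thesis using le by (simp add: measure_pmf.emeasure_eq_measure ennreal_leI)
    next
      case False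
      have "emeasure (graph_given_types n \<kappa> (\<lambda>i. X n i \<omega>)) A \<le> 1" by (rule measure_pmf.emeasure_le_1)
      then show ?thesis using False \<omega> by (simp add: add_increasing)
    qed
  qed
  also have "\<dots> = ennreal b + emeasure (M n) (space (M n) - G)"
    using G by (subst nn_integral_add) (auto simp: emeasure_space_1)
  also have "\<dots> = ennreal (b + (1 - measure (M n) G))"
    using G b by (simp add: emeasure_eq_measure prob_compl)
  finally have le: "ennreal (measure (random_graph M X \<kappa> n) A) \<le> ennreal (b + (1 - measure (M n) G))" .
  have "0 \<le> b + (1 - measure (M n) G)" using b by simp
  from le show ?thesis unfolding ennreal_le_iff[OF \<open>0 \<le> b + (1 - measure (M n) G)\<close>] .
qed

end

text \<open>Carries bounds that hold for all good deterministic sequences of types over to the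
  random graph; by concentration the remaining sequences have vanishing probability.\<close>

lemma (in rank1_exponential) random_graph_tendsto_0:
  fixes M :: "nat \<Rightarrow> 'w measure" and X :: "nat \<Rightarrow> nat \<Rightarrow> 'w \<Rightarrow> real" and A :: "nat \<Rightarrow> nat set set set"
  assumes vs: "vertex_space S \<mu> M X" and tc: "types_concentrated S \<mu> M X \<psi>"
    and ex: "\<exists>\<epsilon>>0. \<exists>q>0. \<exists>g. g \<longlonglongrightarrow> 0 \<and> (\<forall>\<^sub>F n in sequentially. \<forall>x. (\<forall>i\<in>{1..n}. x i \<in> S) \<longrightarrow>
      good_types \<epsilon> q n x \<longrightarrow> measure_pmf.prob (graph_given_types n (rank1_kernel c \<psi>) x) (A n) \<le> g n)"
  shows "(\<lambda>n. measure (random_graph M X (rank1_kernel c \<psi>) n) (A n)) \<longlonglongrightarrow> 0"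
proof -
  obtain \<epsilon> q g where \<epsilon>: "\<epsilon> > 0" "q > 0" and g: "g \<longlonglongrightarrow> 0"
    and ev: "\<forall>\<^sub>F n in sequentially. \<forall>x. (\<forall>i\<in>{1..n}. x i \<in> S) \<longrightarrow>
      good_types \<epsilon> q n x \<longrightarrow> measure_pmf.prob (graph_given_types n (rank1_kernel c \<psi>) x) (A n) \<le> g n"
    using ex by blast
  define G where "G n = {\<omega> \<in> space (M n). good_types \<epsilon> q n (\<lambda>i. X n i \<omega>)}" for n
  have G1: "(\<lambda>n. measure (M n) (G n)) \<longlonglongrightarrow> 1"
    using tc \<epsilon> unfolding types_concentrated_def G_def good_types_def by auto
  \<comment> \<open>A set that is not measurable has measure 0, so positive measure is what shows
    \<open>G n\<close> to be an event.\<close>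
  have Gev: "\<forall>\<^sub>F n in sequentially. measure (M n) (G n) > 0"
    using order_tendstoD(1)[OF G1, of 0] by simp
  have bound: "\<forall>\<^sub>F n in sequentially. measure (random_graph M X (rank1_kernel c \<psi>) n) (A n) \<le>
      \<bar>g n\<bar> + (1 - measure (M n) (G n))"
    using ev Gev eventually_ge_at_top[of 1]
  proof eventually_elim
    case (elim n)
    have GM: "G n \<in> sets (M n)"
      using elim(2) measure_notin_sets[of "G n" "M n"] by force
    have X: "X n i \<in> borel_measurable (M n)" "\<And>\<omega>. \<omega> \<in> space (M n) \<Longrightarrow> X n i \<omega> \<in> S" if "i \<in> {1..n}" for i
      using vs elim(3) that unfolding vertex_space_def by auto
    have M: "prob_space (M n)" using vs elim(3) unfolding vertex_space_def by auto
    show ?case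
    proof (rule prob_random_graph_le[where S = S and n = n and M = M and X = X and G = "G n"])
      fix \<omega> assume "\<omega> \<in> G n"
      then have "\<forall>i\<in>{1..n}. X n i \<omega> \<in> S" "good_types \<epsilon> q n (\<lambda>i. X n i \<omega>)" using X(2) by (auto simp: G_def)
      then have "measure_pmf.prob (graph_given_types n (rank1_kernel c \<psi>) (\<lambda>i. X n i \<omega>)) (A n) \<le> g n"
        using elim(1)[rule_format, of "\<lambda>i. X n i \<omega>"] by blast
      then show "measure_pmf.prob (graph_given_types n (rank1_kernel c \<psi>) (\<lambda>i. X n i \<omega>)) (A n) \<le> \<bar>g n\<bar>" by linarith
    qed (use countable_S M X GM in auto)
  qed
  show ?thesis
  proof (rule tendsto_sandwich[where f = "\<lambda>_. 0" and h = "\<lambda>n. \<bar>g n\<bar> + (1 - measure (M n) (G n))"])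
    have "(\<lambda>n. \<bar>g n\<bar> + (1 - measure (M n) (G n))) \<longlonglongrightarrow> \<bar>0\<bar> + (1 - 1)"
      by (intro tendsto_intros g G1)
    then show "(\<lambda>n. \<bar>g n\<bar> + (1 - measure (M n) (G n))) \<longlonglongrightarrow> 0" by simp
    show "(\<lambda>_. 0) \<longlonglongrightarrow> (0::real)" by simp
  qed (use bound in auto)
qed

section \<open>Convergence in probability from the two tail estimates\<close>

theorem theorem1p1:
  fixes S :: "real set" and \<mu> :: "real pmf" and \<psi> :: "real \<Rightarrow> real" and c :: real
    and M :: "nat \<Rightarrow> 'w measure" and X :: "nat \<Rightarrow> nat \<Rightarrow> 'w \<Rightarrow> real"
  assumes "S \<subseteq> {0..}" and "countable S" and "set_pmf \<mu> \<subseteq> S"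
    and "\<And>x. x \<in> S \<Longrightarrow> \<psi> x > 0" and "c > 0"
    and "vertex_space S \<mu> M X"
    and "graphical S \<mu> M X (rank1_kernel c \<psi>)"
    and "growth_condition S \<mu> \<psi>"
    and "types_concentrated S \<mu> M X \<psi>"
  shows "tendsto_in_prob (random_graph M X (rank1_kernel c \<psi>))
           (\<lambda>n E. C1 n E / ln n) (inv_log (r_radius S \<mu> \<psi> c))
       \<and> (ennreal c < c_cr S \<mu> \<psi> \<longrightarrow> r_radius S \<mu> \<psi> c > 1)
       \<and> (ennreal c \<ge> c_cr S \<mu> \<psi> \<longrightarrow> r_radius S \<mu> \<psi> c = 1)"
proof -
  have moment: "\<exists>a>0. integrable \<mu> (\<lambda>x. exp (a * \<psi> x))"
    using assms(2-4,8) by (rule growth_condition_exp_moment)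
  then have int: "integrable \<mu> \<psi>"
    using assms(3,4) by (intro exp_moment_imp_integrable) auto
  interpret rank1_exponential S \<mu> \<psi> c
    by unfold_locales (use assms moment int in auto)
  define R where "R = random_graph M X (rank1_kernel c \<psi>)"
  have types: "prob_space (M n)" "\<And>i. i \<in> {1..n} \<Longrightarrow> X n i \<in> borel_measurable (M n)"
    "\<And>i \<omega>. i \<in> {1..n} \<Longrightarrow> \<omega> \<in> space (M n) \<Longrightarrow> X n i \<omega> \<in> S" if "n \<ge> 1" for n
    using assms(6) that unfolding vertex_space_def by auto
  have R: "prob_space (R n)" "space (R n) = UNIV" "sets (R n) = UNIV" if "n \<ge> 1" for n
  proof -
    note * = prob_space_random_graph[where S = S and M = M and X = X and n = n]
      space_random_graph[where S = S and M = M and X = X and n = n]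
      sets_random_graph[where S = S and M = M and X = X and n = n]
    show "prob_space (R n)" "space (R n) = UNIV" "sets (R n) = UNIV"
      unfolding R_def by (rule *; use types[OF that] assms(2) in blast)+
  qed
  have lower: "(\<lambda>n. measure (R n) {E. C1 n E < \<alpha> * ln (real n)}) \<longlonglongrightarrow> 0"
    if "\<alpha> > 0" "r_radius S \<mu> \<psi> c < ereal (exp (1 / \<alpha>))" for \<alpha>
    unfolding R_def by (rule random_graph_tendsto_0[OF assms(6,9) C1_lower_tail[OF that]])
  have upper: "(\<lambda>n. measure (R n) {E. \<alpha> * ln (real n) < C1 n E}) \<longlonglongrightarrow> 0"
    if \<alpha>: "\<alpha> > 0" "ereal (exp (1 / \<alpha>)) < r_radius S \<mu> \<psi> c" for \<alpha>
    unfolding R_def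
  proof (rule random_graph_tendsto_0[OF assms(6,9)])
    obtain \<epsilon> q K \<beta> where eq: "\<epsilon> > 0" "q > 0" "\<beta> > 0"
      and le: "\<And>n x. n \<ge> 1 \<Longrightarrow> (\<forall>i\<in>{1..n}. x i \<in> S) \<Longrightarrow> good_types \<epsilon> q n x \<Longrightarrow>
        measure_pmf.prob (graph_given_types n (rank1_kernel c \<psi>) x) {E. \<alpha> * ln (real n) < C1 n E} \<le> K * real n powr -\<beta>"
      using C1_upper_tail[OF \<alpha>] by blast
    have "(\<lambda>n. K * real n powr -\<beta>) \<longlonglongrightarrow> 0" using eq(3) by real_asymp
    moreover have "\<forall>\<^sub>F n in sequentially. \<forall>x. (\<forall>i\<in>{1..n}. x i \<in> S) \<longrightarrow> good_types \<epsilon> q n x \<longrightarrow>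
        measure_pmf.prob (graph_given_types n (rank1_kernel c \<psi>) x) {E. \<alpha> * ln (real n) < C1 n E} \<le> K * real n powr -\<beta>"
      using eventually_ge_at_top[of 1] by eventually_elim (use le in blast)
    ultimately show "\<exists>\<epsilon>>0. \<exists>q>0. \<exists>g. g \<longlonglongrightarrow> 0 \<and> (\<forall>\<^sub>F n in sequentially. \<forall>x. (\<forall>i\<in>{1..n}. x i \<in> S) \<longrightarrow>
      good_types \<epsilon> q n x \<longrightarrow> measure_pmf.prob (graph_given_types n (rank1_kernel c \<psi>) x)
        {E. \<alpha> * ln (real n) < C1 n E} \<le> g n)"
      using eq(1,2) by blast
  qed
  \<comment> \<open>The radius is finite, so the limit is never 0.\<close>
  have "r_radius S \<mu> \<psi> c < \<infinity>" by (rule le_less_trans[OF r_radius_le]) (auto simp: max_def)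
  then obtain r where r: "r_radius S \<mu> \<psi> c = ereal r" "r \<ge> 1"
    using r_radius_ge_1 by (cases "r_radius S \<mu> \<psi> c") (auto simp: one_ereal_def)
  have "tendsto_in_prob R (\<lambda>n E. C1 n E / ln n) (inv_log (r_radius S \<mu> \<psi> c))"
  proof (cases "r = 1")
    case True
    then have inv: "inv_log (r_radius S \<mu> \<psi> c) = \<infinity>" by (simp add: inv_log_def r)
    have "(\<lambda>n. measure (R n) {E \<in> space (R n). C1 n E / ln n > B}) \<longlonglongrightarrow> 1" for B :: real
    proof -
      \<comment> \<open>For r = 1 every positive \<alpha> satisfies r < exp (1 / \<alpha>), so the
        lower tail applies at any level above B.\<close>
      define \<alpha> where "\<alpha> = max 1 (B + 1)"
      have \<alpha>: "\<alpha> > 0" "B < \<alpha>" by (auto simp: \<alpha>_def)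
      have lim: "(\<lambda>n. 1 - measure (R n) {E. C1 n E < \<alpha> * ln (real n)}) \<longlonglongrightarrow> 1 - 0"
        using \<alpha> True by (intro tendsto_diff tendsto_const lower) (auto simp: r)
      show ?thesis
      proof (rule tendsto_sandwich)
        show "\<forall>\<^sub>F n in sequentially. 1 - measure (R n) {E. C1 n E < \<alpha> * ln (real n)} \<le>
            measure (R n) {E \<in> space (R n). C1 n E / ln n > B}"
          \<comment> \<open>From n = 2 on, ln n is positive and inequalities may be divided by
            it.\<close>
          using eventually_ge_at_top[of 2]
        proof eventually_elim
          case (elim n)
          interpret Rn: prob_space "R n" using R elim by simp
          have ln: "ln (real n) > 0" using elim by simp
          have "1 - measure (R n) {E. C1 n E < \<alpha> * ln (real n)} = measure (R n) (space (R n) - {E. C1 n E < \<alpha> * ln (real n)})"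
            using R elim by (intro Rn.prob_compl[symmetric]) auto
          also have "\<dots> \<le> measure (R n) {E \<in> space (R n). C1 n E / ln n > B}"
          proof (intro Rn.finite_measure_mono subsetI)
            fix E assume "E \<in> space (R n) - {E. C1 n E < \<alpha> * ln (real n)}"
            then have "\<alpha> * ln (real n) \<le> C1 n E" "E \<in> space (R n)" by auto
            moreover have "B * ln (real n) < \<alpha> * ln (real n)"
              using \<alpha>(2) ln by (rule mult_strict_right_mono)
            ultimately have "B * ln (real n) < C1 n E" "E \<in> space (R n)" by linarith+
            then show "E \<in> {E \<in> space (R n). C1 n E / ln n > B}" using ln by (simp add: pos_less_divide_eq)
          qed (use R elim in auto)
          finally show ?case .
        qed
        show "\<forall>\<^sub>F n in sequentially. measure (R n) {E \<in> space (R n). C1 n E / ln n > B} \<le> 1"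
          using eventually_ge_at_top[of 1]
          by eventually_elim (use R in \<open>auto intro!: prob_space.prob_le_1\<close>)
      qed (use lim in auto)
    qed
    then show ?thesis by (simp add: tendsto_in_prob_def inv infinity_ereal_def[symmetric])
  next
    case False
    then have r1: "r > 1" using r by simp
    define a where "a = 1 / ln r"
    have lnr: "ln r > 0" using r1 by simp
    have a: "a > 0" using lnr by (simp add: a_def)
    have inv: "inv_log (r_radius S \<mu> \<psi> c) = ereal a"
      using lnr by (simp add: inv_log_def r a_def one_ereal_def)
    have "(\<lambda>n. measure (R n) {E \<in> space (R n). \<bar>C1 n E / ln n - a\<bar> > \<epsilon>}) \<longlonglongrightarrow> 0" if \<epsilon>: "\<epsilon> > 0" for \<epsilon>
    proof -
      have up: "(\<lambda>n. measure (R n) {E. (a + \<epsilon>) * ln (real n) < C1 n E}) \<longlonglongrightarrow> 0"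
      proof (rule upper)
        have "1 / (a + \<epsilon>) < 1 / a" using a \<epsilon> by (intro divide_strict_left_mono) auto
        then have "exp (1 / (a + \<epsilon>)) < exp (ln r)" unfolding exp_less_cancel_iff by (simp add: a_def)
        then show "ereal (exp (1 / (a + \<epsilon>))) < r_radius S \<mu> \<psi> c" using r1 by (simp add: r)
      qed (use a \<epsilon> in simp)
      \<comment> \<open>The first entry keeps the level positive when \<open>\<epsilon>\<close>
        exceeds the limit a.\<close>
      define \<alpha> where "\<alpha> = max (a / 2) (a - \<epsilon>)"
      have \<alpha>: "0 < \<alpha>" "\<alpha> < a" "a - \<epsilon> \<le> \<alpha>" using a \<epsilon> by (auto simp: \<alpha>_def)
      have low: "(\<lambda>n. measure (R n) {E. C1 n E < \<alpha> * ln (real n)}) \<longlonglongrightarrow> 0"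
      proof (rule lower)
        have "1 / a < 1 / \<alpha>" using a \<alpha> by (intro divide_strict_left_mono) auto
        then have "exp (ln r) < exp (1 / \<alpha>)" unfolding exp_less_cancel_iff by (simp add: a_def)
        then show "r_radius S \<mu> \<psi> c < ereal (exp (1 / \<alpha>))" using r1 by (simp add: r)
      qed (use \<alpha> in simp)
      show ?thesis
      proof (rule tendsto_sandwich[where f = "\<lambda>_. 0" and h = "\<lambda>n.
            measure (R n) {E. (a + \<epsilon>) * ln (real n) < C1 n E} + measure (R n) {E. C1 n E < \<alpha> * ln (real n)}"])
        show "\<forall>\<^sub>F n in sequentially. measure (R n) {E \<in> space (R n). \<bar>C1 n E / ln n - a\<bar> > \<epsilon>} \<le>
           measure (R n) {E. (a + \<epsilon>) * ln (real n) < C1 n E} + measure (R n) {E. C1 n E < \<alpha> * ln (real n)}"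
          using eventually_ge_at_top[of 2]
        proof eventually_elim
          case (elim n)
          interpret Rn: prob_space "R n" using R elim by simp
          have ln: "ln (real n) > 0" using elim by simp
          have "{E \<in> space (R n). \<bar>C1 n E / ln n - a\<bar> > \<epsilon>} \<subseteq>
              {E. (a + \<epsilon>) * ln (real n) < C1 n E} \<union> {E. C1 n E < \<alpha> * ln (real n)}"
          proof
            fix E assume E: "E \<in> {E \<in> space (R n). \<bar>C1 n E / ln n - a\<bar> > \<epsilon>}"
            then consider "a + \<epsilon> < C1 n E / ln n" | "C1 n E / ln n < a - \<epsilon>" by force
            then show "E \<in> {E. (a + \<epsilon>) * ln (real n) < C1 n E} \<union> {E. C1 n E < \<alpha> * ln (real n)}"
            proof cases
              case 1
              then show ?thesis using ln by (simp add: field_simps)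
            next
              case 2
              then have "C1 n E / ln n < \<alpha>" using \<alpha>(3) by linarith
              then show ?thesis using ln by (simp add: field_simps)
            qed
          qed
          then have "measure (R n) {E \<in> space (R n). \<bar>C1 n E / ln n - a\<bar> > \<epsilon>} \<le>
              measure (R n) ({E. (a + \<epsilon>) * ln (real n) < C1 n E} \<union> {E. C1 n E < \<alpha> * ln (real n)})"
            using R elim by (intro Rn.finite_measure_mono) auto
          also have "\<dots> \<le> measure (R n) {E. (a + \<epsilon>) * ln (real n) < C1 n E} + measure (R n) {E. C1 n E < \<alpha> * ln (real n)}"
            using R elim by (intro measure_Un_le) auto
          finally show ?case .
        qed
        show "(\<lambda>n. measure (R n) {E. (a + \<epsilon>) * ln (real n) < C1 n E} + measure (R n) {E. C1 n E < \<alpha> * ln (real n)}) \<longlonglongrightarrow> 0"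
          using tendsto_add[OF up low] by simp
        show "(\<lambda>_. 0) \<longlonglongrightarrow> (0::real)" by simp
      qed simp
    qed
    then show ?thesis by (simp add: tendsto_in_prob_def inv)
  qed
  then show ?thesis
    using r_radius_subcritical r_radius_supercritical unfolding R_def by blast
qed

end
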